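(* Let $\mathcal{O}$ be an Okubo algebra with isotropic norm over an arbitrary field $\mathbb{F}$. Then the orthogonality graph $\Gamma_O(\mathcal{O})$ is disconnected, and the vertex sets of its connected components are exactly the following: (1) the set $V_x=\{[x],[x*x]\}$ for any $x\in Z(\mathcal{O})$ such that $n(x,x*x)\neq 0$; (2) if $\mathcal{O}$ contains a nonzero idempotent, $\operatorname{char}\mathbb{F}\neq 3$ and $\mathbb{F}$ does not contain a primitive cube root of unity: the set $V'_x=\{[y] \mid 0\neq y\in O_{\mathcal{O}}(x)\}$ for any $x\in Z(\mathcal{O})$ such that $x*x=0$; (3) if $\mathcal{O}$ contains a nonzero idempotent, and either $\operatorname{char}\mathbb{F}=3$ or $\mathbb{F}$ contains a primitive cube root of unity: the set $V=\{[x]\mid x\in Z(\mathcal{O}),\ n(x,x*x)=0\}$. The diameter of the connected component on the vertex set $V_x$ equals $1$, on the vertex set $V'_x$ equals $2$, and on the vertex set $V$ equals $5$ if $\mathcal{O}$ is the split Okubo algebra and $3$ otherwise. (Moreover, if $\mathcal{O}$ contains a nonzero idempotent and $\operatorname{char}\mathbb{F}\neq 3$, then $\mathcal{O}$ is automatically split.)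
   Context: For a field $\mathbb{F}$ (arbitrary characteristic) and nonzero $\alpha,\beta\in\mathbb{F}$, let $\mathcal{O}_{\alpha,\beta}$ be the $8$-dimensional $\mathbb{F}$-algebra with basis $z_{1,0},z_{2,0},z_{0,1},z_{0,2},z_{1,1},z_{2,2},z_{1,2},z_{2,1}$ and (bilinear, non-associative) multiplication $*$ given by the table (the entry in row $a$, column $b$ is $a*b$): $$\begin{array}{c|cccccccc} * & z_{1,0} & z_{2,0} & z_{0,1} & z_{0,2} & z_{1,1} & z_{2,2} & z_{1,2} & z_{2,1}\\ \hline z_{1,0} & z_{2,0} & 0 & -z_{1,1} & 0 & -z_{2,1} & 0 & 0 & -\alpha z_{0,1}\\ z_{2,0} & 0 & \alpha z_{1,0} & 0 & -z_{2,2} & 0 & -\alpha z_{1,2} & -\alpha z_{0,2} & 0\\ z_{0,1} & 0 & -z_{2,1} & z_{0,2} & 0 & 0 & -\beta z_{2,0} & 0 & -z_{2,2}\\ z_{0,2} & -z_{1,2} & 0 & 0 & \beta z_{0,1} & -\beta z_{1,0} & 0 & -\beta z_{1,1} & 0\\ z_{1,1} & 0 & -\alpha z_{0,1} & -z_{1,2} & 0 & z_{2,2} & 0 & -\beta z_{2,0} & 0\\ z_{2,2} & -\alpha z_{0,2} & 0 & 0 & -\beta z_{2,1} & 0 & \alpha\beta z_{1,1} & 0 & -\alpha\beta z_{1,0}\\ z_{1,2} & -z_{2,2} & 0 & -\beta z_{1,0} & 0 & 0 & -\alpha\beta z_{0,1} & \beta z_{2,1} & 0\\ z_{2,1} & 0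 & -\alpha z_{1,1} & 0 & -\beta z_{2,0} & -\alpha z_{0,2} & 0 & 0 & \alpha z_{1,2}\end{array}$$ Its norm is the quadratic form $n$ with $n(z_{i,j})=0$ for all basis elements and polar form $n(a,b)=n(a+b)-n(a)-n(b)$ given on the basis by $n(z_{1,0},z_{2,0})=\alpha$, $n(z_{0,1},z_{0,2})=\beta$, $n(z_{1,1},z_{2,2})=n(z_{1,2},z_{2,1})=\alpha\beta$, and $0$ on all other pairs of basis elements. By the known classification, the Okubo algebras with isotropic norm over $\mathbb{F}$ are exactly the $\mathbb{F}$-algebras isomorphic to $\mathcal{O}_{\alpha,\beta}$ for some nonzero $\alpha,\beta\in\mathbb{F}$; take this as the definition, with $n$ transported along the isomorphism (it does not depend on the isomorphism, since $(x*y)*x=x*(y*x)=n(x)y$). The split Okubo algebra is $\mathcal{O}_{1,1}$ (up to isomorphism). $Z(\mathcal{O})$ is the set of zero divisors, i.e. nonzero $a$ such that $a*b=0$ or $b*a=0$ for some nonzero $b$; in $\mathcal{O}$ every zero divisor is two-sided (both a left and a right one). The orthogonalizer of $a$ is $O_{\mathcal{O}}(a)=\{b\in\mathcal{O}\mid a*b=b*a=0\}$. For $x\neq0$ write $[x]=\mathbb{F}x$. The orthogonality graph $\Gamma_O(\mathcal{O})$ is the undirected graph whose vertices are the lines $[a]$ with $a$ a two-sided zero divisor, two distinct vertices $[a],[b]$ being adjacent if and only if $a*b=b*a=0$. *)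

theory Defs
  imports "HOL-Analysis.Cartesian_Space" "Graph_Theory.Graph_Theory"
begin

section \<open>The algebras $\mathcal{O}_{\alpha,\beta}$\<close>

datatype okubo_index = Z10 | Z20 | Z01 | Z02 | Z11 | Z22 | Z12 | Z21

lemma UNIV_okubo_index: "UNIV = {Z10, Z20, Z01, Z02, Z11, Z22, Z12, Z21}"
  using okubo_index.exhaust by auto

instance okubo_index :: finite
  by standard (simp add: UNIV_okubo_index)

text \<open>The basis element $z_{i,j}$ is \<open>axis Zij 1\<close>, so that \<open>axis Zij c\<close> is $c z_{i,j}$.\<close>

fun okubo_table :: "'f::field \<Rightarrow> 'f \<Rightarrow> okubo_index \<Rightarrow> okubo_index \<Rightarrow> 'f ^ okubo_index" where
  "okubo_table \<alpha> \<beta> Z10 Z10 = axis Z20 1"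
| "okubo_table \<alpha> \<beta> Z10 Z01 = axis Z11 (- 1)"
| "okubo_table \<alpha> \<beta> Z10 Z11 = axis Z21 (- 1)"
| "okubo_table \<alpha> \<beta> Z10 Z21 = axis Z01 (- \<alpha>)"

| "okubo_table \<alpha> \<beta> Z20 Z20 = axis Z10 \<alpha>"
| "okubo_table \<alpha> \<beta> Z20 Z02 = axis Z22 (- 1)"
| "okubo_table \<alpha> \<beta> Z20 Z22 = axis Z12 (- \<alpha>)"
| "okubo_table \<alpha> \<beta> Z20 Z12 = axis Z02 (- \<alpha>)"

| "okubo_table \<alpha> \<beta> Z01 Z20 = axis Z21 (- 1)"
| "okubo_table \<alpha> \<beta> Z01 Z01 = axis Z02 1"
| "okubo_table \<alpha> \<beta> Z01 Z22 = axis Z20 (- \<beta>)"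
| "okubo_table \<alpha> \<beta> Z01 Z21 = axis Z22 (- 1)"

| "okubo_table \<alpha> \<beta> Z02 Z10 = axis Z12 (- 1)"
| "okubo_table \<alpha> \<beta> Z02 Z02 = axis Z01 \<beta>"
| "okubo_table \<alpha> \<beta> Z02 Z11 = axis Z10 (- \<beta>)"
| "okubo_table \<alpha> \<beta> Z02 Z12 = axis Z11 (- \<beta>)"

| "okubo_table \<alpha> \<beta> Z11 Z20 = axis Z01 (- \<alpha>)"
| "okubo_table \<alpha> \<beta> Z11 Z01 = axis Z12 (- 1)"
| "okubo_table \<alpha> \<beta> Z11 Z11 = axis Z22 1"
| "okubo_table \<alpha> \<beta> Z11 Z12 = axis Z20 (- \<beta>)"

| "okubo_table \<alpha> \<beta> Z22 Z10 = axis Z02 (- \<alpha>)"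
| "okubo_table \<alpha> \<beta> Z22 Z02 = axis Z21 (- \<beta>)"
| "okubo_table \<alpha> \<beta> Z22 Z22 = axis Z11 (\<alpha> * \<beta>)"
| "okubo_table \<alpha> \<beta> Z22 Z21 = axis Z10 (- (\<alpha> * \<beta>))"

| "okubo_table \<alpha> \<beta> Z12 Z10 = axis Z22 (- 1)"
| "okubo_table \<alpha> \<beta> Z12 Z01 = axis Z10 (- \<beta>)"
| "okubo_table \<alpha> \<beta> Z12 Z22 = axis Z01 (- (\<alpha> * \<beta>))"
| "okubo_table \<alpha> \<beta> Z12 Z12 = axis Z21 \<beta>"

| "okubo_table \<alpha> \<beta> Z21 Z20 = axis Z11 (- \<alpha>)"
| "okubo_table \<alpha> \<beta> Z21 Z02 = axis Z20 (- \<beta>)"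
| "okubo_table \<alpha> \<beta> Z21 Z11 = axis Z02 (- \<alpha>)"
| "okubo_table \<alpha> \<beta> Z21 Z21 = axis Z12 \<alpha>"

| "okubo_table _ _ _ _ = 0"

definition okubo_mult ::
  "'f::field \<Rightarrow> 'f \<Rightarrow> 'f ^ okubo_index \<Rightarrow> 'f ^ okubo_index \<Rightarrow> 'f ^ okubo_index" where
  "okubo_mult \<alpha> \<beta> x y = (\<Sum>i\<in>UNIV. \<Sum>j\<in>UNIV. (x $ i * y $ j) *s okubo_table \<alpha> \<beta> i j)"

text \<open>The quadratic form that vanishes on the basis and has the prescribed polar form on pairs of
  basis elements; see \<open>polar_okubo_norm_axis\<close> below.\<close>

definition okubo_norm :: "'f::field \<Rightarrow> 'f \<Rightarrow> 'f ^ okubo_index \<Rightarrow> 'f" where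
  "okubo_norm \<alpha> \<beta> x =
     \<alpha> * (x $ Z10 * x $ Z20) + \<beta> * (x $ Z01 * x $ Z02)
     + \<alpha> * \<beta> * (x $ Z11 * x $ Z22) + \<alpha> * \<beta> * (x $ Z12 * x $ Z21)"

definition polar :: "('a::ab_group_add \<Rightarrow> 'f::ab_group_add) \<Rightarrow> 'a \<Rightarrow> 'a \<Rightarrow> 'f" where
  "polar n a b = n (a + b) - n a - n b"

lemma okubo_mult_axis: "okubo_mult \<alpha> \<beta> (axis i 1) (axis j 1) = okubo_table \<alpha> \<beta> i j"
proof -
  have "okubo_mult \<alpha> \<beta> (axis i 1) (axis j 1) =
      (\<Sum>i'\<in>UNIV. \<Sum>j'\<in>UNIV. if i' = i then (if j' = j then okubo_table \<alpha> \<beta> i' j' else 0) else 0)"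
    unfolding okubo_mult_def by (intro sum.cong refl) (auto simp: axis_def)
  also have "\<dots> = (\<Sum>i'\<in>UNIV. if i' = i then okubo_table \<alpha> \<beta> i' j else 0)"
    by (intro sum.cong refl) (auto simp: sum.delta)
  finally show ?thesis by (simp add: sum.delta)
qed

lemma okubo_norm_axis: "okubo_norm \<alpha> \<beta> (axis i 1) = 0"
  by (cases i) (simp_all add: okubo_norm_def axis_def)

lemma polar_okubo_norm_axis:
  "polar (okubo_norm \<alpha> \<beta>) (axis i 1) (axis j 1) =
     (if {i, j} = {Z10, Z20} then \<alpha>
      else if {i, j} = {Z01, Z02} then \<beta>
      else if {i, j} = {Z11, Z22} \<or> {i, j} = {Z12, Z21} then \<alpha> * \<beta>
      else 0)"
  by (cases i; cases j; simp add: polar_def okubo_norm_def axis_def doubleton_eq_iff)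


section \<open>Okubo algebras with isotropic norm\<close>

text \<open>An algebra is given by its scalar multiplication and its product on a whole type.
  \<^const>\<open>Vector_Spaces.linear\<close> includes that \<open>smul\<close> is a vector space structure; bilinearity
  of \<open>mul\<close> follows from the isomorphism.\<close>

definition okubo_iso ::
  "('f::field \<Rightarrow> 'a::ab_group_add \<Rightarrow> 'a) \<Rightarrow> ('a \<Rightarrow> 'a \<Rightarrow> 'a) \<Rightarrow> 'f \<Rightarrow> 'f \<Rightarrow> ('a \<Rightarrow> 'f ^ okubo_index) \<Rightarrow> bool"
where
  "okubo_iso smul mul \<alpha> \<beta> \<phi> \<longleftrightarrow>
     Vector_Spaces.linear smul (*s) \<phi> \<and> bij \<phi> \<and>
     (\<forall>x y. \<phi> (mul x y) = okubo_mult \<alpha> \<beta> (\<phi> x) (\<phi> y))"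

definition isotropic_okubo ::
  "('f::field \<Rightarrow> 'a::ab_group_add \<Rightarrow> 'a) \<Rightarrow> ('a \<Rightarrow> 'a \<Rightarrow> 'a) \<Rightarrow> ('a \<Rightarrow> 'f) \<Rightarrow> bool" where
  "isotropic_okubo smul mul n \<longleftrightarrow>
     (\<exists>\<alpha> \<beta> \<phi>. \<alpha> \<noteq> 0 \<and> \<beta> \<noteq> 0 \<and> okubo_iso smul mul \<alpha> \<beta> \<phi> \<and> n = (\<lambda>x. okubo_norm \<alpha> \<beta> (\<phi> x)))"

definition split_okubo :: "('f::field \<Rightarrow> 'a::ab_group_add \<Rightarrow> 'a) \<Rightarrow> ('a \<Rightarrow> 'a \<Rightarrow> 'a) \<Rightarrow> bool" where
  "split_okubo smul mul \<longleftrightarrow> (\<exists>\<phi>. okubo_iso smul mul 1 1 \<phi>)"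

definition has_nonzero_idempotent :: "('a::zero \<Rightarrow> 'a \<Rightarrow> 'a) \<Rightarrow> bool" where
  "has_nonzero_idempotent mul \<longleftrightarrow> (\<exists>e. e \<noteq> 0 \<and> mul e e = e)"

definition primitive_cube_root_of_unity :: "'f::field \<Rightarrow> bool" where
  "primitive_cube_root_of_unity w \<longleftrightarrow> w ^ 3 = 1 \<and> w \<noteq> 1 \<and> w ^ 2 \<noteq> 1"


section \<open>Zero divisors and the orthogonality graph\<close>

definition zero_divisors :: "('a::zero \<Rightarrow> 'a \<Rightarrow> 'a) \<Rightarrow> 'a set" where
  "zero_divisors mul = {a. a \<noteq> 0 \<and> (\<exists>b. b \<noteq> 0 \<and> (mul a b = 0 \<or> mul b a = 0))}"

definition two_sided_zero_divisors :: "('a::zero \<Rightarrow> 'a \<Rightarrow> 'a) \<Rightarrow> 'a set" where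
  "two_sided_zero_divisors mul =
     {a. a \<noteq> 0 \<and> (\<exists>b. b \<noteq> 0 \<and> mul a b = 0) \<and> (\<exists>c. c \<noteq> 0 \<and> mul c a = 0)}"

definition orthogonalizer :: "('a::zero \<Rightarrow> 'a \<Rightarrow> 'a) \<Rightarrow> 'a \<Rightarrow> 'a set" where
  "orthogonalizer mul a = {b. mul a b = 0 \<and> mul b a = 0}"

definition line :: "('f \<Rightarrow> 'a \<Rightarrow> 'a) \<Rightarrow> 'a \<Rightarrow> 'a set" where
  "line smul x = range (\<lambda>c. smul c x)"

text \<open>Undirected graphs are represented as symmetric digraphs, whose strong components are the
  connected components of the undirected graph.\<close>

definition orthogonality_graph ::
  "('f \<Rightarrow> 'a::zero \<Rightarrow> 'a) \<Rightarrow> ('a \<Rightarrow> 'a \<Rightarrow> 'a) \<Rightarrow> ('a set, 'a set \<times> 'a set) pre_digraph" where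
  "orthogonality_graph smul mul = with_proj
     \<lparr> pverts = line smul ` two_sided_zero_divisors mul,
       parcs = {(line smul a, line smul b) | a b.
         a \<in> two_sided_zero_divisors mul \<and> b \<in> two_sided_zero_divisors mul \<and>
         line smul a \<noteq> line smul b \<and> mul a b = 0 \<and> mul b a = 0} \<rparr>"

lemma sym_digraph_orthogonality_graph: "sym_digraph (orthogonality_graph smul mul)"
  by unfold_locales
    (auto simp: orthogonality_graph_def symmetric_def intro!: symI)

text \<open>\<^term>\<open>wf_digraph.\<mu> G (\<lambda>_. 1) u v\<close> is the least length of a walk from \<open>u\<close> to \<open>v\<close>
  (infinity if there is none).\<close>

definition graph_diameter :: "('v, 'e) pre_digraph \<Rightarrow> ereal" where
  "graph_diameter G = (SUP u\<in>verts G. SUP v\<in>verts G. wf_digraph.\<mu> G (\<lambda>_. 1) u v)"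


section \<open>The vertex sets $V_x$, $V'_x$ and $V$\<close>

definition Vx :: "('f \<Rightarrow> 'a \<Rightarrow> 'a) \<Rightarrow> ('a \<Rightarrow> 'a \<Rightarrow> 'a) \<Rightarrow> 'a \<Rightarrow> 'a set set" where
  "Vx smul mul x = {line smul x, line smul (mul x x)}"

definition Vx' :: "('f \<Rightarrow> 'a::zero \<Rightarrow> 'a) \<Rightarrow> ('a \<Rightarrow> 'a \<Rightarrow> 'a) \<Rightarrow> 'a \<Rightarrow> 'a set set" where
  "Vx' smul mul x = {line smul y | y. y \<noteq> 0 \<and> y \<in> orthogonalizer mul x}"

definition V0 ::
  "('f::ab_group_add \<Rightarrow> 'a::ab_group_add \<Rightarrow> 'a) \<Rightarrow> ('a \<Rightarrow> 'a \<Rightarrow> 'a) \<Rightarrow> ('a \<Rightarrow> 'f) \<Rightarrow> 'a set set" where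
  "V0 smul mul n = {line smul x | x. x \<in> zero_divisors mul \<and> polar n x (mul x x) = 0}"

end

theory Submission
  imports Defs
begin

text \<open>For an isotropic $x$ one has $(x*x)*(x*x) = g(x) x$ with $g(x) = n(x,x*x)$. If $g(x) \neq 0$, then
  $[x*x]$ is the only neighbour of $[x]$. If $g(x) = 0$, then $[x]$ is equal or adjacent to a line $[u]$
  with $u*u = 0$, and such $u \neq 0$ exist if and only if there is a nonzero idempotent.

  Take $u*u = 0$, $n(u,v) = 1$ and $p = u*v$. Left multiplication by $p$ acts on the orthogonalizer of
  $u$ modulo $u$ as a root of $t^2+t+1$. If this polynomial has a root in the field, an eigenvector yields
  a second square-zero direction orthogonal to $u$, which can be chosen
  orthogonal for $n$ to any given square-zero $v$; as $n(u,v) = 0$ makes $u*v$ a common neighbour of $u$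
  and $v$, square-zero lines have distance at most 3. Elements with $g = 0$ and nonzero
  square hang off these lines as pendant vertices, whence the diameter 5. If there is no root, the
  square-zero lines are isolated from each other.

  Splitting is shown by exhibiting generators: if $y*x = 0$, $n(x,y) = 0$ and
  $g(x), g(y) \neq 0$, then the algebra is $\mathcal{O}_{g(x),g(y)}$, with $x$ and $y$ in the role of $z_{1,0}$
  and $z_{0,1}$. Outside characteristic 3, a square-zero
  element gives such a pair with $g(x) = g(y) = 1$. In characteristic 3, $g$ is additive and
  homogeneous for cubes, and an idempotent gives $g(x) = 1$; if $g(y)$ is not a cube, the square-zero
  elements form a plane with zero multiplication and the diameter drops to 3.\<close>

section \<open>Multiplication in coordinates\<close>

text \<open>The main tool is the linearised composition law, \<open>mul_flip_left\<close> and
  \<open>mul_flip_right\<close>: it exchanges the two outer factors of a triple product at the cost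
  of a polar value, so most products below are one flip away from a known one. Coordinates serve
  mainly for the basic identities and for explicit vertices. The locale keeps \<alpha>, \<beta> and
  \<phi> as parameters beside the product and the norm, so that the same algebra can be interpreted
  again in coordinates adapted to a given element.

  The lower bounds rest on one flip: a common neighbour b of u and v gives n(u,v) b = 0, so n(u,v)
  nonzero forces distance at least 3, and two pendants add 2.

  Characteristic 3 is separate because a factor 3 governs the key steps: t^2+t+1 becomes (t-1)^2,
  the mixed terms of the cubic form g vanish, and g(k u + v*b) no longer depends on k. The passage
  from an idempotent to a square-zero element likewise splits: if 3 is invertible it uses the
  commutator with the idempotent, whose cube is -3 times itself; if 3 = 0 it uses the additivity of
  g.\<close>

lemma sum_okubo_index:
  "(\<Sum>i\<in>UNIV. f i) = f Z10 + f Z20 + f Z01 + f Z02 + f Z11 + f Z22 + f Z12 + f Z21"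
  for f :: "okubo_index \<Rightarrow> 'b::comm_monoid_add"
  by (simp add: UNIV_okubo_index add_ac)

lemma okubo_index_all:
  "(\<forall>i. P i) \<longleftrightarrow> P Z10 \<and> P Z20 \<and> P Z01 \<and> P Z02 \<and> P Z11 \<and> P Z22 \<and> P Z12 \<and> P Z21"
  by (metis okubo_index.exhaust)

lemma okubo_mult_nth:
  "okubo_mult \<alpha> \<beta> x y $ Z10 = \<alpha> * x$Z20 * y$Z20 - \<beta> * x$Z02 * y$Z11 - \<alpha> * \<beta> * x$Z22 * y$Z21 - \<beta> * x$Z12 * y$Z01"
  "okubo_mult \<alpha> \<beta> x y $ Z20 = x$Z10 * y$Z10 - \<beta> * x$Z01 * y$Z22 - \<beta> * x$Z11 * y$Z12 - \<beta> * x$Z21 * y$Z02"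
  "okubo_mult \<alpha> \<beta> x y $ Z01 = \<beta> * x$Z02 * y$Z02 - \<alpha> * x$Z10 * y$Z21 - \<alpha> * x$Z11 * y$Z20 - \<alpha> * \<beta> * x$Z12 * y$Z22"
  "okubo_mult \<alpha> \<beta> x y $ Z02 = x$Z01 * y$Z01 - \<alpha> * x$Z20 * y$Z12 - \<alpha> * x$Z22 * y$Z10 - \<alpha> * x$Z21 * y$Z11"
  "okubo_mult \<alpha> \<beta> x y $ Z11 = \<alpha> * \<beta> * x$Z22 * y$Z22 - x$Z10 * y$Z01 - \<beta> * x$Z02 * y$Z12 - \<alpha> * x$Z21 * y$Z20"
  "okubo_mult \<alpha> \<beta> x y $ Z22 = x$Z11 * y$Z11 - x$Z20 * y$Z02 - x$Z01 * y$Z21 - x$Z12 * y$Z10"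
  "okubo_mult \<alpha> \<beta> x y $ Z12 = \<alpha> * x$Z21 * y$Z21 - \<alpha> * x$Z20 * y$Z22 - x$Z02 * y$Z10 - x$Z11 * y$Z01"
  "okubo_mult \<alpha> \<beta> x y $ Z21 = \<beta> * x$Z12 * y$Z12 - x$Z10 * y$Z11 - x$Z01 * y$Z20 - \<beta> * x$Z22 * y$Z02"
  by (simp_all add: okubo_mult_def sum_okubo_index axis_def algebra_simps)

lemma polar_okubo_norm:
  "polar (okubo_norm \<alpha> \<beta>) x y =
     \<alpha> * (x$Z10 * y$Z20 + x$Z20 * y$Z10) + \<beta> * (x$Z01 * y$Z02 + x$Z02 * y$Z01)
     + \<alpha> * \<beta> * (x$Z11 * y$Z22 + x$Z22 * y$Z11) + \<alpha> * \<beta> * (x$Z12 * y$Z21 + x$Z21 * y$Z12)"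
  by (simp add: polar_def okubo_norm_def algebra_simps)

lemma okubo_mult_mult_left:
  "okubo_mult \<alpha> \<beta> (okubo_mult \<alpha> \<beta> x y) x = okubo_norm \<alpha> \<beta> x *s y"
  by (simp add: vec_eq_iff okubo_index_all okubo_mult_nth okubo_norm_def algebra_simps)

lemma okubo_mult_mult_right:
  "okubo_mult \<alpha> \<beta> x (okubo_mult \<alpha> \<beta> y x) = okubo_norm \<alpha> \<beta> x *s y"
  by (simp add: vec_eq_iff okubo_index_all okubo_mult_nth okubo_norm_def algebra_simps)

lemma okubo_norm_mult:
  "okubo_norm \<alpha> \<beta> (okubo_mult \<alpha> \<beta> x y) = okubo_norm \<alpha> \<beta> x * okubo_norm \<alpha> \<beta> y"
  by (simp add: okubo_mult_nth okubo_norm_def algebra_simps)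

lemma polar_okubo_mult:
  "polar (okubo_norm \<alpha> \<beta>) (okubo_mult \<alpha> \<beta> x y) z = polar (okubo_norm \<alpha> \<beta>) x (okubo_mult \<alpha> \<beta> y z)"
  by (simp add: okubo_mult_nth polar_okubo_norm algebra_simps)

lemma okubo_mult_bilinear:
  "okubo_mult \<alpha> \<beta> (x + x') y = okubo_mult \<alpha> \<beta> x y + okubo_mult \<alpha> \<beta> x' y"
  "okubo_mult \<alpha> \<beta> x (y + y') = okubo_mult \<alpha> \<beta> x y + okubo_mult \<alpha> \<beta> x y'"
  "okubo_mult \<alpha> \<beta> (c *s x) y = c *s okubo_mult \<alpha> \<beta> x y"
  "okubo_mult \<alpha> \<beta> x (c *s y) = c *s okubo_mult \<alpha> \<beta> x y"
  by (simp_all add: vec_eq_iff okubo_index_all okubo_mult_nth algebra_simps)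

text \<open>Equivalently, commutators act as derivations (see \<open>\<delta>_mul\<close>). Together with the symmetric
  composition identities this separates Okubo algebras from para-Cayley algebras, except in
  characteristic 3.\<close>

lemma okubo_associator_cyclic:
  fixes x y z :: "'f::field ^ okubo_index" and \<alpha> \<beta> :: 'f
  defines "m \<equiv> okubo_mult \<alpha> \<beta>"
  shows "m (m x y) z + m (m y z) x + m (m z x) y = m x (m y z) + m y (m z x) + m z (m x y)"
  by (simp add: m_def vec_eq_iff okubo_index_all okubo_mult_nth algebra_simps)

section \<open>Identities of isotropic Okubo algebras\<close>

locale okubo_algebra =
  fixes smul :: "'f::field \<Rightarrow> 'a::ab_group_add \<Rightarrow> 'a" (infixr "\<odot>" 75)
    and mul :: "'a \<Rightarrow> 'a \<Rightarrow> 'a" (infixl "\<star>" 70)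
    and n :: "'a \<Rightarrow> 'f"
    and \<alpha> \<beta> :: 'f
    and \<phi> :: "'a \<Rightarrow> 'f ^ okubo_index"
  assumes iso: "okubo_iso smul mul \<alpha> \<beta> \<phi>"
    and \<alpha>: "\<alpha> \<noteq> 0" and \<beta>: "\<beta> \<noteq> 0"
    and n_eq: "n x = okubo_norm \<alpha> \<beta> (\<phi> x)"
begin

lemma linear_\<phi>: "Vector_Spaces.linear smul (*s) \<phi>"
  and bij_\<phi>: "bij \<phi>"
  and \<phi>_mul: "\<phi> (x \<star> y) = okubo_mult \<alpha> \<beta> (\<phi> x) (\<phi> y)"
  using iso by (auto simp: okubo_iso_def)

sublocale vs: vector_space smul
  using linear_\<phi> by (simp add: linear_iff_module_hom module_hom_def vector_space_def module_def)

sublocale lin: Vector_Spaces.linear smul "(*s)" \<phi>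
  by (rule linear_\<phi>)

lemma \<phi>_eq_iff: "\<phi> x = \<phi> y \<longleftrightarrow> x = y"
  using bij_\<phi> by (auto simp: bij_def inj_def)

lemmas \<phi>_simps = lin.add lin.diff lin.scale lin.neg lin.zero \<phi>_mul

abbreviation N :: "'a \<Rightarrow> 'a \<Rightarrow> 'f" where
  "N \<equiv> polar n"

lemma N_eq: "N x y = polar (okubo_norm \<alpha> \<beta>) (\<phi> x) (\<phi> y)"
  by (simp add: polar_def n_eq \<phi>_simps)

lemma mul_add_left: "(x + y) \<star> z = x \<star> z + y \<star> z"
  and mul_add_right: "z \<star> (x + y) = z \<star> x + z \<star> y"
  and mul_smul_left: "(c \<odot> x) \<star> y = c \<odot> (x \<star> y)"
  and mul_smul_right: "x \<star> (c \<odot> y) = c \<odot> (x \<star> y)"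
  by (simp_all add: \<phi>_eq_iff[symmetric] \<phi>_simps okubo_mult_bilinear)

lemma mul_zero_left [simp]: "0 \<star> x = 0"
  and mul_zero_right [simp]: "x \<star> 0 = 0"
  using mul_smul_left[of 0 x x] mul_smul_right[of x 0 x] by simp_all

lemma mul_minus_left: "(- x) \<star> y = - (x \<star> y)"
  and mul_minus_right: "x \<star> (- y) = - (x \<star> y)"
  using mul_smul_left[of "- 1" x y] mul_smul_right[of x "- 1" y] by simp_all

lemma mul_diff_left: "(x - y) \<star> z = x \<star> z - y \<star> z"
  and mul_diff_right: "z \<star> (x - y) = z \<star> x - z \<star> y"
  using mul_add_left[of x "- y" z] mul_add_right[of z x "- y"]
  by (simp_all add: mul_minus_left mul_minus_right)

lemmas mul_simps = mul_add_left mul_add_right mul_diff_left mul_diff_right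
  mul_minus_left mul_minus_right mul_smul_left mul_smul_right

lemma N_sym: "N x y = N y x"
  by (simp add: polar_def add.commute)

lemma N_add_left: "N (x + y) z = N x z + N y z"
  and N_add_right: "N z (x + y) = N z x + N z y"
  and N_smul_left: "N (c \<odot> x) y = c * N x y"
  and N_smul_right: "N x (c \<odot> y) = c * N x y"
  by (simp_all add: N_eq \<phi>_simps polar_okubo_norm algebra_simps)

lemma N_zero_left [simp]: "N 0 x = 0"
  and N_zero_right [simp]: "N x 0 = 0"
  using N_smul_left[of 0 x x] N_smul_right[of x 0 x] by simp_all

lemma N_minus_left: "N (- x) y = - N x y"
  and N_minus_right: "N x (- y) = - N x y"
  using N_smul_left[of "- 1" x y] N_smul_right[of x "- 1" y] by simp_all

lemma N_diff_left: "N (x - y) z = N x z - N y z"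
  and N_diff_right: "N z (x - y) = N z x - N z y"
  using N_add_left[of x "- y" z] N_add_right[of z x "- y"]
  by (simp_all add: N_minus_left N_minus_right)

lemmas N_simps = N_add_left N_add_right N_diff_left N_diff_right
  N_minus_left N_minus_right N_smul_left N_smul_right

lemma n_zero [simp]: "n 0 = 0"
  by (simp add: n_eq \<phi>_simps okubo_norm_def)

lemma n_add: "n (x + y) = n x + n y + N x y"
  by (simp add: polar_def)

lemma n_smul: "n (c \<odot> x) = c\<^sup>2 * n x"
  by (simp add: n_eq \<phi>_simps okubo_norm_def power2_eq_square algebra_simps)

lemma n_minus [simp]: "n (- x) = n x"
  using n_smul[of "- 1" x] by simp

lemma n_diff: "n (x - y) = n x + n y - N x y"
  using n_add[of x "- y"] by (simp add: N_minus_right)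

lemma N_self: "N x x = 2 * n x"
  by (simp add: N_eq n_eq polar_okubo_norm okubo_norm_def algebra_simps)

lemma n_mul: "n (x \<star> y) = n x * n y"
  by (simp add: n_eq \<phi>_simps okubo_norm_mult)

lemma mul_mul_same_left: "(x \<star> y) \<star> x = n x \<odot> y"
  and mul_mul_same_right: "x \<star> (y \<star> x) = n x \<odot> y"
  by (simp_all add: \<phi>_eq_iff[symmetric] \<phi>_simps n_eq okubo_mult_mult_left okubo_mult_mult_right)

text \<open>Linearisation of \<open>mul_mul_same_left\<close> in the repeated factor: apply it to x
  + z and cancel.\<close>

lemma mul_flip_left: "(x \<star> y) \<star> z = N x z \<odot> y - (z \<star> y) \<star> x"
proof -
  have "n (x + z) \<odot> y = (x \<star> y) \<star> x + (x \<star> y) \<star> z + ((z \<star> y) \<star> x + (z \<star> y) \<star> z)"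
    by (simp add: mul_mul_same_left[symmetric] mul_simps)
  then show ?thesis
    by (simp add: mul_mul_same_left n_add vs.scale_left_distrib algebra_simps)
qed

lemma mul_flip_right: "x \<star> (y \<star> z) = N x z \<odot> y - z \<star> (y \<star> x)"
proof -
  have "n (x + z) \<odot> y = x \<star> (y \<star> x) + x \<star> (y \<star> z) + (z \<star> (y \<star> x) + z \<star> (y \<star> z))"
    by (simp add: mul_mul_same_right[symmetric] mul_simps)
  then show ?thesis
    by (simp add: mul_mul_same_right n_add vs.scale_left_distrib algebra_simps)
qed

lemma N_mul: "N (x \<star> y) z = N x (y \<star> z)"
  by (simp add: N_eq \<phi>_simps polar_okubo_mult)

lemma N_cyclic: "N (x \<star> y) z = N (y \<star> z) x"
  using N_mul N_sym by metis

lemma N_mul_mul_left: "N (x \<star> y) (x \<star> z) = n x * N y z"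
proof -
  have "N (x \<star> y) (x \<star> z) = N ((x \<star> z) \<star> x) y"
    using N_mul N_sym by metis
  then show ?thesis
    by (simp add: mul_mul_same_left N_simps N_sym)
qed

lemma N_mul_mul_right: "N (y \<star> x) (z \<star> x) = n x * N y z"
  by (simp add: N_mul mul_mul_same_right N_simps)

lemma associator_cyclic:
  "(x \<star> y) \<star> z + (y \<star> z) \<star> x + (z \<star> x) \<star> y = x \<star> (y \<star> z) + y \<star> (z \<star> x) + z \<star> (x \<star> y)"
  by (simp add: \<phi>_eq_iff[symmetric] \<phi>_simps okubo_associator_cyclic)

lemma square_square: "(x \<star> x) \<star> (x \<star> x) = N x (x \<star> x) \<odot> x - n x \<odot> (x \<star> x)"
  by (simp add: mul_flip_left[of x x "x \<star> x"] mul_mul_same_left mul_simps)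

definition z :: "okubo_index \<Rightarrow> 'a" where
  "z i = inv \<phi> (axis i 1)"

lemma \<phi>_z: "\<phi> (z i) = axis i 1"
  using bij_\<phi> by (simp add: z_def bij_def surj_f_inv_f)

lemma n_z [simp]: "n (z i) = 0"
  by (simp add: n_eq \<phi>_z okubo_norm_axis)

lemma N_z: "N x (z Z10) = \<alpha> * \<phi> x $ Z20" "N x (z Z20) = \<alpha> * \<phi> x $ Z10"
  "N x (z Z01) = \<beta> * \<phi> x $ Z02" "N x (z Z02) = \<beta> * \<phi> x $ Z01"
  "N x (z Z11) = \<alpha> * \<beta> * \<phi> x $ Z22" "N x (z Z22) = \<alpha> * \<beta> * \<phi> x $ Z11"
  "N x (z Z12) = \<alpha> * \<beta> * \<phi> x $ Z21" "N x (z Z21) = \<alpha> * \<beta> * \<phi> x $ Z12"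
  by (simp_all add: N_eq polar_okubo_norm \<phi>_z axis_def)

lemma eq_0_iff: "x = 0 \<longleftrightarrow> (\<forall>i. \<phi> x $ i = 0)"
  using \<phi>_eq_iff[of x 0] by (simp add: \<phi>_simps vec_eq_iff)

lemma N_nondegenerate: "x = 0" if "\<And>y. N x y = 0"
  using that[of "z Z10"] that[of "z Z20"] that[of "z Z01"] that[of "z Z02"]
    that[of "z Z11"] that[of "z Z22"] that[of "z Z12"] that[of "z Z21"] \<alpha> \<beta>
  by (simp add: eq_0_iff okubo_index_all N_z)

lemma z_nonzero: "z i \<noteq> 0"
  using \<phi>_z[of i] by (metis axis_eq_0_iff lin.zero one_neq_zero)

text \<open>Three basis elements already determine all coordinates. The result makes the commutator
  with a nonzero idempotent a nonzero map, the starting point outside characteristic 3.\<close>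

lemma commutes_with_basis: "x = 0" if "\<And>i. x \<star> z i = z i \<star> x"
proof -
  have *: "okubo_mult \<alpha> \<beta> (\<phi> x) (axis i 1) = okubo_mult \<alpha> \<beta> (axis i 1) (\<phi> x)" for i
    using that[of i] by (metis \<phi>_mul \<phi>_z)
  from *[of Z10] *[of Z01] *[of Z11] show ?thesis
    using \<alpha> \<beta> by (simp add: eq_0_iff okubo_index_all vec_eq_iff okubo_mult_nth axis_def)
qed

text \<open>At most seven linear conditions on an 8-dimensional space. Indexing them by the basis
  itself, with one slot filled by 0, turns them into an endomorphism \<open>h\<close> whose image
  misses one axis, so that it is not injective.\<close>

lemma exists_orthogonal:
  fixes a :: "okubo_index \<Rightarrow> 'a"
  assumes "a i = 0"
  obtains y where "y \<noteq> 0" "\<And>j. N (a j) y = 0"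
proof -
  define h where "h v = (\<chi> j. N (a j) (inv \<phi> v))" for v
  have inv: "inv \<phi> (\<phi> x) = x" "\<phi> (inv \<phi> v) = v" for x v
    using bij_\<phi> by (simp_all add: bij_def surj_f_inv_f)
  have "inv \<phi> (v + w) = inv \<phi> v + inv \<phi> w" "inv \<phi> (c *s v) = c \<odot> inv \<phi> v" for v w c
    by (metis inv lin.add, metis inv lin.scale)
  then have "Vector_Spaces.linear (*s) (*s) h"
    by (simp add: Vector_Spaces.linear_iff vec.vector_space_axioms h_def vec_eq_iff N_simps)
  moreover have "axis i 1 \<notin> range h"
  proof
    assume "axis i 1 \<in> range h"
    then obtain v where "axis i 1 = h v"
      by blast
    then have "axis i 1 $ i = h v $ i"
      by simp
    then show False
      using assms by (simp add: h_def axis_def)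
  qed
  ultimately have "\<not> inj h"
    using vec.linear_inj_imp_surj[of h] UNIV_I by metis
  then obtain v w where "h v = h w" "v \<noteq> w"
    by (auto simp: inj_def)
  then have "h (v - w) = 0" "v - w \<noteq> 0"
    using \<open>Vector_Spaces.linear _ _ h\<close> by (auto simp: vec.linear_diff)
  show thesis
  proof
    show "inv \<phi> (v - w) \<noteq> 0"
      using \<open>v - w \<noteq> 0\<close> by (metis inv(2) lin.zero)
    show "N (a j) (inv \<phi> (v - w)) = 0" for j
      using \<open>h (v - w) = 0\<close> by (simp add: h_def vec_eq_iff)
  qed
qed

lemma exists_orthogonal4:
  obtains y where "y \<noteq> 0" "N a y = 0" "N b y = 0" "N c y = 0" "N d y = 0"
proof (rule exists_orthogonal[of "\<lambda>j. case j of Z10 \<Rightarrow> a | Z20 \<Rightarrow> b | Z01 \<Rightarrow> c | Z02 \<Rightarrow> d | _ \<Rightarrow> 0" Z11])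
  fix y assume "y \<noteq> 0"
    and *: "\<And>j. N (case j of Z10 \<Rightarrow> a | Z20 \<Rightarrow> b | Z01 \<Rightarrow> c | Z02 \<Rightarrow> d | _ \<Rightarrow> 0) y = 0"
  then show thesis
    using that *[of Z10] *[of Z20] *[of Z01] *[of Z02] by simp
qed simp

end

section \<open>Orthogonalizers of square-zero elements\<close>

context okubo_algebra
begin

abbreviation g :: "'a \<Rightarrow> 'f" where
  "g x \<equiv> N x (x \<star> x)"

abbreviation Orth :: "'a \<Rightarrow> 'a set" where
  "Orth \<equiv> orthogonalizer mul"

lemma Orth_left: "b \<in> Orth x \<Longrightarrow> x \<star> b = 0"
  and Orth_sym: "b \<in> Orth x \<longleftrightarrow> x \<in> Orth b"
  by (auto simp: orthogonalizer_def)

lemma Orth_add: "b \<in> Orth x \<Longrightarrow> c \<in> Orth x \<Longrightarrow> b + c \<in> Orth x"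
  and Orth_diff: "b \<in> Orth x \<Longrightarrow> c \<in> Orth x \<Longrightarrow> b - c \<in> Orth x"
  and Orth_smul: "b \<in> Orth x \<Longrightarrow> k \<odot> b \<in> Orth x"
  by (auto simp: orthogonalizer_def mul_simps)

lemma n_eq_0_if_mul_eq_0:
  assumes "x \<star> y = 0" shows "y \<noteq> 0 \<Longrightarrow> n x = 0" and "x \<noteq> 0 \<Longrightarrow> n y = 0"
  using mul_mul_same_left[of x y] mul_mul_same_right[of y x] assms by auto

lemma square_in_Orth: "n x = 0 \<Longrightarrow> x \<star> x \<in> Orth x"
  by (simp add: orthogonalizer_def mul_mul_same_left mul_mul_same_right)

text \<open>An isotropic x is annihilated on both sides by x*x, or by x itself if that square is
  0.\<close>

lemma zero_divisors_eq: "zero_divisors mul = {x. x \<noteq> 0 \<and> n x = 0}"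
proof -
  have "\<exists>b. b \<noteq> 0 \<and> x \<star> b = 0" if "n x = 0" "x \<noteq> 0" for x
    using that square_in_Orth[of x] by (cases "x \<star> x = 0") (auto simp: orthogonalizer_def)
  then show ?thesis
    using n_eq_0_if_mul_eq_0 by (fastforce simp: zero_divisors_def)
qed

lemma two_sided_zero_divisors_eq: "two_sided_zero_divisors mul = {x. x \<noteq> 0 \<and> n x = 0}"
proof -
  have "\<exists>b. b \<noteq> 0 \<and> x \<star> b = 0 \<and> b \<star> x = 0" if "n x = 0" "x \<noteq> 0" for x
    using that square_in_Orth[of x] by (cases "x \<star> x = 0") (auto simp: orthogonalizer_def)
  then show ?thesis
    using n_eq_0_if_mul_eq_0 by (fastforce simp: two_sided_zero_divisors_def)
qed

lemma square_mul_orthogonal: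
  assumes "b \<in> Orth x"
  shows "(x \<star> x) \<star> b = N x b \<odot> x" "b \<star> (x \<star> x) = N x b \<odot> x"
  using mul_flip_left[of x x b] mul_flip_right[of b x x] assms by (simp_all add: orthogonalizer_def N_sym)

lemma square_square_isotropic: "n x = 0 \<Longrightarrow> (x \<star> x) \<star> (x \<star> x) = g x \<odot> x"
  by (simp add: square_square)

text \<open>Removing from b its component along x*x leaves an element b' with x*b' = (x*x)*b' = 0.
  The flip of (x*b')*(x*x) then gives g(x) b' = 0.\<close>

lemma Orth_of_g_nonzero:
  assumes "n x = 0" "g x \<noteq> 0" "b \<in> Orth x"
  shows "\<exists>c. b = c \<odot> (x \<star> x)"
proof -
  let ?u = "x \<star> x" and ?c = "N x b / g x"
  have u: "x \<star> ?u = 0" "?u \<star> x = 0" "?u \<noteq> 0"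
    using square_in_Orth[OF assms(1)] assms(2) by (auto simp: orthogonalizer_def)
  let ?b = "b - ?c \<odot> ?u"
  have "?u \<star> ?b = 0"
    using assms by (simp add: mul_simps square_mul_orthogonal square_square_isotropic)
  moreover have "x \<star> ?b = 0"
    using u assms(3) by (simp add: mul_simps orthogonalizer_def)
  ultimately have "g x \<odot> ?b = 0"
    using mul_flip_left[of x ?b ?u] by simp
  then show ?thesis
    using assms(2) by auto
qed

text \<open>Evaluate ((x*x)*b)*x in two ways: it is n(x,b) x*x, while the flip gives g(x) b = 0.
  Hence n(x,b) = 0 unless x*x = 0, and n(x,b) is the only obstruction by
  \<open>square_mul_orthogonal\<close>.\<close>

lemma Orth_subset_Orth_square:
  assumes "n x = 0" "g x = 0" shows "Orth x \<subseteq> Orth (x \<star> x)"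
proof
  fix b assume b: "b \<in> Orth x"
  show "b \<in> Orth (x \<star> x)"
  proof (cases "x \<star> x = 0")
    case False
    have "N x b \<odot> (x \<star> x) = 0"
      using mul_flip_left[of "x \<star> x" b x] b assms(2)
      by (simp add: square_mul_orthogonal[OF b] mul_simps orthogonalizer_def N_sym)
    with False have "N x b = 0"
      by simp
    then show ?thesis
      by (simp add: orthogonalizer_def square_mul_orthogonal[OF b])
  qed (simp add: orthogonalizer_def)
qed

lemma square_zero_isotropic: "u \<star> u = 0 \<Longrightarrow> n u = 0"
  using n_eq_0_if_mul_eq_0[of u u] by (cases "u = 0") auto

lemma exists_dual:
  assumes "u \<noteq> 0" obtains v where "N u v = 1"
proof -
  obtain y where "N u y \<noteq> 0"
    using assms N_nondegenerate by blast
  then have "N u (inverse (N u y) \<odot> y) = 1"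
    by (simp add: N_simps)
  then show thesis ..
qed

end

locale square_zero = okubo_algebra smul mul n \<alpha> \<beta> \<phi>
  for smul :: "'f::field \<Rightarrow> 'a::ab_group_add \<Rightarrow> 'a" (infixr "\<odot>" 75)
    and mul :: "'a \<Rightarrow> 'a \<Rightarrow> 'a" (infixl "\<star>" 70) and n \<alpha> \<beta> \<phi> +
  fixes u v :: 'a
  assumes uu [simp]: "u \<star> u = 0" and N_uv [simp]: "N u v = 1"
begin

text \<open>If v is chosen as in \<open>exists_isotropic_dual\<close>, then \<open>- (p + r)\<close>
  is an idempotent. The element \<open>- r\<close> serves later as a first generator.\<close>

definition p :: 'a where "p = u \<star> v"
definition r :: 'a where "r = v \<star> u"

lemma N_vu [simp]: "N v u = 1"
  using N_uv by (simp only: N_sym)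

lemma n_u [simp]: "n u = 0"
  by (rule square_zero_isotropic) simp

lemma u_nonzero: "u \<noteq> 0"
  using N_uv by (metis N_zero_left zero_neq_one)

lemma p_mul_u [simp]: "p \<star> u = 0" and u_mul_r [simp]: "u \<star> r = 0"
  by (simp_all add: p_def r_def mul_mul_same_left mul_mul_same_right)

lemma u_mul_p [simp]: "u \<star> p = u" and r_mul_u [simp]: "r \<star> u = u"
  using mul_flip_right[of u u v] mul_flip_left[of v u u] by (simp_all add: p_def r_def)

lemma N_u_mul [simp]: "N u (x \<star> u) = 0" "N u (u \<star> x) = 0"
  using N_cyclic[of x u u] N_mul[of u u x] by (simp_all add: N_sym)

lemma N_u_p [simp]: "N u p = 0" "N p u = 0" and N_u_r [simp]: "N u r = 0" "N r u = 0"
  by (simp_all add: p_def r_def N_sym[of _ u])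

lemma N_p_r [simp]: "N p r = 1" "N r p = 1"
  using N_mul[of v u p] N_sym[of r p] by (simp_all add: r_def[symmetric])

lemma p_mul_v: "p \<star> v = v - (v \<star> v) \<star> u"
  using mul_flip_left[of u v v] by (simp add: p_def)

lemma p_mul_p: "p \<star> p = N u (v \<star> v) \<odot> u - r"
proof -
  have "p \<star> p = - ((p \<star> v) \<star> u)"
    using mul_flip_left[of u v p] by (simp add: p_def[symmetric])
  also have "\<dots> = ((v \<star> v) \<star> u) \<star> u - r"
    by (simp add: p_mul_v mul_simps r_def)
  also have "((v \<star> v) \<star> u) \<star> u = N u (v \<star> v) \<odot> u"
    using mul_flip_left[of "v \<star> v" u u] by (simp add: N_sym)
  finally show ?thesis .
qed

lemma N_Orth_u: "b \<in> Orth u \<Longrightarrow> N u b = 0" "b \<in> Orth u \<Longrightarrow> N b u = 0"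
  using mul_flip_left[of u u b] u_nonzero by (simp_all add: orthogonalizer_def N_sym)

lemma n_Orth_u: "b \<in> Orth u \<Longrightarrow> n b = 0"
  using n_eq_0_if_mul_eq_0(2)[of u b] u_nonzero by (simp add: orthogonalizer_def)

text \<open>A flip with n(u,v) = 1. It shows that the orthogonalizer lies in the images of both
  multiplications by u, with explicit preimages built from v.\<close>

lemma Orth_u_recover: assumes "b \<in> Orth u" shows "(v \<star> b) \<star> u = b" "u \<star> (b \<star> v) = b"
  using mul_flip_left[of v b u] mul_flip_right[of u b v] assms by (simp_all add: orthogonalizer_def)

lemma p_mul_in_Orth: assumes "b \<in> Orth u" shows "p \<star> b \<in> Orth u"
  using mul_flip_right[of u p b] mul_flip_left[of p b u] assms N_Orth_u[OF assms]
  by (simp add: orthogonalizer_def)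

text \<open>With \<open>p_mul_in_Orth\<close>, left multiplication by p preserves the part of the
  orthogonalizer that is orthogonal to v for the norm. There the u-term of its quadratic relation
  disappears, so t^2+t+1 annihilates it exactly.\<close>

lemma N_p_mul_v: assumes "b \<in> Orth u" shows "N (p \<star> b) v = 0"
proof -
  have "N (p \<star> b) v = N (u \<star> v) (b \<star> v)"
    by (simp only: N_mul p_def)
  then show ?thesis
    using N_Orth_u[OF assms] by (simp add: N_mul_mul_right)
qed

lemma mul_p: assumes "b \<in> Orth u" shows "b \<star> p = N b v \<odot> u"
  using mul_flip_right[of b u v] assms by (simp add: orthogonalizer_def p_def)

lemma r_mul: assumes "b \<in> Orth u" shows "r \<star> b = N b v \<odot> u"
  using mul_flip_left[of v u b] assms by (simp add: orthogonalizer_def r_def N_sym)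

text \<open>Modulo \<open>u\<close>, left multiplication by \<open>p\<close> on the orthogonalizer of \<open>u\<close> is a root of
  $t^2 + t + 1$; its eigenvectors are the square-zero neighbours of \<open>u\<close>.\<close>

lemma p_mul_p_mul: assumes "b \<in> Orth u" shows "p \<star> (p \<star> b) + p \<star> b + b = N b v \<odot> u"
proof -
  have b: "u \<star> b = 0" "b \<star> u = 0"
    using assms by (simp_all add: orthogonalizer_def)
  have "N p b = 0"
    using b N_mul[of u v b] N_cyclic[of v b u] by (simp add: p_def N_sym)
  then have "p \<star> (p \<star> b) = - (b \<star> (p \<star> p))"
    using mul_flip_right[of p p b] by simp
  also have "\<dots> = b \<star> r"
    using b by (simp add: p_mul_p mul_simps)
  also have "\<dots> = - (u \<star> (v \<star> b))"
    using mul_flip_right[of b v u] N_Orth_u[OF assms] by (simp add: r_def)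
  finally show ?thesis
    using associator_cyclic[of u v b] mul_p[OF assms] Orth_u_recover(1)[OF assms] b
    by (simp add: p_def[symmetric]) (simp add: algebra_simps)
qed

lemma u_mul_in_Orth: assumes "N u y = 0" shows "u \<star> y \<in> Orth u" "y \<star> u \<in> Orth u"
  using mul_flip_right[of u u y] mul_flip_left[of y u u] assms
  by (simp_all add: orthogonalizer_def mul_mul_same_left mul_mul_same_right N_sym)

lemma square_u_mul: assumes "N u y = 0"
  shows "(u \<star> y) \<star> (u \<star> y) = N u (y \<star> y) \<odot> u" "(y \<star> u) \<star> (y \<star> u) = N u (y \<star> y) \<odot> u"
proof -
  have *: "(u \<star> y) \<star> y = - ((y \<star> y) \<star> u)" "y \<star> (y \<star> u) = - (u \<star> (y \<star> y))"
    using mul_flip_left[of u y y] mul_flip_right[of y y u] assms by (simp_all add: N_sym)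
  have "(u \<star> y) \<star> (u \<star> y) = - (((u \<star> y) \<star> y) \<star> u)"
    using mul_flip_left[of u y "u \<star> y"] by simp
  also have "\<dots> = ((y \<star> y) \<star> u) \<star> u"
    by (simp add: * mul_simps)
  also have "\<dots> = N u (y \<star> y) \<odot> u"
    using mul_flip_left[of "y \<star> y" u u] by (simp add: N_sym)
  finally show "(u \<star> y) \<star> (u \<star> y) = N u (y \<star> y) \<odot> u" .
  have "(y \<star> u) \<star> (y \<star> u) = - (u \<star> (y \<star> (y \<star> u)))"
    using mul_flip_right[of "y \<star> u" y u] N_sym[of "y \<star> u" u] by simp
  also have "\<dots> = u \<star> (u \<star> (y \<star> y))"
    by (simp add: * mul_simps)
  also have "\<dots> = N u (y \<star> y) \<odot> u"
    using mul_flip_right[of u u "y \<star> y"] by simp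
  finally show "(y \<star> u) \<star> (y \<star> u) = N u (y \<star> y) \<odot> u" .
qed

text \<open>Since b = u*(b*v) with b*v orthogonal to u, \<open>square_u_mul\<close> puts b*b on the
  line of u. Pairing with v reads off the coefficient.\<close>

lemma Orth_u_square: assumes "b \<in> Orth u" shows "b \<star> b = N v (b \<star> b) \<odot> u"
proof -
  let ?t = "b \<star> v"
  have t: "N u ?t = 0"
    using N_mul[of u b v] assms by (simp add: orthogonalizer_def)
  have "b \<star> b = N u (?t \<star> ?t) \<odot> u"
    using square_u_mul(1)[OF t] by (simp add: Orth_u_recover(2)[OF assms])
  then show ?thesis
    by (simp add: N_simps)
qed

lemma exists_in_Orth_u: obtains b where "b \<in> Orth u" "b \<noteq> 0" "N b v = 0"
proof -
  obtain y where y: "y \<noteq> 0" "N u y = 0" "N v y = 0" "N p y = 0" "N r y = 0"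
    by (rule exists_orthogonal4)
  then obtain w where w: "N y w \<noteq> 0"
    using N_nondegenerate by blast
  \<comment> \<open>w is corrected along v and p, both orthogonal to y: this enforces n(u,x) =
    n(r,x) = 0 and keeps n(y,x) nonzero.\<close>
  define x where "x = w - N u w \<odot> v - (N r w - N u w * N r v) \<odot> p"
  have x: "N u x = 0" "N r x = 0" "N y x = N y w"
    using y by (simp_all add: x_def N_simps N_sym[of y])
  \<comment> \<open>The flip y*(u*x) + x*(u*y) = n(y,x) u shows that the two products cannot both
    vanish.\<close>
  have "u \<star> y \<noteq> 0 \<or> u \<star> x \<noteq> 0"
    using mul_flip_right[of y u x] w x(3) u_nonzero by auto
  moreover have "N (u \<star> a) v = N r a" for a
    using N_cyclic[of v u a] by (simp add: r_def)
  ultimately show thesis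
    using that[of "u \<star> y"] that[of "u \<star> x"] x y u_mul_in_Orth by auto
qed

text \<open>a*(p*a) = n(a) p = 0, and the left side is c times a*a.\<close>

lemma eigenvector_square_zero:
  assumes "a \<in> Orth u" "p \<star> a = c \<odot> a" "c \<noteq> 0" shows "a \<star> a = 0"
  using mul_mul_same_right[of a p] n_Orth_u[OF assms(1)] assms(2,3) by (simp add: mul_simps)

text \<open>Factor t^2+t+1 = (t-\<omega>)(t+1+\<omega>). Either b is an eigenvector of left
  multiplication by p for \<omega>, or p*b - \<omega> b is one for -1-\<omega>; both eigenvalues are
  nonzero.\<close>

lemma exists_square_zero_in_Orth_u:
  fixes \<omega> :: 'f
  assumes "\<omega>\<^sup>2 + \<omega> + 1 = 0"
  obtains a where "a \<in> Orth u" "a \<noteq> 0" "N a v = 0" "a \<star> a = 0"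
proof -
  have nz: "\<omega> \<noteq> 0" "- 1 - \<omega> \<noteq> 0"
    using assms by (auto simp: power2_eq_square diff_eq_eq)
  obtain b where b: "b \<in> Orth u" "b \<noteq> 0" "N b v = 0"
    by (rule exists_in_Orth_u)
  let ?a = "p \<star> b - \<omega> \<odot> b"
  show thesis
  proof (cases "?a = 0")
    case True
    then show thesis
      using that[of b] b eigenvector_square_zero[of b \<omega>] nz by simp
  next
    case False
    have a: "?a \<in> Orth u"
      by (intro Orth_diff Orth_smul p_mul_in_Orth b)
    have "p \<star> (p \<star> b) = - (p \<star> b) - b"
      using p_mul_p_mul[OF b(1)] b(3) by (simp add: eq_neg_iff_add_eq_0 algebra_simps)
    then have "p \<star> ?a = - (p \<star> b) - b - \<omega> \<odot> (p \<star> b)"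
      by (simp add: mul_simps)
    \<comment> \<open>The coefficient 1 of b is written so that rewriting with the root equation
      turns it into -\<omega>^2-\<omega>, a multiple of \<omega>.\<close>
    also have "\<dots> = (- 1 - \<omega>) \<odot> (p \<star> b) - (\<omega>\<^sup>2 + \<omega> + 1 - \<omega>\<^sup>2 - \<omega>) \<odot> b"
      by (simp add: vs.scale_left_diff_distrib)
    also have "\<dots> = (- 1 - \<omega>) \<odot> ?a"
      unfolding assms
      by (simp add: vs.scale_right_diff_distrib vs.scale_left_diff_distrib power2_eq_square algebra_simps)
    finally show thesis
      using that[of ?a] False a eigenvector_square_zero[OF a] nz b(3)
      by (simp add: N_simps N_p_mul_v b(1))
  qed
qed

end

context okubo_algebra
begin

text \<open>Three corrections of an arbitrary dual element. Subtracting n(v0) u kills the norm;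
  subtracting c p kills n(u,v*v) but makes the norm -c^2; adding c^2 u repairs the norm without
  changing n(u,v*v).\<close>

lemma exists_isotropic_dual:
  assumes "u \<noteq> 0" "u \<star> u = 0"
  obtains v where "N u v = 1" "n v = 0" "N u (v \<star> v) = 0"
proof -
  obtain v0 where "N u v0 = 1"
    using exists_dual[OF assms(1)] .
  define v1 where "v1 = v0 - n v0 \<odot> u"
  have nu: "n u = 0"
    using square_zero_isotropic assms by simp
  have v1: "N u v1 = 1" "n v1 = 0"
    using \<open>N u v0 = 1\<close> nu by (simp_all add: v1_def N_simps N_self n_diff n_smul N_sym[of v0])
  interpret s: square_zero smul mul n \<alpha> \<beta> \<phi> u v1
    by unfold_locales (use v1 assms in auto)
  define c where "c = N u (v1 \<star> v1)"
  define v2 where "v2 = v1 - c \<odot> s.p"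
  have p: "n s.p = 0" "N v1 s.p = c" "v1 \<star> s.p = 0"
    using v1 nu N_cyclic[of u v1 v1] by (simp_all add: s.p_def n_mul mul_mul_same_right c_def N_sym)
  have v2: "N u v2 = 1" "n v2 = - c\<^sup>2" "N u (v2 \<star> v2) = 0"
    using v1 p
    by (simp_all add: v2_def N_simps n_diff n_smul mul_simps s.p_mul_v s.p_mul_p c_def[symmetric]
        power2_eq_square N_self)
  define v where "v = v2 + c\<^sup>2 \<odot> u"
  show thesis
  proof
    show "N u v = 1" "n v = 0" "N u (v \<star> v) = 0"
      using v2 nu assms
      by (simp_all add: v_def N_simps n_add n_smul N_self N_sym[of v2] mul_simps)
  qed
qed

text \<open>For normalised v the products are p*p = -r, r*r = -p and p*r = r*p = 0, so -(p+r) is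
  idempotent. It is nonzero because n(p+r) = n(p,r) = 1.\<close>

lemma idempotent_of_square_zero:
  assumes "u \<noteq> 0" "u \<star> u = 0"
  shows "has_nonzero_idempotent mul"
proof -
  obtain v where v: "N u v = 1" "n v = 0" "N u (v \<star> v) = 0"
    using exists_isotropic_dual[OF assms] .
  interpret s: square_zero smul mul n \<alpha> \<beta> \<phi> u v
    by unfold_locales (use v assms in auto)
  have "s.r \<star> s.r = - s.p"
    using mul_flip_left[of v u s.r] N_mul[of v v u] v(3)
    by (simp add: s.r_def[symmetric]) (simp add: s.p_def s.r_def N_sym)
  moreover have "s.p \<star> s.r = 0"
    using mul_flip_left[of u v s.r] v(2) by (simp add: s.p_def[symmetric]) (simp add: s.r_def mul_mul_same_left)
  moreover have "s.r \<star> s.p = 0"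
    using mul_flip_left[of v u s.p] N_cyclic[of u v v] v(3)
    by (simp add: s.r_def[symmetric]) (simp add: s.p_def N_sym)
  ultimately have "(s.p + s.r) \<star> (s.p + s.r) = - (s.p + s.r)"
    using v(3) by (simp add: mul_simps s.p_mul_p)
  moreover have "n (s.p + s.r) = 1"
    using v(2) by (simp add: n_add) (simp add: s.p_def s.r_def n_mul)
  ultimately show ?thesis
    unfolding has_nonzero_idempotent_def
    by (intro exI[of _ "- (s.p + s.r)"])
      (metis mul_minus_left mul_minus_right minus_minus n_minus n_zero zero_neq_one)
qed

end

section \<open>Changing generators, idempotents and splitting\<close>

context square_zero
begin

lemma N_p_Orth_u: assumes "b \<in> Orth u" shows "N p b = 0"
  using assms N_mul[of u v b] N_cyclic[of v b u] by (simp add: orthogonalizer_def p_def N_sym)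

lemma mul_Orth_u: assumes "b \<in> Orth u" "c \<in> Orth u" shows "b \<star> c \<in> Orth u"
  using mul_flip_right[of u b c] mul_flip_left[of b c u] assms N_Orth_u[OF assms(1)] N_Orth_u[OF assms(2)]
  by (simp add: orthogonalizer_def)

lemma N_p_mul_mul: assumes "b \<in> Orth u" "c \<in> Orth u"
  shows "N ((p \<star> b) \<star> c) v = - N (c \<star> b) v"
proof -
  have "N (c \<star> b) ((v \<star> v) \<star> u) = 0"
    using Orth_left[OF mul_Orth_u[OF assms(2,1)]] N_mul[of "v \<star> v" u "c \<star> b"] by (simp add: N_sym)
  moreover have "(p \<star> b) \<star> c = - ((c \<star> b) \<star> p)"
    using mul_flip_left[of p b c] N_p_Orth_u[OF assms(2)] by simp
  ultimately show ?thesis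
    by (simp add: N_simps N_mul[of _ p v] p_mul_v)
qed

text \<open>Concerns the bilinear form n(b*c,v) on the orthogonalizer of u. Writing b = (v*b)*u
  turns n(b,y), for y orthogonal to u, into a value of this form at c = u*y; the multiples of v
  account for the remaining direction.\<close>

lemma Orth_u_nondegenerate:
  assumes "b \<in> Orth u" "N b v = 0" "\<And>c. c \<in> Orth u \<Longrightarrow> N (b \<star> c) v = 0"
  shows "b = 0"
proof (rule N_nondegenerate)
  fix w
  let ?y = "w - N u w \<odot> v"
  have y: "N u ?y = 0"
    by (simp add: N_simps)
  have "N b ?y = N ((v \<star> b) \<star> u) ?y"
    using Orth_u_recover(1)[OF assms(1)] by simp
  also have "\<dots> = N (b \<star> (u \<star> ?y)) v"
    using N_mul[of "v \<star> b" u ?y] N_mul[of v b "u \<star> ?y"] by (simp add: N_sym)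
  also have "\<dots> = 0"
    using assms(3) u_mul_in_Orth[OF y] by simp
  finally show "N b w = 0"
    using assms(2) by (simp add: N_simps)
qed

text \<open>If all squares vanished, the form n(b*c,v) would be alternating, and
  \<open>N_p_mul_mul\<close> would put p*b - b into its radical. Then p*b = b, and the relation
  t^2+t+1 for p yields 3b = 0.\<close>

lemma exists_square_nonzero_in_Orth_u:
  assumes "(3 :: 'f) \<noteq> 0"
  obtains b where "b \<in> Orth u" "N b v = 0" "N v (b \<star> b) \<noteq> 0"
proof (rule ccontr)
  assume contr: "\<not> thesis"
  note obt = that
  have sq: "c \<star> c = 0" if c: "c \<in> Orth u" for c
  proof -
    let ?c = "c - N c v \<odot> u"
    have "?c \<in> Orth u"
      using c by (intro Orth_diff Orth_smul) (simp_all add: orthogonalizer_def)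
    moreover have "N ?c v = 0" "?c \<star> ?c = c \<star> c"
      using c by (simp_all add: N_simps mul_simps orthogonalizer_def)
    ultimately have "N v (c \<star> c) = 0"
      using contr obt[of ?c] by metis
    then show ?thesis
      using Orth_u_square[OF c] by simp
  qed
  obtain b where b: "b \<in> Orth u" "b \<noteq> 0" "N b v = 0"
    by (rule exists_in_Orth_u)
  have pb: "p \<star> b \<in> Orth u"
    by (rule p_mul_in_Orth) fact
  have "p \<star> b - b = 0"
  proof (rule Orth_u_nondegenerate)
    show "p \<star> b - b \<in> Orth u"
      by (intro Orth_diff pb b)
    show "N (p \<star> b - b) v = 0"
      by (simp add: N_simps N_p_mul_v b)
    fix c assume c: "c \<in> Orth u"
    have "b \<star> c + c \<star> b = 0"
      using sq[OF b(1)] sq[OF c] sq[OF Orth_add[OF b(1) c]] by (simp add: mul_simps add.commute)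
    then show "N ((p \<star> b - b) \<star> c) v = 0"
      using N_p_mul_mul[OF b(1) c] by (simp add: N_simps mul_simps add_eq_0_iff)
  qed
  then have "p \<star> b = b"
    by simp
  then have "b + b + b = 0"
    using p_mul_p_mul[OF b(1)] b(3) by simp
  moreover have "b + b + b = 3 \<odot> b"
    using vs.scale_left_distrib[of 1 1 b] vs.scale_left_distrib[of "1 + 1" 1 b] by simp
  ultimately show False
    using assms b(2) by simp
qed

lemma r_mul_r: "r \<star> r = N u (v \<star> v) \<odot> u - p"
  using mul_flip_left[of v u r] N_mul[of v v u]
  by (simp add: r_def[symmetric]) (simp add: p_def r_def N_sym)

text \<open>Supplies a pair for \<open>iso_of_generators\<close>. The shift k u preserves the
  orthogonality conditions and makes g affine in k with slope 3 n(v,b*b), so outside characteristic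
  3 any value of g can be reached when that pairing is nonzero.\<close>

lemma generators:
  assumes "n v = 0" "N u (v \<star> v) = 0" "b \<in> Orth u" "N b v = 0"
  defines "y \<equiv> \<lambda>k. k \<odot> u + v \<star> b"
  shows "y k \<star> (- r) = 0" "N (- r) (y k) = 0" "g (- r) = 1"
    "g (y k) = 3 * k * N v (b \<star> b) + g (v \<star> b)"
proof -
  let ?s = "v \<star> b"
  have "r \<star> b = 0"
    using r_mul[OF assms(3)] assms(4) by simp
  moreover have "N v r = 0"
    using assms(2) N_mul[of v v u] by (simp add: r_def N_sym)
  ultimately have "?s \<star> r = 0"
    using mul_flip_left[of v b r] by simp
  then show "y k \<star> (- r) = 0"
    by (simp add: y_def mul_simps)
  have "N r ?s = 0"
    using assms(1) by (simp add: r_def N_mul_mul_left)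
  then show "N (- r) (y k) = 0"
    by (simp add: y_def N_simps)
  show "g (- r) = 1"
    by (simp add: mul_simps r_mul_r N_simps)
  have su: "?s \<star> u = b"
    using Orth_u_recover(1)[OF assms(3)] .
  have 1: "N ?s b = N v (b \<star> b)"
    by (simp add: N_mul)
  then have 2: "N ?s (u \<star> ?s) = N v (b \<star> b)"
    using N_mul[of ?s u ?s] by (simp add: su N_sym)
  then have 3: "N u (?s \<star> ?s) = N v (b \<star> b)"
    using N_mul[of u ?s ?s] by (simp add: N_sym)
  show "g (y k) = 3 * k * N v (b \<star> b) + g (v \<star> b)"
    using 1 2 3 N_Orth_u[OF assms(3)]
    by (simp add: y_def mul_simps N_simps su algebra_simps)
qed

end

section \<open>Recognising the algebra from a basis or from two generators\<close>

context okubo_algebra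
begin

lemma mul_sum_left: "(\<Sum>i\<in>S. f i) \<star> y = (\<Sum>i\<in>S. f i \<star> y)"
  by (induction S rule: infinite_finite_induct) (simp_all add: mul_add_left)

lemma mul_sum_right: "y \<star> (\<Sum>i\<in>S. f i) = (\<Sum>i\<in>S. y \<star> f i)"
  by (induction S rule: infinite_finite_induct) (simp_all add: mul_add_right)

text \<open>The Gram matrix of \<open>e\<close> is that of the standard basis, hence nondegenerate,
  so the linear extension \<Psi> is injective. Surjectivity follows by dimension after composing
  with \<phi>, and \<psi> is the inverse of \<Psi>.\<close>

lemma iso_of_basis:
  fixes e :: "okubo_index \<Rightarrow> 'a"
  assumes "a \<noteq> 0" "b \<noteq> 0"
    and N: "\<And>i j. N (e i) (e j) = polar (okubo_norm a b) (axis i 1) (axis j 1)"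
    and n: "\<And>i. n (e i) = 0"
    and mul: "\<And>i j. e i \<star> e j = (\<Sum>k\<in>UNIV. okubo_table a b i j $ k \<odot> e k)"
  obtains \<psi> where "okubo_algebra smul mul n a b \<psi>" "\<And>i. \<psi> (e i) = axis i 1"
proof -
  define \<Psi> where "\<Psi> c = (\<Sum>k\<in>UNIV. c $ k \<odot> e k)" for c :: "'f ^ okubo_index"
  have add: "\<Psi> (c + d) = \<Psi> c + \<Psi> d" for c d
    by (simp add: \<Psi>_def vs.scale_left_distrib sum.distrib)
  have smul: "\<Psi> (k *s c) = k \<odot> \<Psi> c" for c k
    by (simp add: \<Psi>_def vs.scale_sum_right)
  have zero: "\<Psi> 0 = 0"
    by (simp add: \<Psi>_def)
  have axis: "\<Psi> (axis i 1) = e i" for i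
    by (cases i) (simp_all add: \<Psi>_def sum_okubo_index axis_def)
  have sum: "\<Psi> (sum f S) = (\<Sum>i\<in>S. \<Psi> (f i))" for f :: "okubo_index \<Rightarrow> _" and S
    by (induction S rule: infinite_finite_induct) (simp_all add: add zero)
  have mult: "\<Psi> (okubo_mult a b c d) = \<Psi> c \<star> \<Psi> d" for c d
  proof -
    have "\<Psi> (okubo_mult a b c d) = (\<Sum>i\<in>UNIV. \<Sum>j\<in>UNIV. (c $ i * d $ j) \<odot> (e i \<star> e j))"
      by (simp add: okubo_mult_def sum smul) (simp add: mul \<Psi>_def)
    also have "\<dots> = \<Psi> c \<star> \<Psi> d"
      by (simp add: \<Psi>_def mul_sum_left mul_sum_right mul_simps vs.scale_sum_right)
        (subst sum.swap, simp add: mult.commute)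
    finally show ?thesis .
  qed
  have norm: "n (\<Psi> c) = okubo_norm a b c" for c
    by (simp add: \<Psi>_def sum_okubo_index n_add n_smul n N N_simps polar_okubo_norm axis_def
        okubo_norm_def algebra_simps)
  have inj: "inj \<Psi>"
  proof (rule injI)
    fix c d assume "\<Psi> c = \<Psi> d"
    then have "N (\<Psi> c) (e j) = N (\<Psi> d) (e j)" for j
      by simp
    from this[of Z10] this[of Z20] this[of Z01] this[of Z02] this[of Z11] this[of Z22] this[of Z12] this[of Z21]
    show "c = d"
      using assms(1,2)
      by (simp add: \<Psi>_def sum_okubo_index N N_simps polar_okubo_norm axis_def vec_eq_iff
          okubo_index_all)
  qed
  have inj': "inj (\<phi> \<circ> \<Psi>)"
    using inj bij_\<phi> by (simp add: inj_compose bij_is_inj)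
  have "Vector_Spaces.linear (*s) (*s) (\<phi> \<circ> \<Psi>)"
    by (simp add: Vector_Spaces.linear_iff vec.vector_space_axioms add smul lin.add lin.scale)
  then have "surj (\<phi> \<circ> \<Psi>)"
    using inj' vec.linear_inj_imp_surj by blast
  then have "surj \<Psi>"
    by (metis bij_\<phi> bij_betw_def comp_surj fun.map_comp image_comp inj_image_eq_iff)
  with inj have bij: "bij \<Psi>"
    by (simp add: bij_def)
  then have inv: "inv \<Psi> (\<Psi> c) = c" "\<Psi> (inv \<Psi> x) = x" for c x
    by (simp_all add: bij_def surj_f_inv_f)
  show thesis
  proof
    show "inv \<Psi> (e i) = axis i 1" for i
      by (metis axis inv(1))
    have "inv \<Psi> (x + y) = inv \<Psi> x + inv \<Psi> y" "inv \<Psi> (k \<odot> x) = k *s inv \<Psi> x"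
      "inv \<Psi> (x \<star> y) = okubo_mult a b (inv \<Psi> x) (inv \<Psi> y)" "n x = okubo_norm a b (inv \<Psi> x)" for x y k
      by (metis add inv, metis smul inv, metis mult inv, metis norm inv)
    then show "okubo_algebra smul mul n a b (inv \<Psi>)"
      unfolding okubo_algebra_def okubo_iso_def
      using bij assms(1,2)
      by (simp add: Vector_Spaces.linear_iff vec.vector_space_axioms vs.vector_space_axioms bij_imp_bij_inv)
  qed
qed

text \<open>The relations y*x = 0 and n(x,y) = 0 with the two values of g determine the
  multiplication table: flips compute the products of x, x*x, y, y*y first, then those with the
  mixed products A, B, C, D, and finally those among the mixed products.\<close>

lemma iso_of_generators:
  assumes yx: "y \<star> x = 0" and Nxy: "N x y = 0" and gx: "g x \<noteq> 0" and gy: "g y \<noteq> 0"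
  obtains \<psi> where "okubo_algebra smul mul n (g x) (g y) \<psi>" "\<psi> x = axis Z10 1" "\<psi> y = axis Z01 1"
proof -
  define X Y where "X = x \<star> x" and "Y = y \<star> y"
  define A B C D where "A = x \<star> y" and "B = X \<star> Y" and "C = Y \<star> x" and "D = y \<star> X"
  define a b where "a = g x" and "b = g y"
  note fold = X_def[symmetric] Y_def[symmetric] A_def[symmetric] B_def[symmetric] C_def[symmetric] D_def[symmetric]
  have "x \<noteq> 0" "y \<noteq> 0"
    using gx gy by auto
  then have n1: "n x = 0" "n y = 0"
    using n_eq_0_if_mul_eq_0[OF yx] by auto
  then have n2: "n X = 0" "n Y = 0" "n A = 0" "n B = 0" "n C = 0" "n D = 0"
    by (simp_all add: X_def Y_def A_def B_def C_def D_def n_mul)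
  note n = n1 n2
  have m1: "x \<star> X = 0" "X \<star> x = 0" "y \<star> Y = 0" "Y \<star> y = 0" "X \<star> X = a \<odot> x" "Y \<star> Y = b \<odot> y"
    using n1 by (simp_all add: X_def Y_def mul_mul_same_left mul_mul_same_right square_square_isotropic a_def b_def)
  have NxX: "N x X = a" "N y Y = b"
    by (simp_all add: a_def b_def X_def Y_def)
  have NXy: "N X y = 0"
    using N_cyclic[of y x x] yx by (simp add: fold)
  then have NxA: "N x A = 0"
    using N_mul[of x x y] by (simp add: fold)
  have NxY: "N x Y = 0" "N A y = 0"
    using N_mul[of y y x] N_mul[of x y y] N_sym[of x Y] yx by (simp_all add: fold)
  have m2: "x \<star> Y = 0" "X \<star> y = 0"
    using mul_flip_right[of x y y] mul_flip_left[of x x y] by (simp_all add: fold yx Nxy)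
  have NXY: "N X Y = 0"
    using N_mul[of x x Y] by (simp add: fold m2)
  have m3: "Y \<star> X = 0"
    using mul_flip_left[of y y X] by (simp add: fold m2 NXy N_sym[of y X])
  note m = m1 m2 m3 yx fold
  note Ns = Nxy NxX NXy NxA NxY NXY
  note sym = N_sym[of y x] N_sym[of X x] N_sym[of Y y] N_sym[of y X] N_sym[of Y x] N_sym[of Y X]
  \<comment> \<open>Each mixed entry needs only the relations \<open>m\<close> and the polar values;
    the entries are then the input for the products among A, B, C, D.\<close>
  have xA: "x \<star> A = - D" using mul_flip_right[of x x y] by (simp add: m Ns sym)
  have Ax: "A \<star> x = 0" using mul_mul_same_left[of x y] by (simp add: m n)
  have xB: "x \<star> B = 0" using mul_flip_right[of x X Y] by (simp add: m Ns sym)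
  have Bx: "B \<star> x = a \<odot> Y" using mul_flip_left[of X Y x] by (simp add: m Ns sym)
  have xC: "x \<star> C = 0" using mul_mul_same_right[of x Y] by (simp add: m n)
  have Cx: "C \<star> x = - B" using mul_flip_left[of Y x x] by (simp add: m Ns sym)
  have xD: "x \<star> D = a \<odot> y" using mul_flip_right[of x y X] by (simp add: m Ns sym)
  have Dx: "D \<star> x = 0" using mul_flip_left[of y X x] by (simp add: m Ns sym)
  have XA: "X \<star> A = 0" using mul_flip_right[of X x y] by (simp add: m Ns sym)
  have AX: "A \<star> X = a \<odot> y" using mul_flip_left[of x y X] by (simp add: m Ns sym)
  have XB: "X \<star> B = - a \<odot> C" using mul_flip_right[of X X Y] by (simp add: m Ns sym mul_simps)
  have BX: "B \<star> X = 0" using mul_mul_same_left[of X Y] by (simp add: m n)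
  have XC: "X \<star> C = a \<odot> Y" using mul_flip_right[of X Y x] by (simp add: m Ns sym)
  have CX: "C \<star> X = 0" using mul_flip_left[of Y x X] by (simp add: m Ns sym)
  have XD: "X \<star> D = 0" using mul_mul_same_right[of X y] by (simp add: m n)
  have DX: "D \<star> X = - a \<odot> A" using mul_flip_left[of y X X] by (simp add: m Ns sym mul_simps)
  have yA: "y \<star> A = 0" using mul_mul_same_right[of y x] by (simp add: m n)
  have Ay: "A \<star> y = - C" using mul_flip_left[of x y y] by (simp add: m Ns sym)
  have yB: "y \<star> B = b \<odot> X" using mul_flip_right[of y X Y] by (simp add: m Ns sym)
  have By: "B \<star> y = 0" using mul_flip_left[of X Y y] by (simp add: m Ns sym)
  have yC: "y \<star> C = 0" using mul_flip_right[of y Y x] by (simp add: m Ns sym)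
  have Cy: "C \<star> y = b \<odot> x" using mul_flip_left[of Y x y] by (simp add: m Ns sym)
  have yD: "y \<star> D = - B" using mul_flip_right[of y y X] by (simp add: m Ns sym)
  have Dy: "D \<star> y = 0" using mul_mul_same_left[of y X] by (simp add: m n)
  have YA: "Y \<star> A = b \<odot> x" using mul_flip_right[of Y x y] by (simp add: m Ns sym)
  have AY: "A \<star> Y = 0" using mul_flip_left[of x y Y] by (simp add: m Ns sym)
  have YB: "Y \<star> B = 0" using mul_mul_same_right[of Y X] by (simp add: m n)
  have BY: "B \<star> Y = - b \<odot> D" using mul_flip_left[of X Y Y] by (simp add: m Ns sym mul_simps)
  have YC: "Y \<star> C = - b \<odot> A" using mul_flip_right[of Y Y x] by (simp add: m Ns sym mul_simps)
  have CY: "C \<star> Y = 0" using mul_mul_same_left[of Y x] by (simp add: m n)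
  have YD: "Y \<star> D = 0" using mul_flip_right[of Y y X] by (simp add: m Ns sym)
  have DY: "D \<star> Y = b \<odot> X" using mul_flip_left[of y X Y] by (simp add: m Ns sym)
  note mc = xA Ax xB Bx xC Cx xD Dx XA AX XB BX XC CX XD DX yA Ay yB By yC Cy yD Dy YA AY YB BY YC CY YD DY
  have N1: "N x B = 0" "N X B = 0" "N y B = 0" "N Y B = 0"
    using N_mul[of x X Y] N_mul[of X X Y] N_mul[of X Y y] N_mul[of X Y Y] N_sym[of y B] N_sym[of Y B]
    by (simp_all add: m Ns sym N_simps)
  have N2: "N X A = 0" "N Y A = 0"
    using N_mul[of X x y] N_mul[of x y Y] N_sym[of Y A] by (simp_all add: m Ns sym N_simps)
  have N3: "N x C = 0" "N X C = 0" "N y C = 0" "N Y C = 0"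
    using N_mul[of Y x x] N_mul[of Y x X] N_mul[of y Y x] N_mul[of Y Y x] N_sym[of x C] N_sym[of X C]
    by (simp_all add: m Ns sym N_simps)
  have N4: "N x D = 0" "N X D = 0" "N y D = 0" "N Y D = 0"
    using N_mul[of y X x] N_mul[of y X X] N_mul[of y y X] N_mul[of Y y X] N_sym[of x D] N_sym[of X D]
    by (simp_all add: m Ns sym N_simps)
  have N5: "N A B = a * b" "N A C = 0" "N A D = 0" "N B C = 0" "N B D = 0" "N C D = a * b"
    using N_mul[of x y B] N_mul[of x y C] N_mul[of x y D] N_mul[of X Y C] N_mul[of X Y D] N_mul[of Y x D]
    by (simp_all add: m mc Ns sym N1 N2 N_simps)
  have Ny: "N y A = 0"
    using NxY N_sym by metis
  have AA: "A \<star> A = - B" using mul_flip_left[of x y A] by (simp add: m mc Ns mul_simps)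
  have AB: "A \<star> B = 0" using mul_flip_left[of x y B] by (simp add: m mc N1 mul_simps)
  have AC: "A \<star> C = - b \<odot> X" using mul_flip_left[of x y C] by (simp add: m mc N3 mul_simps)
  have AD: "A \<star> D = 0" using mul_flip_left[of x y D] by (simp add: m mc N4 mul_simps)
  have BA: "B \<star> A = 0" using mul_flip_left[of X Y A] by (simp add: m mc N2 mul_simps)
  have BB: "B \<star> B = - (a * b) \<odot> A" using mul_flip_left[of X Y B] by (simp add: m mc N1 mul_simps mult.commute)
  have BC: "B \<star> C = 0" using mul_flip_left[of X Y C] by (simp add: m mc N3 mul_simps)
  have BD: "B \<star> D = - (a * b) \<odot> x" using mul_flip_left[of X Y D] by (simp add: m mc N4 mul_simps mult.commute)
  have CA: "C \<star> A = 0" using mul_flip_left[of Y x A] by (simp add: m mc N2 mul_simps)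
  have CB: "C \<star> B = - (a * b) \<odot> y" using mul_flip_left[of Y x B] by (simp add: m mc N1 mul_simps)
  have CC: "C \<star> C = - b \<odot> D" using mul_flip_left[of Y x C] by (simp add: m mc N3 mul_simps)
  have CD: "C \<star> D = 0" using mul_flip_left[of Y x D] by (simp add: m mc N4 mul_simps)
  have DA: "D \<star> A = - a \<odot> Y" using mul_flip_left[of y X A] by (simp add: m mc Ny mul_simps)
  have DB: "D \<star> B = 0" using mul_flip_left[of y X B] by (simp add: m mc N1 mul_simps)
  have DC: "D \<star> C = 0" using mul_flip_left[of y X C] by (simp add: m mc N3 mul_simps)
  have DD: "D \<star> D = - a \<odot> C" using mul_flip_left[of y X D] by (simp add: m mc N4 mul_simps)
  note mcc = AA AB AC AD BA BB BC BD CA CB CC CD DA DB DC DD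
  \<comment> \<open>The signs follow the table: z11 = -z10*z01, z22 = -z20*z02, z12 = -z02*z10, z21
    = -z01*z20.\<close>
  define e where "e i = (case i of Z10 \<Rightarrow> x | Z20 \<Rightarrow> X | Z01 \<Rightarrow> y | Z02 \<Rightarrow> Y
    | Z11 \<Rightarrow> - A | Z22 \<Rightarrow> - B | Z12 \<Rightarrow> - C | Z21 \<Rightarrow> - D)" for i
  have Nall: "N (e i) (e j) = polar (okubo_norm a b) (axis i 1) (axis j 1)" for i j
  proof -
    show ?thesis
      by (cases i; cases j)
        (simp_all add: e_def polar_okubo_norm axis_def N_simps Ns Ny N1 N2 N3 N4 N5 N_self n sym
          N_sym[of A x] N_sym[of A X] N_sym[of A y] N_sym[of A Y] N_sym[of B A] N_sym[of C A] N_sym[of D A]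
          N_sym[of B x] N_sym[of B X] N_sym[of B y] N_sym[of B Y] N_sym[of C x] N_sym[of C X]
          N_sym[of C y] N_sym[of C Y] N_sym[of D x] N_sym[of D X] N_sym[of D y] N_sym[of D Y]
          N_sym[of C B] N_sym[of D B] N_sym[of D C])
  qed
  have nall: "n (e i) = 0" for i
    by (cases i) (simp_all add: e_def n)
  have mulall: "e i \<star> e j = (\<Sum>k\<in>UNIV. okubo_table a b i j $ k \<odot> e k)" for i j
    by (cases i; cases j; simp add: e_def sum_okubo_index axis_def mul_simps m mc mcc mult.commute)
  have "a \<noteq> 0" "b \<noteq> 0"
    using gx gy by (simp_all add: a_def b_def)
  then obtain \<psi> where "okubo_algebra smul mul n a b \<psi>" "\<And>i. \<psi> (e i) = axis i 1"
    using iso_of_basis[of a b e, OF _ _ Nall nall mulall] by metis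
  then show thesis
    using that[of \<psi>] by (metis a_def b_def e_def okubo_index.case(1,3))
qed


section \<open>From idempotents to square-zero elements\<close>

lemma smul_3: "3 \<odot> x = x + x + x"
  using vs.scale_left_distrib[of 1 1 x] vs.scale_left_distrib[of "1 + 1" 1 x] by simp

definition \<delta> :: "'a \<Rightarrow> 'a \<Rightarrow> 'a" where
  "\<delta> a x = a \<star> x - x \<star> a"

lemma \<delta>_simps: "\<delta> a (x + y) = \<delta> a x + \<delta> a y" "\<delta> a (x - y) = \<delta> a x - \<delta> a y"
  "\<delta> a (k \<odot> x) = k \<odot> \<delta> a x" "\<delta> a (- x) = - \<delta> a x"
  by (simp_all add: \<delta>_def mul_simps algebra_simps)

lemma \<delta>_mul: "\<delta> a (x \<star> y) = \<delta> a x \<star> y + x \<star> \<delta> a y"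
  using associator_cyclic[of a x y] mul_flip_left[of y a x] mul_flip_right[of y a x]
  by (simp add: \<delta>_def mul_simps algebra_simps)

lemma N_\<delta>: "N (\<delta> a x) y = - N x (\<delta> a y)"
proof -
  have "N (a \<star> x) y = N x (y \<star> a)" "N (x \<star> a) y = N x (a \<star> y)"
    using N_cyclic[of a x y] N_mul[of x y a] N_mul[of x a y] by simp_all
  then show ?thesis
    by (simp add: \<delta>_def N_diff_left N_diff_right)
qed

text \<open>\<delta> e is a skew derivation. Moving it across the polar form gives 3 n(d,w*w) = 0
  for d = \<delta> e w; moving it again in g(d), with \<delta> e d = -3 w, gives a multiple of
  n(d,w*w).\<close>

lemma g_\<delta>_eq_0:
  assumes "(3 :: 'f) \<noteq> 0" and w: "\<delta> e (\<delta> e w) = - 3 \<odot> w"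
  shows "g (\<delta> e w) = 0"
proof -
  let ?d = "\<delta> e w"
  have 1: "N w (?d \<star> w) = N ?d (w \<star> w)" "N w (w \<star> ?d) = N ?d (w \<star> w)"
    using N_cyclic[of w ?d w] N_mul[of ?d w w] N_mul[of w w ?d] N_sym by metis+
  have "N ?d (w \<star> w) = - (N ?d (w \<star> w) + N ?d (w \<star> w))"
    using N_\<delta>[of e w "w \<star> w"] by (simp add: \<delta>_mul N_simps 1)
  then have "3 * N ?d (w \<star> w) = 0"
    by (simp add: eq_neg_iff_add_eq_0 algebra_simps)
  then have "N ?d (w \<star> w) = 0"
    using assms(1) by simp
  then show ?thesis
    using N_\<delta>[of e w "?d \<star> ?d"]
    by (simp add: \<delta>_mul N_simps w mul_simps 1)
qed

lemma exists_square_zero_of_g_eq_0: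
  assumes "x \<noteq> 0" "n x = 0" "g x = 0"
  shows "\<exists>u. u \<noteq> 0 \<and> u \<star> u = 0"
  using assms square_square_isotropic[of x] by (cases "x \<star> x = 0") auto

text \<open>The candidates are x*a with n(x*x,a) = 0. For y and y' of this kind with n(y,y')
  nonzero, the flip of y*(x*y') excludes that both products are 0.\<close>

lemma exists_in_W:
  assumes "n x = 0" "g x = 1"
  obtains s where "s \<noteq> 0" "s \<star> x = 0" "N x s = 0"
proof -
  let ?X = "x \<star> x"
  obtain y where y: "y \<noteq> 0" "N ?X y = 0" "N x y = 0"
    by (rule exists_orthogonal4[of ?X x 0 0])
  then obtain w where w: "N y w \<noteq> 0"
    using N_nondegenerate by blast
  define y' where "y' = w - N ?X w \<odot> x"
  have y': "N ?X y' = 0" "N y y' = N y w"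
    using y assms by (simp_all add: y'_def N_simps N_sym[of y x] N_sym[of ?X x])
  have "x \<noteq> 0"
    using assms(2) by auto
  then have "x \<star> y \<noteq> 0 \<or> x \<star> y' \<noteq> 0"
    using mul_flip_right[of y x y'] y'(2) w by auto
  moreover have "(x \<star> a) \<star> x = 0" for a
    using assms by (simp add: mul_mul_same_left)
  moreover have "N x (x \<star> a) = N ?X a" for a
    using N_mul[of x x a] by simp
  ultimately show thesis
    using that[of "x \<star> y"] that[of "x \<star> y'"] y(2) y'(1) by auto
qed

text \<open>On the elements killed by right multiplication by \<open>x\<close> and orthogonal to \<open>x\<close>, left multiplication
  by \<open>x\<close> has cube $-1$, so $s - x * s + x * (x * s)$ is an eigenvector for $-1$; an eigenvector $u$
  satisfies $u * u = -u * (x * u) = -n(u) x = 0$.\<close>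

lemma exists_square_zero_of_g_eq_1:
  assumes x: "n x = 0" "g x = 1"
  shows "\<exists>u. u \<noteq> 0 \<and> u \<star> u = 0"
proof -
  obtain s where s: "s \<noteq> 0" "s \<star> x = 0" "N x s = 0"
    by (rule exists_in_W[OF x])
  have "x \<noteq> 0"
    using x(2) by auto
  define s1 where "s1 = x \<star> s"
  define u where "u = s - s1 + x \<star> s1"
  have W: "s1 \<star> x = 0" "(x \<star> s1) \<star> x = 0"
    using x by (simp_all add: s1_def mul_mul_same_left)
  have iso: "n a = 0" if "a \<star> x = 0" for a
    using n_eq_0_if_mul_eq_0(1)[OF that] \<open>x \<noteq> 0\<close> by simp
  have "x \<star> s1 = - (s \<star> (x \<star> x))"
    using mul_flip_right[of x x s] s by (simp add: s1_def)
  moreover have "x \<star> (s \<star> (x \<star> x)) = s"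
    using mul_flip_right[of x s "x \<star> x"] s x by simp
  ultimately have "x \<star> (x \<star> s1) = - s"
    by (simp add: mul_simps)
  then have xu: "x \<star> u = - u"
    by (simp add: u_def mul_simps s1_def)
  have "u \<star> x = 0"
    using W s(2) by (simp add: u_def mul_simps)
  then have "n u = 0"
    by (rule iso)
  then have "u \<star> (x \<star> u) = 0"
    by (simp add: mul_mul_same_right)
  then have uu: "u \<star> u = 0"
    by (simp add: xu mul_simps)
  show ?thesis
  proof (cases "u = 0")
    \<comment> \<open>If the projection onto the eigenspace kills s, then x*s1 = s1 - s. This
      relation forces g(s) = 0, so s or s*s is the square-zero element.\<close>
    case True
    then have s2: "x \<star> s1 = s1 - s"
      by (simp add: u_def algebra_simps)
    have ns: "n s = 0" "n s1 = 0"
      using iso s(2) W(1) by simp_all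
    have ss1: "s \<star> s1 = 0"
      using ns mul_mul_same_right[of s x] by (simp add: s1_def)
    have "N s s1 = 0"
      using iso[of "s + s1"] ns s(2) W(1) by (simp add: mul_simps n_add)
    then have "s \<star> (x \<star> s1) = - (s1 \<star> s1)"
      using mul_flip_right[of s x s1] by (simp add: s1_def[symmetric])
    then have "s \<star> s = s1 \<star> s1"
      by (simp add: s2 mul_simps ss1)
    then have "g s = 0"
      using N_mul[of s s1 s1] ss1 by simp
    then show ?thesis
      using exists_square_zero_of_g_eq_0 s(1) ns(1) by blast
  qed (use uu in blast)
qed

lemma g_add: "g (x + y) = g x + g y + 3 * N (x \<star> x) y + 3 * N (y \<star> y) x"
proof -
  have *: "N a (a \<star> b) = N (a \<star> a) b" "N a (b \<star> a) = N (a \<star> a) b" "N b (a \<star> a) = N (a \<star> a) b" for a b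
    using N_mul[of a a b] N_cyclic[of b a a] N_sym by metis+
  show ?thesis
    by (simp add: mul_simps N_add_left N_add_right *[of x y] *[of y x])
qed

lemma g_minus [simp]: "g (- x) = - g x"
  by (simp add: mul_simps N_simps)

context
  fixes e :: 'a
  assumes e: "e \<star> e = e" "e \<noteq> 0"
begin

lemma n_idempotent: "n e = 1"
proof -
  have "n e \<odot> e = 1 \<odot> e"
    using mul_mul_same_left[of e e] e by simp
  then show ?thesis
    using e(2) by (simp only: vs.scale_cancel_right) simp
qed

lemma idempotent_mul_mul: "e \<star> (e \<star> a) = N e a \<odot> e - a \<star> e" "(a \<star> e) \<star> e = N e a \<odot> e - e \<star> a"
  "(e \<star> a) \<star> e = a" "e \<star> (a \<star> e) = a"
  using mul_flip_right[of e e a] mul_flip_left[of a e e] e(1)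
  by (simp_all add: N_sym mul_mul_same_left mul_mul_same_right n_idempotent)

lemma e_\<delta>: "e \<star> \<delta> e a + \<delta> e a \<star> e = \<delta> e a"
  by (simp add: \<delta>_def mul_simps idempotent_mul_mul)

text \<open>Let L, R be the two multiplications by e. Up to multiples of e, which \<delta> e kills,
  L^2 = -R, R^2 = -L and LR = RL = 1, hence (L-R)^2 = -(L+R)-2. By \<open>e_\<delta>\<close>, L+R is
  the identity on the image of L-R.\<close>

lemma \<delta>_\<delta>_\<delta>: "\<delta> e (\<delta> e (\<delta> e a)) = - 3 \<odot> \<delta> e a"
proof -
  have "\<delta> e (\<delta> e a) = N e a \<odot> e + N e a \<odot> e - a \<star> e - e \<star> a - a - a"
    by (simp add: \<delta>_def[of e "\<delta> e a"]) (simp add: \<delta>_def mul_simps idempotent_mul_mul)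
  moreover have "\<delta> e e = 0"
    by (simp add: \<delta>_def)
  moreover have "\<delta> e (e \<star> a) = \<delta> e a - \<delta> e (a \<star> e)"
    using e_\<delta>[of a] by (simp add: \<delta>_def mul_simps idempotent_mul_mul algebra_simps)
  ultimately have "\<delta> e (\<delta> e (\<delta> e a)) = - (\<delta> e a + \<delta> e a + \<delta> e a)"
    by (simp add: \<delta>_simps)
  also have "\<dots> = - 3 \<odot> \<delta> e a"
    by (simp add: smul_3)
  finally show ?thesis .
qed

text \<open>An isotropic basis element splits as k + w with k in the kernel and w in the image of
  \<open>\<delta> e\<close>; these are orthogonal, so n(k) = -n(w). If n(w) = 0, then g(w) = 0
  finishes. Otherwise k*w rescales to w' with n(w') = -1, and -(e+w') is isotropic with g =
  1.\<close>

lemma exists_square_zero_char_not_3: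
  assumes "(3 :: 'f) \<noteq> 0"
  shows "\<exists>u. u \<noteq> 0 \<and> u \<star> u = 0"
proof -
  obtain i where "\<delta> e (z i) \<noteq> 0"
    using commutes_with_basis[of e] e(2) by (auto simp: \<delta>_def)
  define x0 where "x0 = z i"
  \<comment> \<open>The factor -1/3 makes w the projection of x0 to the image of
    \<open>\<delta> e\<close>, because the cube of \<open>\<delta> e\<close> is -3 times
    \<open>\<delta> e\<close>.\<close>
  define w1 where "w1 = (- 1 / 3) \<odot> \<delta> e x0"
  define w where "w = \<delta> e w1"
  define k where "k = x0 - w"
  have w1: "\<delta> e (\<delta> e w1) = - 3 \<odot> w1"
    by (simp add: w1_def \<delta>_simps \<delta>_\<delta>_\<delta> mult.commute)
  have dw: "\<delta> e w = \<delta> e x0"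
  proof -
    have "\<delta> e w = - 3 \<odot> w1"
      unfolding w_def by (rule w1)
    then show ?thesis
      using assms by (simp add: w1_def)
  qed
  then have dk: "\<delta> e k = 0" and "w \<noteq> 0"
    using \<open>\<delta> e (z i) \<noteq> 0\<close> \<delta>_simps(3)[of e 0 0] by (auto simp: k_def \<delta>_simps x0_def)
  have "N k w = 0"
    using N_\<delta>[of e k w1] dk by (simp add: w_def)
  moreover have "n (k + w) = 0"
    by (simp add: k_def x0_def)
  ultimately have nk: "n k = - n w"
    by (simp add: n_add eq_neg_iff_add_eq_0)
  show ?thesis
  proof (cases "n w = 0")
    case True
    then show ?thesis
      using exists_square_zero_of_g_eq_0[OF \<open>w \<noteq> 0\<close>] g_\<delta>_eq_0[OF assms w1] by (simp add: w_def)
  next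
    case False
    \<comment> \<open>Since \<open>\<delta> e\<close> kills k, it commutes with left multiplication
      by k, so w' stays in its image. Dividing by n(w) gives n(w') = n(k) n(w) / n(w)^2 =
      -1.\<close>
    define w2 where "w2 = (1 / n w) \<odot> (k \<star> w1)"
    define w' where "w' = \<delta> e w2"
    have w': "w' = (1 / n w) \<odot> (k \<star> w)"
      by (simp add: w'_def w2_def \<delta>_simps \<delta>_mul dk w_def)
    have w2: "\<delta> e (\<delta> e w2) = - 3 \<odot> w2"
      by (simp add: w2_def \<delta>_simps \<delta>_mul dk w1 mul_simps mult.commute)
    have gw': "g w' = 0"
      using g_\<delta>_eq_0[OF assms w2] by (simp add: w'_def)
    have nw': "n w' = - 1"
      using False by (simp add: w' n_smul n_mul nk power2_eq_square)
    have New': "N e w' = 0"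
      using N_\<delta>[of e e w2] by (simp add: w'_def \<delta>_def[of e e])
    have sum: "e \<star> w' + w' \<star> e = w'"
      using e_\<delta> by (simp add: w'_def)
    then have "n (e \<star> w') = n (w' - w' \<star> e)"
      by (metis add_diff_cancel_right')
    then have t: "N w' (w' \<star> e) = - 1"
      by (simp add: n_diff n_mul n_idempotent nw') (metis minus_minus)
    have "g (e + w') = 3 + 3 * N (w' \<star> w') e - 1"
      using g_add[of e w'] e(1) gw' New' n_idempotent by (simp add: N_self N_sym)
    also have "N (w' \<star> w') e = - 1"
      using t by (simp add: N_mul)
    finally have "g (- (e + w')) = 1"
      by (simp only: g_minus) simp
    moreover have "n (- (e + w')) = 0"
      by (simp only: n_minus) (simp add: n_add n_idempotent nw' New')
    ultimately show ?thesis
      by (intro exists_square_zero_of_g_eq_1)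
  qed
qed

text \<open>For isotropic h orthogonal to e, both e*h and h*e have g equal to -g(h). Additivity
  gives g(u) = 3 g(h) = 0 for u = h - e*h - h*e, and n(u) is also a multiple of 3. If u = 0, then h
  = e*h + h*e yields g(h) = 0 directly.\<close>

lemma exists_square_zero_char_3:
  assumes 3: "(3 :: 'f) = 0"
  shows "\<exists>u. u \<noteq> 0 \<and> u \<star> u = 0"
proof -
  obtain h where h: "h \<noteq> 0" "n h = 0" "N e h = 0"
  proof (cases "N e (z Z10) = 0")
    case True
    then show thesis
      using that z_nonzero n_z by blast
  next
    case False
    let ?h = "N e (z Z01) \<odot> z Z10 - N e (z Z10) \<odot> z Z01"
    have "N ?h (z Z02) = - N e (z Z10) * \<beta>"
      by (simp add: N_z \<phi>_simps \<phi>_z axis_def)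
    with False have "?h \<noteq> 0"
      using \<beta> by auto
    then show thesis
      by (rule that) (simp_all add: n_diff n_smul N_simps N_z(1,3) \<phi>_simps \<phi>_z axis_def)
  qed
  \<comment> \<open>Because h*e = -e*(e*h), this is h - e*h + e*(e*h), the same projection as in
    \<open>exists_square_zero_of_g_eq_1\<close>.\<close>
  define u where "u = h - e \<star> h - h \<star> e"
  have hhh: "(h \<star> h) \<star> h = 0" "h \<star> (h \<star> h) = 0"
    using h by (simp_all add: mul_mul_same_left mul_mul_same_right)
  show ?thesis
  proof (cases "u = 0")
    case True
    then have "h = e \<star> h + h \<star> e"
      by (simp add: u_def algebra_simps)
    then have "g h = N (e \<star> h) (h \<star> h) + N (h \<star> e) (h \<star> h)"
      by (metis N_add_left)
    also have "\<dots> = 0"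
      using N_mul[of e h "h \<star> h"] N_cyclic[of "h \<star> h" h e] N_sym hhh by simp
    finally show ?thesis
      using exists_square_zero_of_g_eq_0 h by blast
  next
    case False
    have Neh: "N (e \<star> h) e = 0" "N (h \<star> e) e = 0" "N e (e \<star> h) = 0" "N h e = 0"
      using N_mul[of e e h] N_mul[of h e e] e(1) h(3) by (simp_all add: N_sym)
    have hheh: "h \<star> (h \<star> e) = - (e \<star> (h \<star> h))" "(e \<star> h) \<star> h = - ((h \<star> h) \<star> e)"
      using mul_flip_right[of h h e] mul_flip_left[of e h h] h(3) by (simp_all add: N_sym)
    have geh: "g (e \<star> h) = - g h"
    proof -
      have "(e \<star> h) \<star> (e \<star> h) = - (((e \<star> h) \<star> h) \<star> e)"
        using mul_flip_left[of e h "e \<star> h"] Neh by simp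
      also have "\<dots> = N e (h \<star> h) \<odot> e - e \<star> (h \<star> h)"
        by (simp add: hheh mul_simps idempotent_mul_mul)
      finally show ?thesis
        by (simp add: N_simps Neh N_mul_mul_left n_idempotent)
    qed
    have ghe: "g (h \<star> e) = - g h"
    proof -
      have "(h \<star> e) \<star> (h \<star> e) = - (e \<star> (h \<star> (h \<star> e)))"
        using mul_flip_right[of "h \<star> e" h e] Neh by simp
      also have "\<dots> = N e (h \<star> h) \<odot> e - (h \<star> h) \<star> e"
        by (simp add: hheh mul_simps idempotent_mul_mul)
      finally show ?thesis
        by (simp add: N_simps Neh N_mul_mul_right n_idempotent)
    qed
    have "u = h + (- (e \<star> h) + - (h \<star> e))"
      by (simp add: u_def)
    then have "g u = g h + (- g (e \<star> h) + - g (h \<star> e))"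
      by (simp only: g_add g_minus 3) simp
    then have "g u = 3 * g h"
      by (simp add: geh ghe)
    then have "g u = 0"
      by (simp add: 3)
    moreover have "n u = 0"
    proof -
      have "N h (h \<star> e) = N e (h \<star> h)" "N h (e \<star> h) = N e (h \<star> h)"
        using N_mul[of h h e] N_cyclic[of e h h] N_sym by metis+
      moreover have "N (e \<star> h) (h \<star> e) = - N e (h \<star> h)"
        using N_mul[of e h "h \<star> e"] N_mul[of e e "h \<star> h"] e(1) by (simp add: hheh N_simps)
      ultimately have "n u = - 3 * N e (h \<star> h)"
        using h by (simp add: u_def n_diff n_mul N_simps)
      then show ?thesis
        by (simp add: 3)
    qed
    ultimately show ?thesis
      using exists_square_zero_of_g_eq_0 False by blast
  qed
qed

end

lemma exists_square_zero_iff_idempotent: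
  "(\<exists>u. u \<noteq> 0 \<and> u \<star> u = 0) \<longleftrightarrow> has_nonzero_idempotent mul"
proof
  show "has_nonzero_idempotent mul" if "\<exists>u. u \<noteq> 0 \<and> u \<star> u = 0"
    using that idempotent_of_square_zero by blast
  show "\<exists>u. u \<noteq> 0 \<and> u \<star> u = 0" if "has_nonzero_idempotent mul"
    using that exists_square_zero_char_3 exists_square_zero_char_not_3
    unfolding has_nonzero_idempotent_def by blast
qed

text \<open>The generator x = -r is returned with its products with u, so that the line of u can be
  located in the new coordinates.\<close>

lemma split_iso_of_square_zero:
  assumes 3: "(3 :: 'f) \<noteq> 0" and u: "u \<noteq> 0" "u \<star> u = 0"
  obtains \<psi> x where "okubo_algebra smul mul n 1 1 \<psi>" "\<psi> x = axis Z10 1" "x \<star> u = - u" "u \<star> x = 0"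
proof -
  obtain v where v: "N u v = 1" "n v = 0" "N u (v \<star> v) = 0"
    using exists_isotropic_dual[OF u] .
  interpret s: square_zero smul mul n \<alpha> \<beta> \<phi> u v
    by unfold_locales (use v u in auto)
  obtain b where b: "b \<in> Orth u" "N b v = 0" "N v (b \<star> b) \<noteq> 0"
    using s.exists_square_nonzero_in_Orth_u[OF 3] .
  \<comment> \<open>Solves 3 k n(v,b*b) + g(v*b) = 1.\<close>
  define k where "k = (1 - g (v \<star> b)) / (3 * N v (b \<star> b))"
  let ?x = "- s.r" and ?y = "k \<odot> u + v \<star> b"
  note gen = s.generators[OF v(2,3) b(1,2)]
  have gy: "g ?y = 1"
    unfolding gen(4) using 3 b(3) by (simp add: k_def field_simps)
  obtain \<psi> where "okubo_algebra smul mul n (g ?x) (g ?y) \<psi>" "\<psi> ?x = axis Z10 1"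
    using iso_of_generators[OF gen(1)[of k] gen(2)[of k]] unfolding gen(3) gy by auto
  then show thesis
    using that[of \<psi> ?x] unfolding gen(3) gy by (simp add: mul_simps)
qed

end

section \<open>Computations in coordinates\<close>

context okubo_algebra
begin

text \<open>The product determines the norm through (x*y)*x = n(x) y, so an isomorphism of products
  alone suffices to change coordinates.\<close>

lemma mul_unique_norm:
  assumes "okubo_iso smul mul a b \<psi>" "a \<noteq> 0" "b \<noteq> 0"
  shows "okubo_algebra smul mul n a b \<psi>"
proof -
  interpret o: okubo_algebra smul mul "\<lambda>x. okubo_norm a b (\<psi> x)" a b \<psi>
    by unfold_locales (use assms in auto)
  have "n x = okubo_norm a b (\<psi> x)" for x
  proof -
    have "n x \<odot> z Z10 = okubo_norm a b (\<psi> x) \<odot> z Z10"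
      using mul_mul_same_left o.mul_mul_same_left by metis
    then show ?thesis
      using z_nonzero by simp
  qed
  then show ?thesis
    by unfold_locales (use assms in auto)
qed

lemma eq_iff_coords: "x = y \<longleftrightarrow> (\<forall>i. \<phi> x $ i = \<phi> y $ i)"
  by (simp add: \<phi>_eq_iff[symmetric] vec_eq_iff)

lemmas coord_simps = eq_iff_coords okubo_index_all \<phi>_simps \<phi>_z okubo_mult_nth axis_def

lemma g_coord:
  "g x = \<alpha> * \<phi> x $ Z10 ^ 3 + \<alpha>\<^sup>2 * \<phi> x $ Z20 ^ 3 + \<beta> * \<phi> x $ Z01 ^ 3 + \<beta>\<^sup>2 * \<phi> x $ Z02 ^ 3
     + \<alpha> * \<beta> * \<phi> x $ Z11 ^ 3 + \<alpha>\<^sup>2 * \<beta>\<^sup>2 * \<phi> x $ Z22 ^ 3 + \<alpha> * \<beta>\<^sup>2 * \<phi> x $ Z12 ^ 3 + \<alpha>\<^sup>2 * \<beta> * \<phi> x $ Z21 ^ 3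
     - 3 * (\<alpha> * \<beta> * (\<phi> x $ Z01 * \<phi> x $ Z10 * \<phi> x $ Z22 + \<phi> x $ Z10 * \<phi> x $ Z11 * \<phi> x $ Z12
       + \<phi> x $ Z02 * \<phi> x $ Z10 * \<phi> x $ Z21 + \<phi> x $ Z02 * \<phi> x $ Z11 * \<phi> x $ Z20
       + \<alpha> * \<phi> x $ Z20 * \<phi> x $ Z21 * \<phi> x $ Z22 + \<phi> x $ Z01 * \<phi> x $ Z12 * \<phi> x $ Z20
       + \<phi> x $ Z01 * \<phi> x $ Z11 * \<phi> x $ Z21 + \<beta> * \<phi> x $ Z02 * \<phi> x $ Z12 * \<phi> x $ Z22))"
  by (simp add: N_eq polar_okubo_norm \<phi>_simps okubo_mult_nth power2_eq_square power3_eq_cube algebra_simps)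

text \<open>[y] is a pendant vertex attached to [u]. Here u = s - x*s + x*(x*s) for x = z10 and s =
  z01, so it is a -1 eigenvector of left multiplication by z10.\<close>

lemma pendant_Z02_Z12:
  assumes "\<alpha> = 1"
  defines "u \<equiv> z Z01 + z Z11 + z Z21" and "y \<equiv> z Z02 - z Z12"
  shows "u \<noteq> 0" "u \<star> u = 0" "n y = 0" "y \<star> y = \<beta> \<odot> u" "b \<in> Orth y \<Longrightarrow> \<exists>c. b = c \<odot> u"
proof -
  show "u \<noteq> 0" "u \<star> u = 0" "y \<star> y = \<beta> \<odot> u"
    using assms(1) by (simp_all add: u_def y_def coord_simps)
  show "n y = 0"
    by (simp add: y_def n_eq okubo_norm_def \<phi>_simps \<phi>_z axis_def)
  assume "b \<in> Orth y"
  then have "b = \<phi> b $ Z01 \<odot> u"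
    using assms(1) \<beta> by (auto simp: orthogonalizer_def u_def y_def coord_simps)
  then show "\<exists>c. b = c \<odot> u" ..
qed

text \<open>The mirror construction: this u is a -1 eigenvector of right multiplication by
  z10.\<close>

lemma pendant_Z01_Z11:
  assumes "\<alpha> = 1"
  defines "u \<equiv> z Z02 + z Z12 + z Z22" and "y \<equiv> z Z01 - z Z11"
  shows "u \<noteq> 0" "u \<star> u = 0" "n y = 0" "y \<star> y = u" "b \<in> Orth y \<Longrightarrow> \<exists>c. b = c \<odot> u"
proof -
  show "u \<noteq> 0" "u \<star> u = 0" "y \<star> y = u"
    using assms(1) by (simp_all add: u_def y_def coord_simps)
  show "n y = 0"
    by (simp add: y_def n_eq okubo_norm_def \<phi>_simps \<phi>_z axis_def)
  assume "b \<in> Orth y"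
  then have "b = \<phi> b $ Z02 \<odot> u"
    using assms(1) \<beta> by (auto simp: orthogonalizer_def u_def y_def coord_simps)
  then show "\<exists>c. b = c \<odot> u" ..
qed

text \<open>Here u is a -1 eigenvector of right multiplication by z01, which requires \<beta> = 1.
  The last equation makes it nonorthogonal to the centre of the first pendant.\<close>

lemma pendant_Z20_Z21:
  assumes "\<alpha> = 1" "\<beta> = 1"
  defines "u \<equiv> z Z10 + z Z11 + z Z12" and "y \<equiv> z Z20 - z Z21"
  shows "u \<noteq> 0" "u \<star> u = 0" "n y = 0" "y \<star> y = u" "b \<in> Orth y \<Longrightarrow> \<exists>c. b = c \<odot> u"
    "N (z Z01 + z Z11 + z Z21) u = 1"
proof -
  show "u \<noteq> 0" "u \<star> u = 0" "y \<star> y = u"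
    using assms(1,2) by (simp_all add: u_def y_def coord_simps)
  show "n y = 0"
    by (simp add: y_def n_eq okubo_norm_def \<phi>_simps \<phi>_z axis_def)
  show "N (z Z01 + z Z11 + z Z21) u = 1"
    using assms(1,2) by (simp add: u_def N_eq polar_okubo_norm \<phi>_simps \<phi>_z axis_def)
  assume "b \<in> Orth y"
  then have "b = \<phi> b $ Z10 \<odot> u"
    using assms(1,2) by (auto simp: orthogonalizer_def u_def y_def coord_simps)
  then show "\<exists>c. b = c \<odot> u" ..
qed

lemma eigenline_z10:
  assumes "\<alpha> = 1" "\<phi> x = axis Z10 1" "x \<star> u = - u" "u \<star> x = 0"
  shows "\<exists>c. u = c \<odot> (z Z01 + z Z11 + z Z21)"
proof -
  have "\<phi> (x \<star> u) $ k = \<phi> (- u) $ k" "\<phi> (u \<star> x) $ k = 0" for k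
    using assms(3,4) lin.zero by simp_all
  note eq = this(1)[of Z20] this(1)[of Z10] this(1)[of Z11] this(1)[of Z21] this(1)[of Z02] this(1)[of Z22] this(1)[of Z12]
  have "\<phi> u $ Z11 = \<phi> u $ Z01" "\<phi> u $ Z21 = \<phi> u $ Z11"
    "\<phi> u $ Z10 = 0" "\<phi> u $ Z02 = 0" "\<phi> u $ Z22 = 0" "\<phi> u $ Z12 = 0" "\<phi> u $ Z20 = 0"
    using eq by (simp_all add: \<phi>_simps okubo_mult_nth assms(1,2) axis_def)
  then have "u = \<phi> u $ Z01 \<odot> (z Z01 + z Z11 + z Z21)"
    by (simp add: coord_simps)
  then show ?thesis ..
qed

text \<open>In coordinates, the square of an element of the orthogonalizer is governed by the binary
  form i^2 + ij + j^2, which is anisotropic when t^2+t+1 has no root.\<close>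

lemma square_zero_in_Orth_u1:
  assumes "\<alpha> = 1" and no_root: "\<And>t :: 'f. t\<^sup>2 + t + 1 \<noteq> 0"
  defines "u \<equiv> z Z01 + z Z11 + z Z21"
  assumes d: "d \<in> Orth u" "d \<star> d = 0"
  shows "\<exists>c. d = c \<odot> u"
proof -
  let ?i = "\<phi> d $ Z02" and ?j = "\<phi> d $ Z22"
  have lin: "\<phi> d $ Z10 = 0" "\<phi> d $ Z20 = 0" "\<phi> d $ Z11 = \<phi> d $ Z01" "\<phi> d $ Z21 = \<phi> d $ Z01"
    "\<phi> d $ Z12 = - ?i - ?j"
  proof -
    have "\<phi> (u \<star> d) $ k = 0" "\<phi> (d \<star> u) $ k = 0" for k
      using d(1) by (simp_all add: orthogonalizer_def \<phi>_simps del: \<phi>_mul)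
    note eq = this(1)[of Z01] this(1)[of Z02] this(1)[of Z22] this(1)[of Z20] this(2)[of Z01]
    show "\<phi> d $ Z10 = 0" "\<phi> d $ Z20 = 0" "\<phi> d $ Z11 = \<phi> d $ Z01" "\<phi> d $ Z21 = \<phi> d $ Z01"
      using eq(1-3,5) by (simp_all add: \<phi>_simps okubo_mult_nth u_def \<phi>_z assms(1) axis_def)
    have "\<phi> (u \<star> d) $ Z20 = - \<beta> * (\<phi> d $ Z12 + ?i + ?j)"
      by (simp add: \<phi>_simps okubo_mult_nth u_def \<phi>_z assms(1) axis_def algebra_simps)
    then have "\<phi> d $ Z12 + ?i + ?j = 0"
      using \<beta> eq(4) by simp
    moreover have "\<phi> d $ Z12 = (\<phi> d $ Z12 + ?i + ?j) - ?i - ?j"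
      by simp
    ultimately show "\<phi> d $ Z12 = - ?i - ?j"
      by simp
  qed
  have "\<beta> * (?i\<^sup>2 + ?i * ?j + ?j\<^sup>2) = \<phi> (d \<star> d) $ Z01"
    using assms(1) by (simp add: \<phi>_simps okubo_mult_nth lin power2_eq_square algebra_simps)
  then have q: "?i\<^sup>2 + ?i * ?j + ?j\<^sup>2 = 0"
    using d(2) \<beta> by (simp add: \<phi>_simps)
  have j: "?j = 0"
  proof (rule ccontr)
    assume "?j \<noteq> 0"
    then have "(?i / ?j)\<^sup>2 + ?i / ?j + 1 = (?i\<^sup>2 + ?i * ?j + ?j\<^sup>2) / ?j\<^sup>2"
      by (simp add: field_simps power2_eq_square)
    then show False
      using q no_root by simp
  qed
  with q have i: "?i = 0"
    by simp
  have "d = \<phi> d $ Z01 \<odot> u"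
    using lin i j by (simp add: coord_simps u_def)
  then show ?thesis ..
qed

text \<open>Outside characteristic 3 there are coordinates in which u spans the same line as
  z01+z11+z21, because the eigenspace conditions in \<open>eigenline_z10\<close> cut out that
  line.\<close>

lemma square_zero_in_Orth_no_root:
  assumes "(3 :: 'f) \<noteq> 0" "\<And>t :: 'f. t\<^sup>2 + t + 1 \<noteq> 0"
    and u: "u \<noteq> 0" "u \<star> u = 0" and d: "d \<in> Orth u" "d \<star> d = 0"
  shows "\<exists>c. d = c \<odot> u"
proof -
  obtain \<psi> x where \<psi>: "okubo_algebra smul mul n 1 1 \<psi>" "\<psi> x = axis Z10 1" "x \<star> u = - u" "u \<star> x = 0"
    using split_iso_of_square_zero[OF assms(1) u] .
  interpret o: okubo_algebra smul mul n 1 1 \<psi>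
    by (rule \<psi>)
  let ?u = "o.z Z01 + o.z Z11 + o.z Z21"
  obtain c where c: "u = c \<odot> ?u"
    using o.eigenline_z10[OF refl \<psi>(2-)] by blast
  with u(1) have "c \<noteq> 0"
    by auto
  moreover have "d \<in> Orth ?u"
    using d(1) \<open>c \<noteq> 0\<close> by (simp add: orthogonalizer_def c mul_smul_left mul_smul_right)
  then obtain k where "d = k \<odot> ?u"
    using o.square_zero_in_Orth_u1[OF refl assms(2) _ d(2)] by blast
  ultimately have "d = (k / c) \<odot> u"
    by (simp add: c)
  then show ?thesis ..
qed

end

text \<open>Closure under inverses is automatic, because $a^{-1} = a^2 (a^{-1})^3$.\<close>

definition subfield_with_cubes :: "'f::field set \<Rightarrow> bool" where
  "subfield_with_cubes K \<longleftrightarrow> (\<forall>a\<in>K. \<forall>b\<in>K. a + b \<in> K \<and> a * b \<in> K) \<and> (\<forall>a. a ^ 3 \<in> K)"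

lemma subfield_with_cubes_closed:
  assumes "subfield_with_cubes K"
  shows "a \<in> K \<Longrightarrow> b \<in> K \<Longrightarrow> a + b \<in> K" "a \<in> K \<Longrightarrow> b \<in> K \<Longrightarrow> a * b \<in> K" "c ^ 3 \<in> K"
    "a \<in> K \<Longrightarrow> - a \<in> K" "a \<in> K \<Longrightarrow> inverse a \<in> K" "a \<in> K \<Longrightarrow> b \<in> K \<Longrightarrow> a - b \<in> K"
    "a \<in> K \<Longrightarrow> b \<in> K \<Longrightarrow> a / b \<in> K"
proof -
  show add: "a \<in> K \<Longrightarrow> b \<in> K \<Longrightarrow> a + b \<in> K" and mul: "a \<in> K \<Longrightarrow> b \<in> K \<Longrightarrow> a * b \<in> K"
    and cube: "c ^ 3 \<in> K" for a b c
    using assms by (auto simp: subfield_with_cubes_def)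
  show neg: "a \<in> K \<Longrightarrow> - a \<in> K" for a
    using mul[of "(- 1) ^ 3" a] cube[of "- 1"] by simp
  show inv: "inverse a \<in> K" if "a \<in> K" for a
  proof -
    have "inverse a = a * a * inverse a ^ 3"
      by (cases "a = 0") (simp_all add: power3_eq_cube field_simps)
    then show ?thesis
      using mul[OF mul[OF that that] cube] by metis
  qed
  show "a \<in> K \<Longrightarrow> b \<in> K \<Longrightarrow> a - b \<in> K" "a \<in> K \<Longrightarrow> b \<in> K \<Longrightarrow> a / b \<in> K"
    using add[of a "- b"] neg mul[of a "inverse b"] inv by (simp_all add: divide_inverse)
qed

text \<open>\<theta> has degree 3 over K. A monic quadratic relation, used to reduce \<theta>^3 in
  K, gives (B^2-C) \<theta> in K; if B^2 = C, the quadratic is (\<theta>-B)^2 in characteristic 3.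
  Either way \<theta> would lie in K.\<close>

lemma independent_over_cubes:
  fixes \<theta> :: "'f::field"
  assumes 3: "(3 :: 'f) = 0" and K: "subfield_with_cubes K"
    and A: "a \<in> K" "b \<in> K" "c \<in> K" "a + b * \<theta> + c * \<theta>\<^sup>2 = 0" "\<theta> \<notin> K"
  shows "a = 0 \<and> b = 0 \<and> c = 0"
proof -
  note cl = subfield_with_cubes_closed[OF K]
  have c: "c = 0"
  proof (rule ccontr)
    assume "c \<noteq> 0"
    define B C where "B = b / c" and "C = a / c"
    have BC: "B \<in> K" "C \<in> K"
      using A cl by (simp_all add: B_def C_def)
    have "c * (\<theta>\<^sup>2 + B * \<theta> + C) = a + b * \<theta> + c * \<theta>\<^sup>2"
      using \<open>c \<noteq> 0\<close> by (simp add: B_def C_def field_simps)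
    then have "\<theta>\<^sup>2 + B * \<theta> + C = 0"
      using \<open>c \<noteq> 0\<close> A(4) by simp
    moreover have "\<theta>\<^sup>2 = (\<theta>\<^sup>2 + B * \<theta> + C) - B * \<theta> - C"
      by simp
    ultimately have sq: "\<theta>\<^sup>2 = - B * \<theta> - C"
      by simp
    have "\<theta> ^ 3 = \<theta> * \<theta>\<^sup>2"
      by (simp add: power2_eq_square power3_eq_cube)
    also have "\<dots> = \<theta> * (- B * \<theta> - C)"
      by (simp only: sq)
    also have "\<dots> = - B * \<theta>\<^sup>2 - C * \<theta>"
      by (simp add: power2_eq_square algebra_simps)
    also have "\<dots> = - B * (- B * \<theta> - C) - C * \<theta>"
      by (simp only: sq)
    also have "\<dots> = (B\<^sup>2 - C) * \<theta> + B * C"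
      by (simp add: algebra_simps power2_eq_square)
    finally have cube: "(B\<^sup>2 - C) * \<theta> = \<theta> ^ 3 - B * C"
      by simp
    show False
    proof (cases "B\<^sup>2 = C")
      case True
      have "(\<theta> - B)\<^sup>2 = \<theta>\<^sup>2 + B * \<theta> + B\<^sup>2 - 3 * (B * \<theta>)"
        by (simp add: power2_eq_square algebra_simps)
      also have "\<dots> = 0"
        by (simp add: sq True 3)
      finally show False
        using BC A(5) by simp
    next
      case False
      then have "\<theta> = (\<theta> ^ 3 - B * C) / (B * B - C)"
        using cube by (simp add: field_simps power2_eq_square)
      moreover have "\<dots> \<in> K"
        by (intro cl BC)
      ultimately show False
        using A(5) by metis
    qed
  qed
  moreover have "b = 0"
  proof (rule ccontr)
    assume "b \<noteq> 0"
    then have "\<theta> = - a / b"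
      using A(4) c by (simp add: field_simps eq_neg_iff_add_eq_0)
    moreover have "- a / b \<in> K"
      by (intro cl A)
    ultimately show False
      using A(5) by metis
  qed
  ultimately show ?thesis
    using A(4) by simp
qed

lemma cube_add_char_3: "(3 :: 'f::field) = 0 \<Longrightarrow> (a + b) ^ 3 = a ^ 3 + (b :: 'f) ^ 3"
proof -
  assume "(3 :: 'f) = 0"
  moreover have "(a + b) ^ 3 = a ^ 3 + b ^ 3 + 3 * (a * b * (a + b))"
    by (simp add: power3_eq_cube algebra_simps)
  ultimately show ?thesis
    by simp
qed

lemma subfield_cubes:
  assumes "(3 :: 'f::field) = 0" shows "subfield_with_cubes (range (\<lambda>a :: 'f. a ^ 3))"
  unfolding subfield_with_cubes_def
  by (auto simp: cube_add_char_3[OF assms, symmetric] power_mult_distrib[symmetric])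

text \<open>Products reduce to degree at most 2 because \<theta>^3 is itself a cube and is absorbed
  into the cubic coefficients.\<close>

lemma subfield_cubes_adjoin:
  fixes \<theta> :: "'f::field"
  assumes "(3 :: 'f) = 0"
  shows "subfield_with_cubes {a ^ 3 + b ^ 3 * \<theta> + c ^ 3 * \<theta>\<^sup>2 | a b c. True}" (is "subfield_with_cubes ?K")
  unfolding subfield_with_cubes_def
proof (intro conjI ballI allI)
  fix x y assume "x \<in> ?K" "y \<in> ?K"
  then obtain a b c a' b' c' where xy: "x = a ^ 3 + b ^ 3 * \<theta> + c ^ 3 * \<theta>\<^sup>2" "y = a' ^ 3 + b' ^ 3 * \<theta> + c' ^ 3 * \<theta>\<^sup>2"
    by blast
  have "x + y = (a + a') ^ 3 + (b + b') ^ 3 * \<theta> + (c + c') ^ 3 * \<theta>\<^sup>2"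
    by (simp add: xy cube_add_char_3[OF assms] algebra_simps)
  then show "x + y \<in> ?K"
    by blast
  have "x * y = (a * a' + \<theta> * (b * c' + c * b')) ^ 3 + (a * b' + b * a' + \<theta> * (c * c')) ^ 3 * \<theta>
      + (a * c' + c * a' + b * b') ^ 3 * \<theta>\<^sup>2"
    by (simp add: xy cube_add_char_3[OF assms] power_mult_distrib) (simp add: power2_eq_square power3_eq_cube algebra_simps)
  then show "x * y \<in> ?K"
    by blast
next
  fix a
  have "a ^ 3 = a ^ 3 + 0 ^ 3 * \<theta> + 0 ^ 3 * \<theta>\<^sup>2"
    by simp
  then show "a ^ 3 \<in> ?K"
    by blast
qed

section \<open>Normal form and square-zero elements in characteristic 3\<close>

context okubo_algebra
begin

lemma generators_z: "g (z Z10) = \<alpha>" "g (z Z20) = \<alpha>\<^sup>2" "g (z Z01) = \<beta>"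
  by (simp_all add: g_coord \<phi>_z axis_def)

lemma g_smul: "g (k \<odot> x) = k ^ 3 * g x"
  by (simp add: mul_simps N_simps power3_eq_cube)

text \<open>If \<alpha> is a cube, rescale z10. Otherwise g(e) = 2 = -1 is read as a quadratic
  relation for \<beta> over the cubes with \<alpha> adjoined. Its constant term is nonzero, so
  \<beta> lies in that field; expanding 1/\<beta> there gives x in the span of z01, z11, z21 with
  g(x) = 1, paired with z20.\<close>

lemma exists_iso_char_3:
  assumes 3: "(3 :: 'f) = 0" and "has_nonzero_idempotent mul"
  obtains b \<psi> where "okubo_algebra smul mul n 1 b \<psi>"
proof -
  obtain e where e: "e \<star> e = e" "e \<noteq> 0"
    using assms(2) by (auto simp: has_nonzero_idempotent_def)
  have ge: "g e + 1 = 0"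
    using n_idempotent[OF e] e(1) 3 by (simp add: N_self)
  have zz: "z Z01 \<star> z Z10 = 0" "N (z Z10) (z Z01) = 0"
    by (simp_all add: coord_simps N_z)
  show thesis
  proof (cases "\<alpha> \<in> range (\<lambda>a. a ^ 3)")
    case True
    then obtain c where c: "\<alpha> = c ^ 3"
      by blast
    then have "c \<noteq> 0"
      using \<alpha> by auto
    then have g: "g (inverse c \<odot> z Z10) = 1"
      by (simp add: g_smul generators_z c power_inverse)
    have "z Z01 \<star> (inverse c \<odot> z Z10) = 0" "N (inverse c \<odot> z Z10) (z Z01) = 0"
      using zz by (simp_all only: mul_simps N_simps) simp_all
    from iso_of_generators[OF this] g generators_z(3) \<beta> show thesis
      using that by (metis one_neq_zero)
  next
    case False
    let ?K = "{a ^ 3 + b ^ 3 * \<alpha> + c ^ 3 * \<alpha>\<^sup>2 | a b c. True}"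
    define A0 A1 A2 where
      "A0 = 1 ^ 3 + \<phi> e $ Z10 ^ 3 * \<alpha> + \<phi> e $ Z20 ^ 3 * \<alpha>\<^sup>2" and
      "A1 = \<phi> e $ Z01 ^ 3 + \<phi> e $ Z11 ^ 3 * \<alpha> + \<phi> e $ Z21 ^ 3 * \<alpha>\<^sup>2" and
      "A2 = \<phi> e $ Z02 ^ 3 + \<phi> e $ Z12 ^ 3 * \<alpha> + \<phi> e $ Z22 ^ 3 * \<alpha>\<^sup>2"
    have sum: "A0 + A1 * \<beta> + A2 * \<beta>\<^sup>2 = 0"
      using ge by (simp add: g_coord 3 A0_def A1_def A2_def algebra_simps)
    have K: "A0 \<in> ?K" "A1 \<in> ?K" "A2 \<in> ?K"
      unfolding A0_def A1_def A2_def by blast+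
    have "A0 \<noteq> 0"
      using independent_over_cubes[OF 3 subfield_cubes[OF 3] _ _ _ _ False] unfolding A0_def
      by (metis power_one rangeI zero_neq_one)
    then have "\<beta> \<in> ?K"
      using independent_over_cubes[OF 3 subfield_cubes_adjoin[OF 3, of \<alpha>] K sum] by blast
    then have "inverse \<beta> \<in> ?K"
      by (rule subfield_with_cubes_closed(5)[OF subfield_cubes_adjoin[OF 3]])
    then obtain a b c where abc: "inverse \<beta> = a ^ 3 + b ^ 3 * \<alpha> + c ^ 3 * \<alpha>\<^sup>2"
      by blast
    define x where "x = a \<odot> z Z01 + b \<odot> z Z11 + c \<odot> z Z21"
    have "g x = \<beta> * (a ^ 3 + b ^ 3 * \<alpha> + c ^ 3 * \<alpha>\<^sup>2)"
      by (simp add: g_coord x_def \<phi>_simps \<phi>_z axis_def 3 algebra_simps)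
    then have gx: "g x = 1"
      using \<beta> by (simp add: abc[symmetric])
    have "z Z20 \<star> x = 0" "N x (z Z20) = 0"
      by (simp_all add: x_def coord_simps N_z)
    then show thesis
      using iso_of_generators[of "z Z20" x] that gx generators_z \<alpha> by auto
  qed
qed

lemma split_if_cube:
  assumes "\<alpha> = 1" "\<beta> = c ^ 3" shows "split_okubo smul mul"
proof -
  have "c \<noteq> 0"
    using \<beta> assms(2) by auto
  have zz: "z Z01 \<star> z Z10 = 0" "N (z Z10) (z Z01) = 0"
    by (simp_all add: coord_simps N_z)
  have "g (inverse c \<odot> z Z01) = 1" "g (z Z10) = 1"
    using \<open>c \<noteq> 0\<close> assms by (simp_all add: g_smul generators_z power_inverse)
  then obtain \<psi> where "okubo_algebra smul mul n 1 1 \<psi>"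
    using iso_of_generators[of "inverse c \<odot> z Z01" "z Z10"] zz by (auto simp: mul_simps N_simps)
  then show ?thesis
    unfolding okubo_algebra_def split_okubo_def by blast
qed

text \<open>In characteristic 3 the symmetrized product is the negative of the product of
  $\mathbb{F}[X,Y]/(X^3 - \alpha, Y^3 - \beta)$ modulo constants, with $z_{i,j}$ corresponding to
  $X^i Y^j$. For $\alpha = 1$ and $\beta$ not a cube this is $K[a]/(a^3)$, where $K = \mathbb{F}[Y]$ is
  a field and $a = X - 1$, and $u * u = 0$ forces $u \in K a^2$. Below, the vanishing of
  the constant coefficient of $u$ is \<open>l0\<close>, and \<open>a\<close>, \<open>q\<close>, \<open>s\<close> are the coordinates of its linear
  coefficient up to sign.\<close>

lemma square_zero_coords_char_3:
  assumes "\<alpha> = 1" and 3: "(3 :: 'f) = 0" and ncube: "\<beta> \<notin> range (\<lambda>a. a ^ 3)" and u: "u \<star> u = 0"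
  shows "\<phi> u $ Z10 = 0" "\<phi> u $ Z20 = 0" "\<phi> u $ Z11 = \<phi> u $ Z01" "\<phi> u $ Z21 = \<phi> u $ Z01"
    "\<phi> u $ Z12 = \<phi> u $ Z02" "\<phi> u $ Z22 = \<phi> u $ Z02"
proof -
  define a b c d e f h i where "a = \<phi> u $ Z10" and "b = \<phi> u $ Z20" and "c = \<phi> u $ Z01" and "d = \<phi> u $ Z02"
    and "e = \<phi> u $ Z11" and "f = \<phi> u $ Z22" and "h = \<phi> u $ Z12" and "i = \<phi> u $ Z21"
  note defs = a_def b_def c_def d_def e_def f_def h_def i_def
  have "g u = 0"
    using u by simp
  then have "(a + b) ^ 3 + (c + e + i) ^ 3 * \<beta> + (d + f + h) ^ 3 * \<beta>\<^sup>2 = 0"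
    by (simp add: g_coord assms(1) 3 defs cube_add_char_3[OF 3] algebra_simps)
  then have "(a + b) ^ 3 = 0 \<and> (c + e + i) ^ 3 = 0 \<and> (d + f + h) ^ 3 = 0"
    by (intro independent_over_cubes[OF 3 subfield_cubes[OF 3] _ _ _ _ ncube]) auto
  then have l0: "b = - a" "c = - e - i" "d = - f - h"
    by (simp_all add: eq_neg_iff_add_eq_0 eq_diff_eq add_ac)
  define q s where "q = e - i" and "s = h - f"
  have m: "- x - x = x" for x :: 'f
  proof -
    have "- x - x = x - 3 * x"
      by simp
    then show ?thesis
      by (simp add: 3)
  qed
  have "\<phi> (u \<star> u) $ Z20 = 0" "\<phi> (u \<star> u) $ Z21 = 0" "\<phi> (u \<star> u) $ Z22 = 0"
    by (simp_all add: u \<phi>_simps)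
  then have eqs: "a * a - \<beta> * c * f - \<beta> * e * h - \<beta> * i * d = 0" "\<beta> * h * h - a * e - c * b - \<beta> * f * d = 0"
    "e * e - b * d - c * i - h * a = 0"
    by (simp_all add: \<phi>_simps okubo_mult_nth assms(1) defs[symmetric])
  have "a * a - \<beta> * q * s = a * a - \<beta> * c * f - \<beta> * e * h - \<beta> * i * d - 3 * (\<beta> * f * i)"
    by (simp add: l0 q_def s_def algebra_simps)
  then have 1: "a * a = \<beta> * q * s"
    using eqs(1) 3 by simp
  have "\<beta> * s * s + a * q = \<beta> * h * h - a * e - c * b - \<beta> * f * d + 3 * (a * e) - 3 * (\<beta> * f * h)"
    by (simp add: l0 q_def s_def algebra_simps)
  then have 2: "\<beta> * s * s = - a * q"
    using eqs(2) 3 by (simp add: eq_neg_iff_add_eq_0)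
  have "q * q + a * s = e * e - b * d - c * i - h * a - 3 * (e * i) + 3 * (a * h)"
    by (simp add: l0 q_def s_def algebra_simps)
  then have 3: "q * q = - a * s"
    using eqs(3) 3 by (simp add: eq_neg_iff_add_eq_0)
  have "s = 0"
  proof (rule ccontr)
    assume "s \<noteq> 0"
    have "\<beta> * s ^ 3 = (\<beta> * s * s) * s"
      by (simp add: power3_eq_cube)
    also have "\<dots> = (- a * s) * q"
      by (simp add: 2)
    also have "\<dots> = q ^ 3"
      by (simp only: 3[symmetric] power3_eq_cube)
    finally have "\<beta> = (q / s) ^ 3"
      using \<open>s \<noteq> 0\<close> by (simp add: field_simps)
    then show False
      using ncube by blast
  qed
  then have "q = 0" "a = 0"
    using 1 3 by simp_all
  with \<open>s = 0\<close> show "\<phi> u $ Z10 = 0" "\<phi> u $ Z20 = 0" "\<phi> u $ Z11 = \<phi> u $ Z01" "\<phi> u $ Z21 = \<phi> u $ Z01"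
    "\<phi> u $ Z12 = \<phi> u $ Z02" "\<phi> u $ Z22 = \<phi> u $ Z02"
    using l0 m[of i] m[of f] by (simp_all add: defs[symmetric] q_def s_def)
qed

lemma square_zero_mul_char_3:
  assumes "\<alpha> = 1" and 3: "(3 :: 'f) = 0" and ncube: "\<beta> \<notin> range (\<lambda>a. a ^ 3)"
    and u: "u \<star> u = 0" and v: "v \<star> v = 0"
  shows "u \<star> v = 0"
proof -
  have m: "x + x + x = 0" for x :: 'f
  proof -
    have "x + x + x = 3 * x"
      by simp
    then show ?thesis
      by (simp add: 3)
  qed
  show ?thesis
    using square_zero_coords_char_3[OF assms(1) 3 ncube u] square_zero_coords_char_3[OF assms(1) 3 ncube v]
      m[of "\<beta> * \<phi> u $ Z02 * \<phi> v $ Z01"] m[of "\<beta> * \<phi> u $ Z01 * \<phi> v $ Z02"]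
    by (simp add: coord_simps assms(1) algebra_simps)
qed

end

section \<open>Components and diameters of the orthogonality graph\<close>

lemma sccs_verts_eqI:
  assumes "wf_digraph G" and cover: "\<Union>P = verts G" and ne: "{} \<notin> P"
    and closed: "\<And>C u v. C \<in> P \<Longrightarrow> u \<in> C \<Longrightarrow> (u, v) \<in> arcs_ends G \<Longrightarrow> v \<in> C"
    and conn: "\<And>C u v. C \<in> P \<Longrightarrow> u \<in> C \<Longrightarrow> v \<in> C \<Longrightarrow> u \<rightarrow>\<^sup>*\<^bsub>G\<^esub> v"
  shows "pre_digraph.sccs_verts G = P"
proof -
  interpret wf_digraph G by fact
  \<comment> \<open>Members of P are closed under reachability, so two members that meet coincide; P
    may thus be a family with repetitions, such as the sets indexed by x.\<close>
  have reach: "v \<in> C" if "u \<rightarrow>\<^sup>*\<^bsub>G\<^esub> v" "C \<in> P" "u \<in> C" for u v C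
    using that by (induction rule: reachable_induct) (auto intro: closed)
  show ?thesis
  proof (intro equalityI subsetI)
    fix C assume C: "C \<in> P"
    then have "C \<noteq> {}"
      using ne by blast
    then show "C \<in> sccs_verts"
      unfolding in_sccs_verts_conv_reachable using C conn reach by blast
  next
    fix S assume "S \<in> sccs_verts"
    then have S: "S \<noteq> {}" "\<And>u v. u \<in> S \<Longrightarrow> v \<in> S \<Longrightarrow> u \<rightarrow>\<^sup>*\<^bsub>G\<^esub> v"
      "\<And>u v. u \<in> S \<Longrightarrow> v \<notin> S \<Longrightarrow> \<not> u \<rightarrow>\<^sup>*\<^bsub>G\<^esub> v \<or> \<not> v \<rightarrow>\<^sup>*\<^bsub>G\<^esub> u"
      unfolding in_sccs_verts_conv_reachable by blast+
    then obtain u where u: "u \<in> S"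
      by blast
    then have "u \<in> verts G"
      using S(2) reachable_in_verts by blast
    then obtain C where C: "C \<in> P" "u \<in> C"
      using cover by blast
    have "S = C"
      using S(2,3) u C conn reach by blast
    then show "S \<in> P"
      using C by simp
  qed
qed

lemma awalk_imp_relpow:
  assumes "wf_digraph G"
  shows "pre_digraph.awalk G u p v \<Longrightarrow> (u, v) \<in> arcs_ends G ^^ length p"
proof (induction p arbitrary: u)
  interpret wf_digraph G by fact
  case Nil
  then show ?case
    by (simp add: awalk_Nil_iff)
next
  interpret wf_digraph G by fact
  case (Cons e p)
  then have "(u, head G e) \<in> arcs_ends G" "(head G e, v) \<in> arcs_ends G ^^ length p"
    by (auto simp: awalk_Cons_iff arcs_ends_conv)
  then show ?case
    unfolding list.size add_Suc_right add_0_right by (rule relpow_Suc_I2)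
qed

lemma relpow_imp_awalk:
  assumes "wf_digraph G" "u \<in> verts G" "(u, v) \<in> arcs_ends G ^^ k"
  shows "\<exists>p. pre_digraph.awalk G u p v \<and> length p = k"
  using assms(2,3)
proof (induction k arbitrary: u)
  interpret wf_digraph G by fact
  case 0
  then show ?case
    by (auto simp: awalk_Nil_iff)
next
  interpret wf_digraph G by fact
  case (Suc k)
  obtain w where w: "(u, w) \<in> arcs_ends G" "(w, v) \<in> arcs_ends G ^^ k"
    using Suc.prems(2) by (rule relpow_Suc_E2)
  then obtain e where e: "e \<in> arcs G" "tail G e = u" "head G e = w"
    by (auto simp: arcs_ends_conv)
  then obtain p where "awalk w p v" "length p = k"
    using Suc.IH[of w] w(2) by auto
  then show ?case
    using e by (intro exI[of _ "e # p"]) (simp add: awalk_Cons_iff)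
qed

lemma graph_diameter_eqI:
  assumes wf: "wf_digraph G" and uv: "u \<in> verts G" "v \<in> verts G"
    and upper: "\<And>u v. u \<in> verts G \<Longrightarrow> v \<in> verts G \<Longrightarrow> \<exists>k\<le>d. (u, v) \<in> arcs_ends G ^^ k"
    and lower: "\<And>k. k < d \<Longrightarrow> (u, v) \<notin> arcs_ends G ^^ k"
  shows "graph_diameter G = ereal (real d)"
proof -
  interpret wf_digraph G by fact
  have cost: "awalk_cost (\<lambda>_. 1) p = real (length p)" for p
    by (induction p) simp_all
  show ?thesis
  proof (rule antisym)
    show "graph_diameter G \<le> ereal (real d)"
      unfolding graph_diameter_def
    proof (intro SUP_least)
      fix x y assume "x \<in> verts G" "y \<in> verts G"
      then obtain k p where "k \<le> d" "awalk x p y" "length p = k"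
        using upper relpow_imp_awalk[OF wf] by metis
      then show "\<mu> (\<lambda>_. 1) x y \<le> ereal (real d)"
        using min_cost_le_walk_cost[of x p y "\<lambda>_. 1"] unfolding cost
        by (meson ereal_less_eq(3) of_nat_le_iff order_trans)
    qed
    have "ereal (real d) \<le> \<mu> (\<lambda>_. 1) u v"
      unfolding \<mu>_def
    proof (intro INF_greatest)
      fix p assume "p \<in> {p. awalk u p v}"
      then have "\<not> length p < d"
        using awalk_imp_relpow[OF wf] lower by blast
      then show "ereal (real d) \<le> ereal (awalk_cost (\<lambda>_. 1) p)"
        by (simp add: cost)
    qed
    also have "\<dots> \<le> graph_diameter G"
      unfolding graph_diameter_def using uv by (meson SUP_upper SUP_upper2)
    finally show "ereal (real d) \<le> graph_diameter G" .
  qed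
qed

lemma relpow_restrict:
  assumes closed: "\<And>u v. u \<in> C \<Longrightarrow> (u, v) \<in> E \<Longrightarrow> v \<in> C"
  shows "u \<in> C \<Longrightarrow> (u, v) \<in> E ^^ k \<Longrightarrow> (u, v) \<in> (E \<inter> C \<times> C) ^^ k"
proof (induction k arbitrary: u)
  case (Suc k)
  from Suc.prems(2) obtain w where w: "(u, w) \<in> E" "(w, v) \<in> E ^^ k"
    by (rule relpow_Suc_E2)
  then have "w \<in> C"
    using closed Suc.prems(1) by blast
  then show ?case
    using w Suc by (intro relpow_Suc_I2[of u w]) auto
qed simp

lemma relpow_mono_rel:
  fixes R S :: "('b \<times> 'b) set"
  assumes "R \<subseteq> S" shows "R ^^ k \<subseteq> S ^^ k"
  by (induction k) (use assms in auto)

lemma relpow_2I: "(a, b) \<in> R \<Longrightarrow> (b, c) \<in> R \<Longrightarrow> (a, c) \<in> R ^^ 2"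
  by (auto simp: numeral_2_eq_2)

text \<open>Upper bounds use powers of \<open>E\<^sup>=\<close> because consecutive lines of a
  constructed walk may coincide.\<close>

lemma relpow_reflcl: "(u, v) \<in> (E\<^sup>=) ^^ k \<Longrightarrow> \<exists>j\<le>k. (u, v) \<in> E ^^ j"
proof (induction k arbitrary: v)
  case (Suc k)
  then obtain w where w: "(u, w) \<in> (E\<^sup>=) ^^ k" "(w, v) \<in> E\<^sup>="
    by auto
  then obtain j where j: "j \<le> k" "(u, w) \<in> E ^^ j"
    using Suc.IH by blast
  show ?case
  proof (cases "w = v")
    case True
    then show ?thesis
      using j le_SucI by blast
  next
    case False
    then have "(u, v) \<in> E ^^ Suc j"
      using j(2) w(2) by auto
    then show ?thesis
      using j(1) Suc_le_mono by blast
  qed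
qed simp

lemma arcs_ends_induce_subgraph: "arcs_ends (G \<restriction> C) = arcs_ends G \<inter> C \<times> C"
  by (auto simp: arcs_ends_conv)

lemma wf_induce_subgraph: "wf_digraph (G \<restriction> C)"
  by unfold_locales auto

lemma graph_diameter_closed_eqI:
  assumes closed: "\<And>u v. u \<in> C \<Longrightarrow> (u, v) \<in> arcs_ends G \<Longrightarrow> v \<in> C"
    and uv: "u \<in> C" "v \<in> C"
    and upper: "\<And>u v. u \<in> C \<Longrightarrow> v \<in> C \<Longrightarrow> (u, v) \<in> ((arcs_ends G)\<^sup>=) ^^ d"
    and lower: "\<And>k. k < d \<Longrightarrow> (u, v) \<notin> arcs_ends G ^^ k"
  shows "graph_diameter (G \<restriction> C) = ereal (real d)"
proof (rule graph_diameter_eqI[OF wf_induce_subgraph, where u = u and v = v])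
  show "\<exists>k\<le>d. (x, y) \<in> arcs_ends (G \<restriction> C) ^^ k" if "x \<in> verts (G \<restriction> C)" "y \<in> verts (G \<restriction> C)" for x y
  proof -
    have xy: "x \<in> C" "y \<in> C"
      using that by simp_all
    then obtain k where k: "k \<le> d" "(x, y) \<in> arcs_ends G ^^ k"
      using relpow_reflcl[OF upper] by blast
    have "(x, y) \<in> (arcs_ends G \<inter> C \<times> C) ^^ k"
      by (rule relpow_restrict[OF closed xy(1) k(2)])
    then show ?thesis
      unfolding arcs_ends_induce_subgraph using k(1) by blast
  qed
  show "(u, v) \<notin> arcs_ends (G \<restriction> C) ^^ k" if "k < d" for k
    using lower[OF that] relpow_mono_rel[of "arcs_ends G \<inter> C \<times> C" "arcs_ends G"]
    unfolding arcs_ends_induce_subgraph by blast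
qed (use uv in simp_all)

lemma reachable_of_relpow:
  assumes "wf_digraph G" "(u, v) \<in> ((arcs_ends G)\<^sup>=) ^^ k" "u \<in> verts G"
  shows "u \<rightarrow>\<^sup>*\<^bsub>G\<^esub> v"
proof -
  interpret wf_digraph G by fact
  obtain j where "(u, v) \<in> arcs_ends G ^^ j"
    using relpow_reflcl[OF assms(2)] by blast
  then obtain p where "awalk u p v"
    using relpow_imp_awalk[OF assms(1,3)] by blast
  then show ?thesis
    by (rule reachable_awalkI)
qed

text \<open>A longer walk must leave u through u' and reach v through v', so only its inner part is
  left to bound.\<close>

lemma relpow_pendants:
  assumes sym: "sym E" and "(u, v) \<in> E ^^ k"
    and u: "\<And>w. (u, w) \<in> E \<Longrightarrow> w = u'" and v: "\<And>w. (v, w) \<in> E \<Longrightarrow> w = v'"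
  shows "u = v \<or> (u, v) \<in> E \<or> (\<exists>j. k = Suc (Suc j) \<and> (u', v') \<in> E ^^ j)"
proof (cases k)
  case (Suc l)
  then obtain w where w: "(u, w) \<in> E" "(w, v) \<in> E ^^ l"
    using assms(2) relpow_Suc_E2 by metis
  show ?thesis
  proof (cases l)
    case (Suc j)
    then obtain x where x: "(w, x) \<in> E ^^ j" "(x, v) \<in> E"
      using w(2) by (auto elim: relpow_Suc_E)
    then have "x = v'"
      using v sym by (auto dest: symD)
    then show ?thesis
      using u[OF w(1)] x(1) \<open>k = Suc l\<close> Suc by auto
  qed (use w in auto)
qed (use assms(2) in auto)

section \<open>Neighbours, paths and diameters in the orthogonality graph\<close>

context okubo_algebra
begin

abbreviation L :: "'a \<Rightarrow> 'a set" where
  "L \<equiv> line smul"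

abbreviation \<Gamma> :: "('a set, 'a set \<times> 'a set) pre_digraph" where
  "\<Gamma> \<equiv> orthogonality_graph smul mul"

abbreviation Z :: "'a set" where
  "Z \<equiv> zero_divisors mul"

abbreviation E :: "('a set \<times> 'a set) set" where
  "E \<equiv> arcs_ends \<Gamma>"

lemma Z_iff: "x \<in> Z \<longleftrightarrow> x \<noteq> 0 \<and> n x = 0"
  by (simp add: zero_divisors_eq)

lemma L_eq_iff:
  assumes "x \<noteq> 0" "y \<noteq> 0"
  shows "L x = L y \<longleftrightarrow> (\<exists>c. c \<noteq> 0 \<and> y = c \<odot> x)"
proof
  assume "L x = L y"
  moreover have "y \<in> L y"
    unfolding line_def using vs.scale_one[of y] by (metis rangeI)
  ultimately obtain c where "y = c \<odot> x"
    by (auto simp: line_def)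
  then show "\<exists>c. c \<noteq> 0 \<and> y = c \<odot> x"
    using assms(2) by auto
next
  assume "\<exists>c. c \<noteq> 0 \<and> y = c \<odot> x"
  then obtain c where c: "c \<noteq> 0" "y = c \<odot> x"
    by blast
  have "k \<odot> x \<in> range (\<lambda>d. d \<odot> y)" "k \<odot> y \<in> range (\<lambda>d. d \<odot> x)" for k
    using c by (auto intro: range_eqI[of _ _ "k / c"] range_eqI[of _ _ "k * c"])
  then show "L x = L y"
    unfolding line_def by blast
qed

lemma L_smul: "c \<noteq> 0 \<Longrightarrow> L (c \<odot> x) = L x"
proof (cases "x = 0")
  case False
  assume "c \<noteq> 0"
  with False have "L x = L (c \<odot> x)"
    by (subst L_eq_iff) auto
  then show ?thesis ..
qed simp

lemma verts_\<Gamma>: "verts \<Gamma> = L ` Z"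
  by (simp add: orthogonality_graph_def two_sided_zero_divisors_eq zero_divisors_eq)

lemma E_def: "E = {(L a, L b) | a b. a \<in> Z \<and> b \<in> Z \<and> L a \<noteq> L b \<and> b \<in> Orth a}"
  by (simp add: orthogonality_graph_def two_sided_zero_divisors_eq zero_divisors_eq orthogonalizer_def)

lemma wf_\<Gamma>: "wf_digraph \<Gamma>"
  by unfold_locales (auto simp: orthogonality_graph_def)

lemma Orth_of_smul: "c \<noteq> 0 \<Longrightarrow> Orth (c \<odot> x) = Orth x"
  by (auto simp: orthogonalizer_def mul_simps)

lemma E_iff:
  assumes "a \<in> Z" "b \<in> Z"
  shows "(L a, L b) \<in> E \<longleftrightarrow> L a \<noteq> L b \<and> b \<in> Orth a"
proof
  assume "(L a, L b) \<in> E"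
  then obtain a' b' where ab: "L a = L a'" "L b = L b'" "a' \<in> Z" "b' \<in> Z" "L a \<noteq> L b" "b' \<in> Orth a'"
    by (auto simp: E_def)
  then obtain c d where "a' = c \<odot> a" "c \<noteq> 0" "b' = d \<odot> b" "d \<noteq> 0"
    using assms L_eq_iff Z_iff by metis
  then show "L a \<noteq> L b \<and> b \<in> Orth a"
    using ab(5,6) by (simp add: orthogonalizer_def mul_simps)
qed (use assms in \<open>auto simp: E_def\<close>)

lemma E_cases:
  assumes "(L a, w) \<in> E" "a \<in> Z"
  obtains b where "b \<in> Z" "w = L b" "b \<in> Orth a" "L a \<noteq> L b"
proof -
  obtain b where "b \<in> Z" "w = L b"
    using assms(1) by (auto simp: E_def)
  then show thesis
    using that assms E_iff by blast
qed

lemma E_reflI: "a \<in> Z \<Longrightarrow> b \<in> Z \<Longrightarrow> b \<in> Orth a \<Longrightarrow> (L a, L b) \<in> E\<^sup>="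
  by (auto simp: E_iff)

lemma sym_E: "sym E"
  unfolding sym_def E_def using Orth_sym by blast

lemma g_L: "L x = L y \<Longrightarrow> x \<in> Z \<Longrightarrow> y \<in> Z \<Longrightarrow> g x = 0 \<longleftrightarrow> g y = 0"
  by (auto simp: L_eq_iff Z_iff g_smul)

lemma square_in_Z: "x \<in> Z \<Longrightarrow> x \<star> x \<noteq> 0 \<Longrightarrow> x \<star> x \<in> Z"
  by (simp add: Z_iff n_mul)

lemma square_zero_in_Z: "x \<noteq> 0 \<Longrightarrow> x \<star> x = 0 \<Longrightarrow> x \<in> Z"
  by (simp add: Z_iff square_zero_isotropic)

lemma N_Orth_square_zero:
  assumes "u \<noteq> 0" "u \<star> u = 0" "b \<in> Orth u" shows "N u b = 0"
  using mul_flip_left[of u u b] assms by (simp add: orthogonalizer_def)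

lemma square_of_g_nonzero:
  assumes "x \<in> Z" "g x \<noteq> 0"
  shows "x \<star> x \<in> Z" "g (x \<star> x) \<noteq> 0" "L x \<noteq> L (x \<star> x)" "L ((x \<star> x) \<star> (x \<star> x)) = L x"
proof -
  have nz: "x \<star> x \<noteq> 0"
    using assms(2) by auto
  then show Z: "x \<star> x \<in> Z"
    using square_in_Z assms(1) by blast
  have sq: "(x \<star> x) \<star> (x \<star> x) = g x \<odot> x"
    using assms(1) square_square_isotropic by (simp add: Z_iff)
  show "g (x \<star> x) \<noteq> 0"
    using assms(2) by (simp add: sq N_simps N_sym)
  show "L ((x \<star> x) \<star> (x \<star> x)) = L x"
    using assms(2) by (simp add: sq L_smul)
  show "L x \<noteq> L (x \<star> x)"
    using assms Z by (auto simp: L_eq_iff Z_iff N_simps N_self)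
qed

lemma Vx_neighbour:
  assumes "x \<in> Z" "g x \<noteq> 0" "(L x, w) \<in> E"
  shows "w = L (x \<star> x)"
proof -
  obtain b where b: "b \<in> Z" "w = L b" "b \<in> Orth x"
    using assms by (auto elim: E_cases)
  then obtain c where "b = c \<odot> (x \<star> x)"
    using Orth_of_g_nonzero assms by (auto simp: Z_iff)
  then show ?thesis
    using b L_smul by (auto simp: Z_iff)
qed

lemma Vx_closed:
  assumes "x \<in> Z" "g x \<noteq> 0" "u \<in> Vx smul mul x" "(u, w) \<in> E"
  shows "w \<in> Vx smul mul x"
  using assms Vx_neighbour[of x w] Vx_neighbour[of "x \<star> x" w] square_of_g_nonzero[OF assms(1,2)] by (auto simp: Vx_def)

lemma Vx_upper:
  assumes "x \<in> Z" "g x \<noteq> 0" "u \<in> Vx smul mul x" "v \<in> Vx smul mul x"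
  shows "(u, v) \<in> E\<^sup>="
proof -
  have "(L x, L (x \<star> x)) \<in> E"
    using E_iff[OF assms(1) square_of_g_nonzero(1)[OF assms(1,2)]] square_of_g_nonzero(3)[OF assms(1,2)] square_in_Orth assms(1)
    by (simp add: Z_iff)
  then show ?thesis
    using assms(3,4) sym_E by (auto simp: Vx_def dest: symD)
qed

lemma Vx_diameter:
  assumes "x \<in> Z" "g x \<noteq> 0"
  shows "graph_diameter (\<Gamma> \<restriction> Vx smul mul x) = 1"
  using graph_diameter_closed_eqI[of "Vx smul mul x" \<Gamma> "L x" "L (x \<star> x)" 1]
    Vx_closed[OF assms] Vx_upper[OF assms] square_of_g_nonzero(3)[OF assms]
  by (auto simp: Vx_def one_ereal_def)

lemma Orth_square_zero:
  assumes "u \<noteq> 0" "u \<star> u = 0" "b \<in> Orth u"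
  shows "n b = 0" "\<exists>k. b \<star> b = k \<odot> u" "g b = 0"
proof -
  obtain v where "N u v = 1"
    using exists_dual[OF assms(1)] .
  then interpret s: square_zero smul mul n \<alpha> \<beta> \<phi> u v
    by unfold_locales (use assms in auto)
  show "n b = 0"
    using s.n_Orth_u assms(3) .
  have "b \<star> b = N v (b \<star> b) \<odot> u"
    using s.Orth_u_square[OF assms(3)] .
  then show "\<exists>k. b \<star> b = k \<odot> u" "g b = 0"
    using s.N_Orth_u(2)[OF assms(3)] by (blast, metis N_smul_right mult_zero_right)
qed

lemma square_zero_path2:
  assumes u: "u \<noteq> 0" "u \<star> u = 0" and v: "v \<noteq> 0" "v \<star> v = 0" and "N u v = 0"
  shows "(L u, L v) \<in> (E\<^sup>=) ^^ 2"
proof -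
  have path: "(L a, L b) \<in> (E\<^sup>=) ^^ 2"
    if "a \<noteq> 0" "a \<star> a = 0" "b \<noteq> 0" "b \<star> b = 0" "N a b = 0" "a \<star> b \<noteq> 0" for a b
  proof -
    have "n a = 0" "n b = 0"
      using that square_zero_isotropic by auto
    then have "a \<star> b \<in> Orth a" "a \<star> b \<in> Orth b" "a \<star> b \<in> Z"
      using that mul_flip_right[of a a b] mul_flip_left[of a b b]
      by (simp_all add: orthogonalizer_def Z_iff n_mul mul_mul_same_left mul_mul_same_right)
    then have "(L a, L (a \<star> b)) \<in> E\<^sup>=" "(L (a \<star> b), L b) \<in> E\<^sup>="
      using that square_zero_in_Z E_reflI Orth_sym by blast+
    then show ?thesis
      by (rule relpow_2I)
  qed
  consider "u \<star> v \<noteq> 0" | "v \<star> u \<noteq> 0" | "v \<in> Orth u"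
    by (auto simp: orthogonalizer_def)
  then show ?thesis
  proof cases
    case 2
    then have "(L v, L u) \<in> (E\<^sup>=) ^^ 2"
      using path assms N_sym by metis
    then show ?thesis
      using sym_E by (auto simp: numeral_2_eq_2 dest: symD)
  next
    case 3
    then have "(L u, L v) \<in> E\<^sup>="
      using assms square_zero_in_Z E_reflI by blast
    then show ?thesis
      by (auto simp: numeral_2_eq_2)
  qed (use path assms in blast)
qed

lemma square_zero_path3:
  fixes \<omega> :: 'f
  assumes \<omega>: "\<omega>\<^sup>2 + \<omega> + 1 = 0" and u: "u \<noteq> 0" "u \<star> u = 0" and v: "v \<noteq> 0" "v \<star> v = 0"
  shows "(L u, L v) \<in> (E\<^sup>=) ^^ 3"
proof (cases "N u v = 0")
  case True
  then have "(L u, L v) \<in> (E\<^sup>=) ^^ 2"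
    using square_zero_path2 assms by blast
  then show ?thesis
    unfolding numeral_3_eq_3 numeral_2_eq_2 by (rule relpow_Suc_I) simp
next
  case False
  define v' where "v' = inverse (N u v) \<odot> v"
  have v': "N u v' = 1" "v' \<noteq> 0" "v' \<star> v' = 0" "L v' = L v"
    using False v by (simp_all add: v'_def N_simps mul_simps L_smul)
  interpret s: square_zero smul mul n \<alpha> \<beta> \<phi> u v'
    by unfold_locales (use u v' in auto)
  obtain a where a: "a \<in> Orth u" "a \<noteq> 0" "N a v' = 0" "a \<star> a = 0"
    using s.exists_square_zero_in_Orth_u[OF \<omega>] .
  have "(L u, L a) \<in> E\<^sup>="
    using a u square_zero_in_Z E_reflI by blast
  moreover have "(L a, L v) \<in> (E\<^sup>=) ^^ 2"
    using square_zero_path2[OF a(2,4) v'(2,3) a(3)] v'(4) by simp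
  ultimately show ?thesis
    unfolding numeral_3_eq_3 numeral_2_eq_2 by (rule relpow_Suc_I2)
qed

lemma V0_iff: "x \<in> Z \<Longrightarrow> L x \<in> V0 smul mul n \<longleftrightarrow> g x = 0"
  unfolding V0_def using g_L by blast

text \<open>A neighbour b with g(b) nonzero is joined only to the line of b*b, where g is again
  nonzero.\<close>

lemma V0_closed:
  assumes "u \<in> V0 smul mul n" "(u, w) \<in> E"
  shows "w \<in> V0 smul mul n"
proof -
  obtain x where x: "u = L x" "x \<in> Z" "g x = 0"
    using assms(1) by (auto simp: V0_def)
  then obtain b where b: "b \<in> Z" "w = L b" "b \<in> Orth x" "L x \<noteq> L b"
    using E_cases[of x w] assms(2) by blast
  have "g b = 0"
  proof (rule ccontr)
    assume "g b \<noteq> 0"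
    then obtain c where c: "x = c \<odot> (b \<star> b)"
      using Orth_of_g_nonzero[of b x] b Orth_sym by (auto simp: Z_iff)
    then have "L x = L (b \<star> b)"
      using x(2) L_smul by (auto simp: Z_iff)
    then show False
      using g_L square_of_g_nonzero(1,2)[OF b(1) \<open>g b \<noteq> 0\<close>] x by blast
  qed
  then show ?thesis
    using V0_iff b by simp
qed

lemma V0_to_square_zero:
  assumes "w \<in> V0 smul mul n"
  obtains u where "u \<noteq> 0" "u \<star> u = 0" "(w, L u) \<in> E\<^sup>=" "(L u, w) \<in> E\<^sup>="
proof -
  obtain x where x: "w = L x" "x \<in> Z" "g x = 0"
    using assms by (auto simp: V0_def)
  show thesis
  proof (cases "x \<star> x = 0")
    case True
    then show thesis
      using that[of x] x by (simp add: Z_iff)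
  next
    case False
    have "(w, L (x \<star> x)) \<in> E\<^sup>="
      using E_reflI x False square_in_Z square_in_Orth Z_iff by metis
    moreover have "(x \<star> x) \<star> (x \<star> x) = 0"
      using square_square_isotropic x by (simp add: Z_iff)
    ultimately show thesis
      using that False sym_E by (auto dest: symD)
  qed
qed

lemma V0_upper:
  assumes "\<And>u v. u \<noteq> 0 \<Longrightarrow> u \<star> u = 0 \<Longrightarrow> v \<noteq> 0 \<Longrightarrow> v \<star> v = 0 \<Longrightarrow> (L u, L v) \<in> (E\<^sup>=) ^^ k"
    and "x \<in> V0 smul mul n" "y \<in> V0 smul mul n" and d: "d = Suc (Suc k)"
  shows "(x, y) \<in> (E\<^sup>=) ^^ d"
proof -
  obtain u where u: "u \<noteq> 0" "u \<star> u = 0" "(x, L u) \<in> E\<^sup>="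
    using V0_to_square_zero[OF assms(2)] .
  obtain v where v: "v \<noteq> 0" "v \<star> v = 0" "(L v, y) \<in> E\<^sup>="
    using V0_to_square_zero[OF assms(3)] .
  show ?thesis
    unfolding d
    by (rule relpow_Suc_I2[OF u(3)], rule relpow_Suc_I[OF _ v(3)], rule assms(1)) (use u v in auto)
qed

lemma pendant_neighbour:
  assumes "y \<in> Z" "\<And>b. b \<in> Orth y \<Longrightarrow> \<exists>c. b = c \<odot> u" "(L y, w) \<in> E"
  shows "w = L u"
proof -
  obtain b where "b \<in> Z" "w = L b" "b \<in> Orth y"
    using assms(1,3) by (auto elim: E_cases)
  then show ?thesis
    using assms(2)[of b] L_smul[of _ u] by (auto simp: Z_iff)
qed

lemma pendants_walk:
  assumes u: "u \<star> u = 0" "v \<star> v = 0" "L u \<noteq> L v"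
    and x: "n x = 0" "x \<star> x = a \<odot> u" "a \<odot> u \<noteq> 0" "\<And>b. b \<in> Orth x \<Longrightarrow> \<exists>c. b = c \<odot> u"
    and y: "n y = 0" "y \<star> y = b \<odot> v" "b \<odot> v \<noteq> 0" "\<And>b. b \<in> Orth y \<Longrightarrow> \<exists>c. b = c \<odot> v"
  shows "L x \<in> V0 smul mul n" "L y \<in> V0 smul mul n"
    "(L x, L y) \<in> E ^^ k \<Longrightarrow> \<exists>j. k = Suc (Suc j) \<and> (L u, L v) \<in> E ^^ j"
proof -
  have xyZ: "x \<in> Z" "y \<in> Z"
    using x y by (auto simp: Z_iff)
  have adj: "(L x, L u) \<in> E" "(L y, L v) \<in> E"
  proof -
    have *: "(L x, L u) \<in> E" if h: "u \<star> u = 0" "n x = 0" "x \<star> x = a \<odot> u" "a \<odot> u \<noteq> 0" "x \<in> Z" for x u a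
    proof -
      have "L u = L (x \<star> x)"
        using that L_smul[of a u] by auto
      moreover have "L x \<noteq> L (x \<star> x)"
      proof
        assume "L x = L (x \<star> x)"
        then obtain c where c: "c \<noteq> 0" "x \<star> x = c \<odot> x"
          using L_eq_iff[of x "x \<star> x"] h(3-5) by (auto simp: Z_iff)
        have "(x \<star> x) \<star> (x \<star> x) = 0"
          using h(1) by (simp add: h(3) mul_simps)
        then have "(c \<odot> x) \<star> (c \<odot> x) = 0"
          by (simp only: c(2))
        then show False
          using c(1) h(3,4) by (simp add: mul_simps)
      qed
      moreover have "x \<star> x \<in> Z" "x \<star> x \<in> Orth x"
        using h square_in_Z[of x] square_in_Orth[of x] by simp_all
      ultimately show ?thesis
        using E_iff that(5) by metis
    qed
    show "(L x, L u) \<in> E" "(L y, L v) \<in> E"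
      using * u x y xyZ by blast+
  qed
  have nb: "w = L u" if "(L x, w) \<in> E" for w
    using pendant_neighbour[OF xyZ(1) x(4) that] .
  have nb': "w = L v" if "(L y, w) \<in> E" for w
    using pendant_neighbour[OF xyZ(2) y(4) that] .
  have "g x = 0" "g y = 0"
    using mul_mul_same_left[of x x] mul_mul_same_right[of x x] N_mul[of x x x] x y
      square_square_isotropic[of x] square_square_isotropic[of y] u xyZ
    by (auto simp: Z_iff mul_simps)
  then show "L x \<in> V0 smul mul n" "L y \<in> V0 smul mul n"
    using V0_iff xyZ by simp_all
  have "L x \<noteq> L y"
    using adj nb' u(3) by metis
  moreover have "(L x, L y) \<notin> E"
  proof
    assume "(L x, L y) \<in> E"
    then have "L y = L u"
      by (rule nb)
    then obtain c where "u = c \<odot> y" "c \<noteq> 0"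
      using L_eq_iff xyZ x(3) by (metis Z_iff vs.scale_zero_right)
    then have "y \<star> y = 0"
      using u(1) by (simp add: mul_simps)
    then show False
      using y by simp
  qed
  ultimately show "(L x, L y) \<in> E ^^ k \<Longrightarrow> \<exists>j. k = Suc (Suc j) \<and> (L u, L v) \<in> E ^^ j"
    using relpow_pendants[OF sym_E _ nb nb'] by metis
qed

text \<open>Orthogonal or equal square-zero lines have n(u,v) = 0, and a common neighbour b gives
  n(u,v) b = (u*b)*v + (v*b)*u = 0.\<close>

lemma square_zero_distance:
  assumes "u \<noteq> 0" "u \<star> u = 0" "v \<noteq> 0" "v \<star> v = 0" "N u v \<noteq> 0" "(L u, L v) \<in> E ^^ j"
  shows "3 \<le> j"
proof (rule ccontr)
  have Z: "u \<in> Z" "v \<in> Z"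
    using assms square_zero_in_Z by auto
  assume "\<not> 3 \<le> j"
  then consider "j = 0" | "j = 1" | "j = 2"
    by linarith
  then show False
  proof cases
    case 1
    then obtain c where "v = c \<odot> u"
      using assms L_eq_iff by auto
    then show False
      using assms(5) Z by (simp add: N_simps N_self Z_iff)
  next
    case 2
    then have "v \<in> Orth u"
      using assms(6) E_iff Z by auto
    then show False
      using N_Orth_square_zero assms by blast
  next
    case 3
    then obtain w where "(L u, w) \<in> E" "(w, L v) \<in> E"
      using assms(6) by (auto simp: numeral_2_eq_2)
    then obtain b where "b \<in> Z" "b \<in> Orth u" "b \<in> Orth v"
      using Z sym_E E_iff by (metis E_cases symD)
    then have "N u v \<odot> b = 0"
      using mul_flip_left[of u b v] by (simp add: orthogonalizer_def)
    then show False
      using assms(5) \<open>b \<in> Z\<close> by (simp add: Z_iff)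
  qed
qed

text \<open>The upper bound is 3 between square-zero lines plus one step at each end. Pendants
  attached to two nonorthogonal square-zero lines attain it.\<close>

lemma V0_diameter_split:
  fixes \<omega> :: 'f
  assumes \<omega>: "\<omega>\<^sup>2 + \<omega> + 1 = 0" and "split_okubo smul mul"
  shows "graph_diameter (\<Gamma> \<restriction> V0 smul mul n) = 5"
proof -
  obtain \<psi> where "okubo_iso smul mul 1 1 \<psi>"
    using assms(2) by (auto simp: split_okubo_def)
  then have "okubo_algebra smul mul n 1 1 \<psi>"
    by (rule mul_unique_norm) simp_all
  then interpret o: okubo_algebra smul mul n 1 1 \<psi> .
  let ?u = "o.z Z01 + o.z Z11 + o.z Z21" and ?x = "o.z Z02 - o.z Z12"
  let ?v = "o.z Z10 + o.z Z11 + o.z Z12" and ?y = "o.z Z20 - o.z Z21"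
  note x = o.pendant_Z02_Z12[OF refl] and y = o.pendant_Z20_Z21[OF refl refl]
  have dist: "3 \<le> j" if "(L ?u, L ?v) \<in> E ^^ j" for j
    using square_zero_distance[OF x(1,2) y(1,2) _ that] y(6) by simp
  have "L ?u \<noteq> L ?v"
    using dist[of 0] by auto
  then have pw: "L ?x \<in> V0 smul mul n" "L ?y \<in> V0 smul mul n"
    "(L ?x, L ?y) \<in> E ^^ k \<Longrightarrow> \<exists>j. k = Suc (Suc j) \<and> (L ?u, L ?v) \<in> E ^^ j" for k
    using pendants_walk[OF x(2) y(2) _ x(3,4) _ x(5) y(3), of 1] x(1) y(1,4,5) by simp_all
  have "graph_diameter (\<Gamma> \<restriction> V0 smul mul n) = ereal (real 5)"
  proof (rule graph_diameter_closed_eqI[OF V0_closed pw(1,2)])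
    show "(a, b) \<in> (E\<^sup>=) ^^ 5" if "a \<in> V0 smul mul n" "b \<in> V0 smul mul n" for a b
      by (rule V0_upper[OF square_zero_path3[OF \<omega>] that]) simp_all
    show "(L ?x, L ?y) \<notin> E ^^ k" if "k < 5" for k
      using pw(3)[of k] dist that by fastforce
  qed
  then show ?thesis
    by simp
qed

text \<open>Non-splitness makes b a non-cube, so distinct square-zero lines are adjacent; pendants
  on two of them are at distance 1 + 2.\<close>

lemma V0_diameter_nonsplit:
  assumes 3: "(3 :: 'f) = 0" and idem: "has_nonzero_idempotent mul" and nonsplit: "\<not> split_okubo smul mul"
  shows "graph_diameter (\<Gamma> \<restriction> V0 smul mul n) = 3"
proof -
  obtain b \<psi> where "okubo_algebra smul mul n 1 b \<psi>"
    using exists_iso_char_3[OF 3 idem] .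
  then interpret o: okubo_algebra smul mul n 1 b \<psi> .
  have ncube: "b \<notin> range (\<lambda>a. a ^ 3)"
    using o.split_if_cube nonsplit by blast
  let ?u = "o.z Z01 + o.z Z11 + o.z Z21" and ?x = "o.z Z02 - o.z Z12"
  let ?v = "o.z Z02 + o.z Z12 + o.z Z22" and ?y = "o.z Z01 - o.z Z11"
  note x = o.pendant_Z02_Z12[OF refl] and y = o.pendant_Z01_Z11[OF refl]
  have "L ?u \<noteq> L ?v"
  proof
    assume "L ?u = L ?v"
    then obtain c where "?v = c \<odot> ?u"
      using L_eq_iff x(1) y(1) by blast
    then have "\<psi> ?v $ Z02 = \<psi> (c \<odot> ?u) $ Z02"
      by simp
    then show False
      by (simp add: o.\<phi>_simps o.\<phi>_z axis_def)
  qed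
  then have pw: "L ?x \<in> V0 smul mul n" "L ?y \<in> V0 smul mul n"
    "(L ?x, L ?y) \<in> E ^^ k \<Longrightarrow> \<exists>j. k = Suc (Suc j) \<and> (L ?u, L ?v) \<in> E ^^ j" for k
    using pendants_walk[OF x(2) y(2) _ x(3,4) _ x(5) y(3), of 1] x(1) y(1,4,5) o.\<beta> by simp_all
  have path: "(L u, L v) \<in> (E\<^sup>=) ^^ 1" if "u \<noteq> 0" "u \<star> u = 0" "v \<noteq> 0" "v \<star> v = 0" for u v
    using that o.square_zero_mul_char_3[OF refl 3 ncube] E_reflI[of u v] square_zero_in_Z
    by (simp add: orthogonalizer_def)
  have "graph_diameter (\<Gamma> \<restriction> V0 smul mul n) = ereal (real 3)"
  proof (rule graph_diameter_closed_eqI[OF V0_closed pw(1,2)])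
    show "(a, b) \<in> (E\<^sup>=) ^^ 3" if "a \<in> V0 smul mul n" "b \<in> V0 smul mul n" for a b
      by (rule V0_upper[OF path that]) simp_all
    show "(L ?x, L ?y) \<notin> E ^^ k" if "k < 3" for k
      using pw(3)[of k] \<open>L ?u \<noteq> L ?v\<close> that by (auto simp: less_Suc_eq numeral_3_eq_3)
  qed
  then show ?thesis
    by simp
qed

context
  assumes 3: "(3 :: 'f) \<noteq> 0" and no_root: "\<And>t :: 'f. t\<^sup>2 + t + 1 \<noteq> 0"
begin

text \<open>For y orthogonal to x, either y*y = 0 and y spans the line of x, or y*y spans it. In
  both cases everything orthogonal to y is orthogonal to x.\<close>

lemma Vx'_closed:
  assumes x: "x \<noteq> 0" "x \<star> x = 0" and "u \<in> Vx' smul mul x" "(u, w) \<in> E"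
  shows "w \<in> Vx' smul mul x"
proof -
  obtain y where y: "u = L y" "y \<noteq> 0" "y \<in> Orth x"
    using assms(3) by (auto simp: Vx'_def)
  note ny = Orth_square_zero[OF x y(3)]
  have "y \<in> Z"
    using ny y by (simp add: Z_iff)
  then obtain b where b: "b \<in> Z" "w = L b" "b \<in> Orth y"
    using assms(4) y(1) by (auto elim: E_cases)
  have "b \<in> Orth x"
  proof (cases "y \<star> y = 0")
    case True
    then obtain c where "y = c \<odot> x"
      using square_zero_in_Orth_no_root[OF 3 no_root x y(3)] by blast
    then show ?thesis
      using b(3) y(2) Orth_of_smul[of c x] by auto
  next
    case False
    obtain k where k: "y \<star> y = k \<odot> x"
      using ny(2) by blast
    have "b \<in> Orth (y \<star> y)"
      using Orth_subset_Orth_square[OF ny(1,3)] b(3) by blast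
    then show ?thesis
      using k False Orth_of_smul[of k x] by auto
  qed
  then show ?thesis
    using b by (auto simp: Vx'_def Z_iff)
qed

text \<open>x is joined to every other vertex. If b*b is nonzero, b and b + x span distinct lines
  that are not adjacent, since b*(b+x) = b*b.\<close>

lemma Vx'_diameter:
  assumes x: "x \<noteq> 0" "x \<star> x = 0"
  shows "graph_diameter (\<Gamma> \<restriction> Vx' smul mul x) = 2"
proof -
  obtain v where "N x v = 1"
    using exists_dual[OF x(1)] .
  then interpret s: square_zero smul mul n \<alpha> \<beta> \<phi> x v
    by unfold_locales (use x in auto)
  obtain b where b: "b \<in> Orth x" "N v (b \<star> b) \<noteq> 0"
    using s.exists_square_nonzero_in_Orth_u[OF 3] by blast
  then have bb: "b \<star> b \<noteq> 0"
    by auto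
  let ?c = "b + x"
  have c: "?c \<in> Orth x" "b \<star> ?c = b \<star> b"
    using b(1) x(2) by (simp_all add: orthogonalizer_def mul_simps)
  have nz: "b \<noteq> 0" "?c \<noteq> 0"
    using bb c(2) by auto
  then have Z: "b \<in> Z" "?c \<in> Z"
    using Orth_square_zero(1)[OF x] b(1) c(1) by (simp_all add: Z_iff)
  have "L b \<noteq> L ?c"
  proof
    assume "L b = L ?c"
    then obtain k where "b + x = k \<odot> b"
      using L_eq_iff nz by blast
    then have k: "x = (k - 1) \<odot> b"
      by (simp add: vs.scale_left_diff_distrib algebra_simps)
    then have "((k - 1) * (k - 1)) \<odot> (b \<star> b) = x \<star> x"
      by (simp add: mul_simps)
    then have "k - 1 = 0"
      using bb x(2) by simp
    then show False
      using k x(1) by simp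
  qed
  moreover have "(L b, L ?c) \<notin> E"
    using E_iff[OF Z] c(2) bb by (simp add: orthogonalizer_def)
  ultimately have lower: "(L b, L ?c) \<notin> E ^^ k" if "k < 2" for k
    using that by (auto simp: less_Suc_eq numeral_2_eq_2)
  have xZ: "x \<in> Z"
    using square_zero_in_Z x by blast
  have upper: "(a, b) \<in> (E\<^sup>=) ^^ 2" if "a \<in> Vx' smul mul x" "b \<in> Vx' smul mul x" for a b
  proof -
    obtain y y' where y: "a = L y" "b = L y'" "y \<noteq> 0" "y' \<noteq> 0" "y \<in> Orth x" "y' \<in> Orth x"
      using \<open>a \<in> _\<close> \<open>b \<in> _\<close> by (auto simp: Vx'_def)
    then have "y \<in> Z" "y' \<in> Z"
      using Orth_square_zero(1)[OF x] by (simp_all add: Z_iff)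
    then have "(a, L x) \<in> E\<^sup>=" "(L x, b) \<in> E\<^sup>="
      using y xZ E_reflI Orth_sym by metis+
    then show ?thesis
      by (rule relpow_2I)
  qed
  have "graph_diameter (\<Gamma> \<restriction> Vx' smul mul x) = ereal (real 2)"
  proof (rule graph_diameter_closed_eqI[where u = "L b" and v = "L ?c"])
    show "L b \<in> Vx' smul mul x" "L ?c \<in> Vx' smul mul x"
      using nz b(1) c(1) by (auto simp: Vx'_def)
  qed (use Vx'_closed[OF x] upper lower in blast)+
  then show ?thesis
    by simp
qed

lemma Vx'_reachable:
  assumes x: "x \<noteq> 0" "x \<star> x = 0" and "u \<in> Vx' smul mul x" "w \<in> Vx' smul mul x"
  shows "u \<rightarrow>\<^sup>*\<^bsub>\<Gamma>\<^esub> w"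
proof -
  obtain y y' where y: "u = L y" "w = L y'" "y \<noteq> 0" "y' \<noteq> 0" "y \<in> Orth x" "y' \<in> Orth x"
    using assms(3,4) by (auto simp: Vx'_def)
  then have Z: "y \<in> Z" "y' \<in> Z"
    using Orth_square_zero(1)[OF x] by (simp_all add: Z_iff)
  have "(u, L x) \<in> E\<^sup>=" "(L x, w) \<in> E\<^sup>="
    using y Z x E_reflI Orth_sym square_zero_in_Z by metis+
  then have "(u, w) \<in> (E\<^sup>=) ^^ 2"
    by (rule relpow_2I)
  then show ?thesis
    by (rule reachable_of_relpow[OF wf_\<Gamma>]) (use y Z in \<open>simp add: verts_\<Gamma>\<close>)
qed

end

lemma Vx_nonempty: "L (z Z10) \<in> verts \<Gamma>" "g (z i) \<noteq> 0"
  using \<alpha> \<beta> by (simp add: verts_\<Gamma> Z_iff z_nonzero, cases i) (simp_all add: g_coord \<phi>_z axis_def)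

text \<open>The lines of z10 and z20 form a set closed under adjacency that misses the line of
  z01.\<close>

lemma not_connected: "\<not> Digraph_Component.connected \<Gamma>"
proof
  interpret wf_digraph \<Gamma>
    by (rule wf_\<Gamma>)
  assume "Digraph_Component.connected \<Gamma>"
  moreover have "symmetric \<Gamma>"
    using sym_E by (simp add: symmetric_def)
  moreover have Z: "z i \<in> Z" for i
    by (simp add: Z_iff z_nonzero)
  ultimately have "L (z Z10) \<rightarrow>\<^sup>*\<^bsub>\<Gamma>\<^esub> L (z Z01)"
    using reachable_mk_symmetric_eq
    by (simp add: Digraph_Component.connected_def strongly_connected_def verts_\<Gamma>)
  then have "L (z Z01) \<in> Vx smul mul (z Z10)"
  proof (induction rule: reachable_induct)
    case (step x y)
    then show ?case
      using Vx_closed[OF Z Vx_nonempty(2)] by blast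
  qed (simp add: Vx_def)
  moreover have "z Z10 \<star> z Z10 = z Z20"
    by (simp add: coord_simps)
  ultimately obtain i c where "i \<in> {Z10, Z20}" "z i = c \<odot> z Z01"
    using L_eq_iff z_nonzero by (auto simp: Vx_def)
  then have "\<phi> (z i) $ i = \<phi> (c \<odot> z Z01) $ i"
    by simp
  then show False
    using \<open>i \<in> _\<close> by (auto simp: \<phi>_simps \<phi>_z axis_def)
qed

end

section \<open>Field conditions and assembly of the components\<close>

lemma CHAR_eq_3_iff: "CHAR('f::field) = 3 \<longleftrightarrow> (3 :: 'f) = 0"
proof
  assume "CHAR('f) = 3"
  then show "(3 :: 'f) = 0"
    using of_nat_CHAR[where 'a = 'f] by simp
next
  assume "(3 :: 'f) = 0"
  then have "of_nat 3 = (0 :: 'f)"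
    by simp
  then have "CHAR('f) dvd 3"
    by (simp only: of_nat_eq_0_iff_char_dvd)
  then have "CHAR('f) \<le> 3" "CHAR('f) dvd 3"
    by (auto dest: dvd_imp_le)
  moreover have "CHAR('f) \<noteq> 1"
    using of_nat_CHAR[where 'a = 'f] by auto
  moreover have "\<not> 2 dvd (3 :: nat)" "\<not> 0 dvd (3 :: nat)"
    by simp_all
  ultimately show "CHAR('f) = 3"
    by (metis One_nat_def le_SucE le_zero_eq numeral_2_eq_2 numeral_3_eq_3)
qed

text \<open>From t^3 - 1 = (t-1)(t^2+t+1); the value t = 1 is a root of the second factor only if 3
  = 0.\<close>

lemma exists_root_iff:
  "(\<exists>t :: 'f::field. t\<^sup>2 + t + 1 = 0) \<longleftrightarrow> (3 :: 'f) = 0 \<or> (\<exists>w :: 'f. primitive_cube_root_of_unity w)"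
proof
  assume "\<exists>t :: 'f. t\<^sup>2 + t + 1 = 0"
  then obtain t :: 'f where t: "t\<^sup>2 + t + 1 = 0"
    by blast
  have "t ^ 3 - 1 = (t - 1) * (t\<^sup>2 + t + 1)"
    by (simp add: power2_eq_square power3_eq_cube algebra_simps)
  then have "t ^ 3 = 1"
    by (simp add: t)
  moreover have "(3 :: 'f) = 0" if "t = 1"
    using t that by simp
  moreover have "(3 :: 'f) = 0" if "t\<^sup>2 = 1"
  proof -
    have "t = - 2"
      using t that by (simp add: eq_neg_iff_add_eq_0 algebra_simps)
    then have "4 = (1 :: 'f)"
      using that by simp
    moreover have "3 = 4 - (1 :: 'f)"
      by simp
    ultimately show ?thesis
      by simp
  qed
  ultimately show "(3 :: 'f) = 0 \<or> (\<exists>w :: 'f. primitive_cube_root_of_unity w)"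
    unfolding primitive_cube_root_of_unity_def by blast
next
  assume "(3 :: 'f) = 0 \<or> (\<exists>w :: 'f. primitive_cube_root_of_unity w)"
  then show "\<exists>t :: 'f. t\<^sup>2 + t + 1 = 0"
  proof
    assume "(3 :: 'f) = 0"
    then have "(1 :: 'f)\<^sup>2 + 1 + 1 = 0"
      by simp
    then show ?thesis
      by blast
  next
    assume "\<exists>w :: 'f. primitive_cube_root_of_unity w"
    then obtain w :: 'f where w: "w ^ 3 = 1" "w \<noteq> 1"
      by (auto simp: primitive_cube_root_of_unity_def)
    have "w ^ 3 - 1 = (w - 1) * (w\<^sup>2 + w + 1)"
      by (simp add: power2_eq_square power3_eq_cube algebra_simps)
    then have "w\<^sup>2 + w + 1 = 0"
      using w by simp
    then show ?thesis
      by blast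
  qed
qed

context okubo_algebra
begin

lemma V0_reachable:
  fixes \<omega> :: 'f
  assumes \<omega>: "\<omega>\<^sup>2 + \<omega> + 1 = 0" and "u \<in> V0 smul mul n" "w \<in> V0 smul mul n"
  shows "u \<rightarrow>\<^sup>*\<^bsub>\<Gamma>\<^esub> w"
proof (rule reachable_of_relpow[OF wf_\<Gamma>])
  show "(u, w) \<in> (E\<^sup>=) ^^ 5"
    by (rule V0_upper[OF square_zero_path3[OF \<omega>] assms(2,3)]) simp_all
  show "u \<in> verts \<Gamma>"
    using assms(2) by (auto simp: V0_def verts_\<Gamma>)
qed

lemma Vx_reachable:
  assumes "x \<in> Z" "g x \<noteq> 0" "u \<in> Vx smul mul x" "w \<in> Vx smul mul x"
  shows "u \<rightarrow>\<^sup>*\<^bsub>\<Gamma>\<^esub> w"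
proof (rule reachable_of_relpow[OF wf_\<Gamma>])
  show "(u, w) \<in> (E\<^sup>=) ^^ 1"
    using Vx_upper[OF assms] by simp
  show "u \<in> verts \<Gamma>"
    using assms(1,3) square_of_g_nonzero(1)[OF assms(1,2)] by (auto simp: Vx_def verts_\<Gamma>)
qed

lemma components:
  fixes case2 case3 :: bool
  defines "case2 \<equiv> has_nonzero_idempotent mul \<and> (3 :: 'f) \<noteq> 0 \<and> (\<forall>t :: 'f. t\<^sup>2 + t + 1 \<noteq> 0)"
    and "case3 \<equiv> has_nonzero_idempotent mul \<and> (\<exists>t :: 'f. t\<^sup>2 + t + 1 = 0)"
  shows "pre_digraph.sccs_verts \<Gamma> =
    {Vx smul mul x | x. x \<in> Z \<and> g x \<noteq> 0}
    \<union> (if case2 then {Vx' smul mul x | x. x \<in> Z \<and> x \<star> x = 0} else {})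
    \<union> (if case3 then {V0 smul mul n} else {})" (is "_ = ?P")
proof (rule sccs_verts_eqI[OF wf_\<Gamma>])
  have members: "thesis" if C: "C \<in> ?P"
    and "\<And>x. x \<in> Z \<Longrightarrow> g x \<noteq> 0 \<Longrightarrow> C = Vx smul mul x \<Longrightarrow> thesis"
    and "\<And>x. case2 \<Longrightarrow> x \<in> Z \<Longrightarrow> x \<noteq> 0 \<Longrightarrow> x \<star> x = 0 \<Longrightarrow> C = Vx' smul mul x \<Longrightarrow> thesis"
    and "case3 \<Longrightarrow> C = V0 smul mul n \<Longrightarrow> thesis" for C thesis
    using that Z_iff by (auto split: if_splits)
  show "\<Union> ?P = verts \<Gamma>"
  proof (intro equalityI subsetI)
    fix w assume "w \<in> \<Union> ?P"
    then obtain C where "C \<in> ?P" "w \<in> C"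
      by blast
    then show "w \<in> verts \<Gamma>"
    proof (elim members)
      fix x assume "x \<in> Z" "g x \<noteq> 0" "C = Vx smul mul x"
      then show ?thesis
        using \<open>w \<in> C\<close> square_of_g_nonzero(1) by (auto simp: Vx_def verts_\<Gamma>)
    next
      fix x assume "x \<in> Z" "x \<noteq> 0" "x \<star> x = 0" "C = Vx' smul mul x"
      then show ?thesis
        using \<open>w \<in> C\<close> Orth_square_zero(1) by (auto simp: Vx'_def verts_\<Gamma> Z_iff)
    next
      assume "C = V0 smul mul n"
      then show ?thesis
        using \<open>w \<in> C\<close> by (auto simp: V0_def verts_\<Gamma>)
    qed
  next
    fix w assume "w \<in> verts \<Gamma>"
    then obtain x where x: "x \<in> Z" "w = L x"
      by (auto simp: verts_\<Gamma>)
    show "w \<in> \<Union> ?P"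
    proof (cases "g x = 0")
      case False
      then have "Vx smul mul x \<in> ?P" "w \<in> Vx smul mul x"
        using x by (auto simp: Vx_def)
      then show ?thesis
        by blast
    next
      case True
      \<comment> \<open>A vertex with g = 0 yields a square-zero element and hence an idempotent,
        after which only the field decides between the two cases.\<close>
      have "has_nonzero_idempotent mul"
        using exists_square_zero_of_g_eq_0[OF _ _ True] x exists_square_zero_iff_idempotent
        by (auto simp: Z_iff)
      then consider case2 | case3
        using case2_def case3_def exists_root_iff[where 'f = 'f] by blast
      then show ?thesis
      proof cases
        case 1
        \<comment> \<open>u is the centre of the component of [x], either x itself or its
          square.\<close>
        define u where "u = (if x \<star> x = 0 then x else x \<star> x)"
        have "u \<star> u = 0"
          using x True square_square_isotropic by (simp add: u_def Z_iff)
        moreover have "u \<in> Z"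
          using x square_in_Z by (simp add: u_def)
        moreover have "x \<in> Orth u"
          using x square_in_Orth[of x] Orth_sym by (auto simp: u_def Z_iff orthogonalizer_def)
        ultimately have "Vx' smul mul u \<in> ?P" "w \<in> Vx' smul mul u"
          using x 1 by (auto simp: Vx'_def Z_iff)
        then show ?thesis
          by blast
      next
        case 2
        then have "V0 smul mul n \<in> ?P" "w \<in> V0 smul mul n"
          using x True by (simp_all add: V0_iff)
        then show ?thesis
          by blast
      qed
    qed
  qed
  show "{} \<notin> ?P"
  proof
    assume "{} \<in> ?P"
    then show False
    proof (rule members)
      fix x assume "x \<in> Z" "x \<noteq> 0" "x \<star> x = 0" "{} = Vx' smul mul x"
      then show False
        by (auto simp: Vx'_def orthogonalizer_def)
    next
      assume case3 and empty: "{} = V0 smul mul n"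
      then obtain u where "u \<noteq> 0" "u \<star> u = 0"
        using exists_square_zero_iff_idempotent by (auto simp: case3_def)
      then have "L u \<in> V0 smul mul n"
        using V0_iff square_zero_in_Z by simp
      then show False
        using empty by blast
    qed (simp add: Vx_def)
  qed
  show "w \<in> C" if "C \<in> ?P" "u \<in> C" "(u, w) \<in> E" for C u w
    using that(1)
  proof (rule members)
    fix x assume "x \<in> Z" "g x \<noteq> 0" "C = Vx smul mul x"
    then show ?thesis
      using Vx_closed that by blast
  next
    fix x assume case2 "x \<noteq> 0" "x \<star> x = 0" "C = Vx' smul mul x"
    then show ?thesis
      using Vx'_closed that by (auto simp: case2_def)
  next
    assume "C = V0 smul mul n"
    then show ?thesis
      using V0_closed that by blast
  qed
  show "u \<rightarrow>\<^sup>*\<^bsub>\<Gamma>\<^esub> w" if "C \<in> ?P" "u \<in> C" "w \<in> C" for C u w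
    using that(1)
  proof (rule members)
    fix x assume "x \<in> Z" "g x \<noteq> 0" "C = Vx smul mul x"
    then show ?thesis
      using Vx_reachable that by blast
  next
    fix x assume case2 "x \<noteq> 0" "x \<star> x = 0" "C = Vx' smul mul x"
    then show ?thesis
      using Vx'_reachable that by (auto simp: case2_def)
  next
    assume case3 "C = V0 smul mul n"
    then show ?thesis
      using V0_reachable that by (auto simp: case3_def)
  qed
qed

lemma split_if_idempotent:
  assumes "has_nonzero_idempotent mul" "(3 :: 'f) \<noteq> 0"
  shows "split_okubo smul mul"
proof -
  obtain u where "u \<noteq> 0" "u \<star> u = 0"
    using assms(1) exists_square_zero_iff_idempotent by blast
  then obtain \<psi> where "okubo_algebra smul mul n 1 1 \<psi>"
    using split_iso_of_square_zero[OF assms(2)] by metis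
  then show ?thesis
    unfolding okubo_algebra_def split_okubo_def by blast
qed

lemma V0_diameter:
  assumes "has_nonzero_idempotent mul" "\<exists>t :: 'f. t\<^sup>2 + t + 1 = 0"
  shows "graph_diameter (\<Gamma> \<restriction> V0 smul mul n) = (if split_okubo smul mul then 5 else 3)"
  using assms V0_diameter_split V0_diameter_nonsplit split_if_idempotent by (metis (full_types))

end

theorem theorem3p15:
  fixes smul :: "'f::field \<Rightarrow> 'a::ab_group_add \<Rightarrow> 'a"
    and mul :: "'a \<Rightarrow> 'a \<Rightarrow> 'a"
    and n :: "'a \<Rightarrow> 'f"
  assumes "isotropic_okubo smul mul n"
  shows
    "let \<Gamma> = orthogonality_graph smul mul;
         Z = zero_divisors mul;
         idem = has_nonzero_idempotent mul;
         root = (\<exists>w::'f. primitive_cube_root_of_unity w);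
         case2 = (idem \<and> CHAR('f) \<noteq> 3 \<and> \<not> root);
         case3 = (idem \<and> (CHAR('f) = 3 \<or> root))
     in
       verts \<Gamma> \<noteq> {} \<and> \<not> Digraph_Component.connected \<Gamma> \<and>
       pre_digraph.sccs_verts \<Gamma> =
         {Vx smul mul x | x. x \<in> Z \<and> polar n x (mul x x) \<noteq> 0}
         \<union> (if case2 then {Vx' smul mul x | x. x \<in> Z \<and> mul x x = 0} else {})
         \<union> (if case3 then {V0 smul mul n} else {}) \<and>
       (\<forall>x\<in>Z. polar n x (mul x x) \<noteq> 0 \<longrightarrow>
          graph_diameter (\<Gamma> \<restriction> Vx smul mul x) = 1) \<and>
       (case2 \<longrightarrow> (\<forall>x\<in>Z. mul x x = 0 \<longrightarrow>
          graph_diameter (\<Gamma> \<restriction> Vx' smul mul x) = 2)) \<and>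
       (case3 \<longrightarrow>
          graph_diameter (\<Gamma> \<restriction> V0 smul mul n) = (if split_okubo smul mul then 5 else 3)) \<and>
       (idem \<and> CHAR('f) \<noteq> 3 \<longrightarrow> split_okubo smul mul)"
proof -
  obtain \<alpha> \<beta> \<phi> where "okubo_algebra smul mul n \<alpha> \<beta> \<phi>"
    using assms unfolding isotropic_okubo_def okubo_algebra_def by fastforce
  then interpret okubo_algebra smul mul n \<alpha> \<beta> \<phi> .
  have root: "CHAR('f) = 3 \<or> (\<exists>w :: 'f. primitive_cube_root_of_unity w) \<longleftrightarrow> (\<exists>t :: 'f. t\<^sup>2 + t + 1 = 0)"
    by (simp only: CHAR_eq_3_iff exists_root_iff)
  then have case2: "CHAR('f) \<noteq> 3 \<and> \<not> (\<exists>w :: 'f. primitive_cube_root_of_unity w) \<longleftrightarrow>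
      (3 :: 'f) \<noteq> 0 \<and> (\<forall>t :: 'f. t\<^sup>2 + t + 1 \<noteq> 0)"
    using CHAR_eq_3_iff[where 'f = 'f] by blast
  show ?thesis
    unfolding Let_def root case2 unfolding CHAR_eq_3_iff
  proof (intro conjI ballI impI; (elim conjE)?)
    show "verts \<Gamma> \<noteq> {}"
      using Vx_nonempty by blast
    show "\<not> Digraph_Component.connected \<Gamma>"
      by (rule not_connected)
    show "graph_diameter (\<Gamma> \<restriction> Vx smul mul x) = 1" if "x \<in> Z" "g x \<noteq> 0" for x
      using Vx_diameter that .
    show "graph_diameter (\<Gamma> \<restriction> Vx' smul mul x) = 2"
      if "x \<in> Z" "mul x x = 0" "(3 :: 'f) \<noteq> 0" "\<forall>t :: 'f. t\<^sup>2 + t + 1 \<noteq> 0" for x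
      using Vx'_diameter[of x] that by (simp add: Z_iff)
  qed (use components V0_diameter split_if_idempotent in blast)+
qed

end
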